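(* For all positive integers $r,c$, as formal power series in $s$ with coefficients in $\mathbb{Q}(q,t)$, $$ \sum_{\pi \in \mathcal{P}(r,c)}F_\pi(q,t)\,s^{|\pi|}=\prod_{i=1}^{r}\prod_{j=1}^{c} \frac{(ts^{i+j-1};q)_\infty}{(s^{i+j-1};q)_{\infty}}. $$ In particular, $$ \sum_{\pi \in \mathcal{P}}F_\pi(q,t)\,s^{|\pi|}=\prod_{n=1}^{\infty} \left[\frac{(ts^{n};q)_\infty}{(s^{n};q)_{\infty}}\right]^n. $$
   Context: A plane partition is an array $\pi=(\pi(i,j))_{i,j\ge 1}$ of nonnegative integers, only finitely many nonzero, that is nonincreasing along each row and each column; its support is the set of boxes $(i,j)$ with $\pi(i,j)>0$ and its weight is $|\pi|=\sum_{i,j}\pi(i,j)$. $\mathcal{P}$ is the set of all plane partitions and $\mathcal{P}(r,c)$ the set of those with $\pi(i,j)=0$ whenever $i>r$ or $j>c$. $(s;q)_\infty=\prod_{n\ge0}(1-sq^n)$. For nonnegative integers $n,m$ let $f(n,m)=\prod_{i=0}^{n-1}\frac{1-q^{i}t^{m+1}}{1-q^{i+1}t^{m}}$ if $n\ge1$ and $f(0,m)=1$. For a box $(i,j)$ in the support of $\pi$ define the partitions $\lambda=(\pi(i,j),\pi(i+1,j+1),\dots)$, $\mu=(\pi(i+1,j),\pi(i+2,j+1),\dots)$, $\nu=(\pi(i,j+1),\pi(i+1,j+2),\dots)$ and set $$F_\pi(i,j)(q,t)=\prod_{m=0}^{\infty}\frac{f(\lambda_1-\mu_{m+1},m)\,f(\lambda_1-\nu_{m+1},m)}{f(\lambda_1-\lambda_{m+1},m)\,f(\lambda_1-\lambda_{m+2},m)}$$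 (only finitely many factors differ from 1). Then $F_\pi(q,t)=\prod_{(i,j)\in\text{support of }\pi}F_\pi(i,j)(q,t)$. *)

theory Defs
  imports "HOL-Analysis.Analysis" "HOL-Computational_Algebra.Computational_Algebra"
    "HOL-Library.Groups_Big_Fun"
begin

(* Q(q,t) is the fraction field of Q[t][q]: q is the outer variable, t the inner one. *)

type_synonym ratqt = "rat poly poly fract"

definition Qvar :: ratqt where "Qvar = Fract [:0, 1:] 1"

definition Tvar :: ratqt where "Tvar = Fract [:[:0, 1:]:] 1"

(* Arrays are indexed by i, j >= 1; the unused entries with i = 0 or j = 0 are fixed to be 0,
   so that each plane partition is represented by exactly one function. *)

definition plane_partitions :: "(nat \<Rightarrow> nat \<Rightarrow> nat) set" where
  "plane_partitions = {\<pi>.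
     (\<forall>i j. i = 0 \<or> j = 0 \<longrightarrow> \<pi> i j = 0) \<and>
     finite {(i, j). \<pi> i j > 0} \<and>
     (\<forall>i\<ge>1. \<forall>j\<ge>1. \<pi> (i + 1) j \<le> \<pi> i j \<and> \<pi> i (j + 1) \<le> \<pi> i j)}"

definition plane_partitions_in :: "nat \<Rightarrow> nat \<Rightarrow> (nat \<Rightarrow> nat \<Rightarrow> nat) set" where
  "plane_partitions_in r c =
     {\<pi> \<in> plane_partitions. \<forall>i j. i > r \<or> j > c \<longrightarrow> \<pi> i j = 0}"

definition pp_support :: "(nat \<Rightarrow> nat \<Rightarrow> nat) \<Rightarrow> (nat \<times> nat) set" where
  "pp_support \<pi> = {(i, j). \<pi> i j > 0}"

definition pp_weight :: "(nat \<Rightarrow> nat \<Rightarrow> nat) \<Rightarrow> nat" where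
  "pp_weight \<pi> = (\<Sum>(i, j)\<in>pp_support \<pi>. \<pi> i j)"

definition f_factor :: "'a::field \<Rightarrow> 'a \<Rightarrow> nat \<Rightarrow> nat \<Rightarrow> 'a" where
  "f_factor q t n m = (\<Prod>i<n. (1 - q ^ i * t ^ (m + 1)) / (1 - q ^ (i + 1) * t ^ m))"

(* The k-th part, k >= 1, of the partition read along the diagonal starting at box (i, j). *)

definition diag_part :: "(nat \<Rightarrow> nat \<Rightarrow> nat) \<Rightarrow> nat \<Rightarrow> nat \<Rightarrow> nat \<Rightarrow> nat" where
  "diag_part \<pi> i j k = \<pi> (i + k - 1) (j + k - 1)"

(* Prod_any is the product over the m whose factor differs from 1. The truncated
   subtractions are genuine ones: lam 1 is the entry of \<pi> at (i, j), which bounds all entries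
   to the south-east of it. *)

definition F_box :: "'a::field \<Rightarrow> 'a \<Rightarrow> (nat \<Rightarrow> nat \<Rightarrow> nat) \<Rightarrow> nat \<Rightarrow> nat \<Rightarrow> 'a" where
  "F_box q t \<pi> i j =
     (let lam = diag_part \<pi> i j; mu = diag_part \<pi> (i + 1) j; nu = diag_part \<pi> i (j + 1)
      in Prod_any (\<lambda>m.
           (f_factor q t (lam 1 - mu (m + 1)) m * f_factor q t (lam 1 - nu (m + 1)) m) /
           (f_factor q t (lam 1 - lam (m + 1)) m * f_factor q t (lam 1 - lam (m + 2)) m)))"

definition F_pp :: "'a::field \<Rightarrow> 'a \<Rightarrow> (nat \<Rightarrow> nat \<Rightarrow> nat) \<Rightarrow> 'a" where
  "F_pp q t \<pi> = (\<Prod>(i, j)\<in>pp_support \<pi>. F_box q t \<pi> i j)"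

(* Convergence in Q(q,t) for the q-adic valuation, i.e. for the topology induced by the
   inclusion of Q(q,t) into the Laurent series field Q(t)((q)): a fraction a/b with b not
   divisible by q is one of nonnegative valuation. *)

definition qadic_tendsto :: "(nat \<Rightarrow> ratqt) \<Rightarrow> ratqt \<Rightarrow> bool" where
  "qadic_tendsto x l \<longleftrightarrow>
     (\<forall>N. \<forall>\<^sub>F n in sequentially.
        \<exists>a b. \<not> [:0, 1:] dvd b \<and> x n - l = Qvar ^ N * Fract a b)"

lemma qadic_tendsto_unique:
  assumes "qadic_tendsto x l" "qadic_tendsto x l'"
  shows "l = l'"
proof (rule ccontr)
  let ?q = "[:0, 1:] :: rat poly poly"
  assume "l \<noteq> l'"
  obtain c d where cd: "l' - l = Fract c d" "d \<noteq> 0"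
    by (cases "l' - l") auto
  have c0: "c \<noteq> 0"
    using \<open>l \<noteq> l'\<close> cd by (auto simp: fract_collapse)
  have prime: "prime_elem ?q"
    unfolding prime_elem_def
  proof (intro conjI allI impI)
    show "\<not> ?q dvd 1" using poly_eq_0_iff_dvd[of 1 "0 :: rat poly"] by simp
    fix u v assume "?q dvd u * v"
    thus "?q dvd u \<or> ?q dvd v"
      using poly_eq_0_iff_dvd[of "u * v" 0] poly_eq_0_iff_dvd[of u 0] poly_eq_0_iff_dvd[of v 0]
      by simp
  qed simp
  have Qpow: "Qvar ^ N = Fract (?q ^ N) 1" for N
    by (induction N) (simp_all add: Qvar_def One_fract_def)
  have "?q ^ N dvd c" for N
  proof -
    have "\<forall>\<^sub>F n in sequentially.
        (\<exists>a b. \<not> ?q dvd b \<and> x n - l = Qvar ^ N * Fract a b) \<and>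
        (\<exists>a b. \<not> ?q dvd b \<and> x n - l' = Qvar ^ N * Fract a b)"
      using assms unfolding qadic_tendsto_def by (intro eventually_conj) blast+
    then obtain n a b a' b' where n: "\<not> ?q dvd b" "x n - l = Qvar ^ N * Fract a b"
        "\<not> ?q dvd b'" "x n - l' = Qvar ^ N * Fract a' b'"
      by (auto dest!: eventually_happens)
    have b: "b \<noteq> 0" "b' \<noteq> 0" using n by auto
    have "l' - l = (x n - l) - (x n - l')" by simp
    also have "\<dots> = Qvar ^ N * (Fract a b - Fract a' b')"
      using n by (simp only: right_diff_distrib)
    also have "\<dots> = Fract (?q ^ N * (a * b' - a' * b)) (b * b')"
      using b by (simp add: Qpow)
    finally have "c * (b * b') = ?q ^ N * (a * b' - a' * b) * d"
      using cd b by (simp add: eq_fract)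
    hence "(b * b') * c = ?q ^ N * ((a * b' - a' * b) * d)"
      by (simp only: mult.assoc mult.commute[of _ c])
    hence "?q ^ N dvd (b * b') * c"
      by (metis dvd_triv_left)
    moreover have "\<not> ?q dvd b * b'"
      using n prime by (simp add: prime_elem_dvd_mult_iff)
    ultimately show ?thesis
      using prime_power_dvd_multD[OF prime, of N "b * b'" c] by (cases "N = 0") auto
  qed
  hence "degree (?q ^ N) \<le> degree c" for N
    using c0 by (intro dvd_imp_degree_le) auto
  hence "degree (?q ^ Suc (degree c)) \<le> degree c" by blast
  thus False by (simp add: degree_power_eq)
qed

(* The infinite product (S;q)_\<infinity> in Q(q,t)[[s]]: each coefficient of the power series is the
   q-adic limit of the corresponding coefficients of the partial products. The topology on
   fps is not the right one here: it makes the coefficients discrete, and the partial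
   products do not converge in it. *)

definition qpoch_inf :: "ratqt fps \<Rightarrow> ratqt fps" where
  "qpoch_inf S = Abs_fps (\<lambda>N. THE l.
     qadic_tendsto (\<lambda>n. fps_nth (\<Prod>k<n. 1 - S * fps_const (Qvar ^ k)) N) l)"

end

theory Submission
  imports Defs
begin

text \<open>Along its diagonals a plane partition is a chain of partitions, increasing in the sense of
  interlacing up to the main diagonal and decreasing after it. Its weight \<open>F\<close> is the product of
  the weights \<open>W\<close> of the interlacing pairs, divided by \<open>W l l\<close> for each slice \<open>l\<close>. So the
  theorem follows by moving the increasing steps past the decreasing ones, which by the skew Cauchy
  identity costs the factor with exponent \<open>i + j - 1\<close> for each box \<open>(i, j)\<close>.

  The skew Cauchy identity says that the operators \<open>Up\<close> and \<open>Down\<close>, which add and remove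
  horizontal strips, commute up to a scalar series. Let \<open>Raise\<close> and \<open>Low\<close> add and remove one
  box, weighted by the inverse of \<open>x = q ^ l i / t ^ i\<close>, and let \<open>Ev\<close> be diagonal with the
  sum of all \<open>1/x\<close> as eigenvalue. Partial fractions in these variables give the commutators of
  \<open>Up\<close> and \<open>Down\<close> with \<open>Ev\<close>, \<open>Raise\<close>, \<open>Low\<close>. They imply that \<open>Up * Down\<close> and
  \<open>Down * Up\<close> satisfy the same recursion for their commutator with \<open>Ev\<close>. As \<open>Ev\<close> has simple
  spectrum, the defect is diagonal, and since it commutes with adding a single box it is a scalar,
  which is read off at the empty partition.\<close>

section \<open>Partial fractions\<close>

text \<open>Proofs of the skew Cauchy identity usually rest on orthogonality and the reproducing
  kernel of Macdonald polynomials. Here only explicit products are given, so everything is drawn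
  from how a weight changes when one box is added. Relations with \<open>Up 1\<close> and
  \<open>Down 1\<close> alone cannot suffice, since adding a horizontal strip of size
  \<open>i\<close> is not a polynomial in adding a box. The missing information comes from
  \<open>Ev\<close>, which is the first Macdonald operator, up to normalisation and inversion of
  both parameters: its commutator with a strip of size \<open>i + 1\<close> is expressed by strips
  of size \<open>i\<close> and one weighted box, and this lets an induction on the size run.

  All operators are split by degree, so that no series in an auxiliary variable has to converge. The
  number of rows matters: two families of equally many poles give the residue sum 0, hence strips
  and boxes of the same direction commute; one row more on one side leaves the scalar in the
  commutator of \<open>Up\<close> and \<open>Down\<close>. The resulting scalar series has the
  coefficients \<open>g n 0\<close>, and the q-binomial theorem identifies it as a quotient of
  infinite products.\<close>

lemma monic_linear_prod:
  fixes b :: "'i \<Rightarrow> 'a::field"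
  assumes "finite I"
  shows "degree (\<Prod>i\<in>I. [:- b i, 1:]) = card I"
    and "coeff (\<Prod>i\<in>I. [:- b i, 1:]) (card I) = 1"
    and "Suc k = card I \<Longrightarrow> coeff (\<Prod>i\<in>I. [:- b i, 1:]) k = - (\<Sum>i\<in>I. b i)"
proof -
  show deg: "degree (\<Prod>i\<in>I. [:- b i, 1:]) = card I" for I :: "'i set"
    by (subst degree_prod_eq_sum_degree) auto
  have lead: "coeff (\<Prod>i\<in>I. [:- b i, 1:]) (card I) = 1" for I :: "'i set"
    using lead_coeff_prod[of "\<lambda>i. [:- b i, 1:]" I] deg[of I] by simp
  show "coeff (\<Prod>i\<in>I. [:- b i, 1:]) (card I) = 1" by (rule lead)
  show "Suc k = card I \<Longrightarrow> coeff (\<Prod>i\<in>I. [:- b i, 1:]) k = - (\<Sum>i\<in>I. b i)"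
    using assms
  proof (induction I arbitrary: k rule: finite_induct)
    case (insert x F)
    have k: "k = card F" using insert by simp
    show ?case
    proof (cases k)
      case 0
      thus ?thesis using k insert by simp
    next
      case (Suc l)
      thus ?thesis using k insert lead[of F] by (simp add: algebra_simps)
    qed
  qed simp
qed

text \<open>\<open>d r\<close> is the residue at \<open>a r\<close> of the quotient of the monic
  polynomials with roots \<open>b i\<close> and \<open>a i\<close>, which equals 1 plus the sum of
  \<open>d r / (z - a r)\<close>. The two conclusions are the coefficient of \<open>1 / z\<close> in
  its expansion at infinity and its value at 0.\<close>

lemma partial_fractions:
  fixes a b :: "'i \<Rightarrow> 'a::field"
  assumes fin: "finite I" and inj: "inj_on a I"
  defines "d \<equiv> \<lambda>r. (\<Prod>i\<in>I. a r - b i) / (\<Prod>i\<in>I-{r}. a r - a i)"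
  shows "(\<Sum>r\<in>I. d r) = (\<Sum>i\<in>I. a i) - (\<Sum>i\<in>I. b i)"
    and "(\<And>i. i \<in> I \<Longrightarrow> a i \<noteq> 0) \<Longrightarrow>
      (\<Sum>r\<in>I. d r / a r) = 1 - (\<Prod>i\<in>I. b i) / (\<Prod>i\<in>I. a i)"
proof -
  define P where "P = (\<Prod>i\<in>I. [:- b i, 1:])"
  define A where "A = (\<Prod>i\<in>I. [:- a i, 1:])"
  define B where "B = (\<lambda>r. \<Prod>i\<in>I-{r}. [:- a i, 1:])"
  define S where "S = (\<Sum>r\<in>I. smult (d r) (B r))"
  have cardI: "Suc (card (I - {r})) = card I" if "r \<in> I" for r
    using that fin by (metis card_Suc_Diff1)
  have polyB: "poly (B r) (a s) = 0" if "s \<in> I" "r \<noteq> s" for r s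
    using that fin by (auto simp: B_def poly_prod)
  have polyBr: "poly (B r) (a r) = (\<Prod>i\<in>I-{r}. a r - a i)" for r
    by (auto simp: B_def poly_prod algebra_simps)
  have nz: "(\<Prod>i\<in>I-{r}. a r - a i) \<noteq> 0" if "r \<in> I" for r
    using fin inj that by (auto simp: inj_on_def)
  \<comment> \<open>\<open>P\<close> and \<open>A\<close> are both monic, so the difference has
    degree below \<open>card I\<close>; but it vanishes at the \<open>card I\<close> distinct points
    \<open>a r\<close>.\<close>
  have "P - A - S = 0"
  proof (rule ccontr)
    assume ne: "P - A - S \<noteq> 0"
    have "I \<noteq> {}" using ne by (auto simp: P_def A_def S_def)
    hence c0: "card I > 0" using fin by (simp add: card_gt_0_iff)
    have "poly (P - A - S) (a r) = 0" if r: "r \<in> I" for r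
    proof -
      have "poly S (a r) = (\<Sum>s\<in>I. d s * poly (B s) (a r))" by (simp add: S_def poly_sum)
      also have "\<dots> = d r * poly (B r) (a r)"
        using r fin polyB by (subst sum.remove[of _ r]) (auto intro!: sum.neutral)
      also have "\<dots> = (\<Prod>i\<in>I. a r - b i)" using nz[OF r] by (simp add: polyBr d_def)
      finally show ?thesis using r fin
        by (auto simp: P_def A_def poly_prod algebra_simps)
    qed
    hence "a ` I \<subseteq> {x. poly (P - A - S) x = 0}" by auto
    hence "card (a ` I) \<le> card {x. poly (P - A - S) x = 0}"
      by (intro card_mono poly_roots_finite ne)
    also have "\<dots> \<le> degree (P - A - S)"
      by (rule card_poly_roots_bound[OF ne])
    finally have le: "card I \<le> degree (P - A - S)" by (simp add: card_image inj)
    have "degree (B r) < card I" if "r \<in> I" for r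
      using monic_linear_prod(1)[of "I - {r}" a] fin cardI[OF that] by (simp add: B_def)
    hence "degree S < card I"
      unfolding S_def using c0 by (intro degree_sum_less) (auto intro: le_less_trans[OF degree_smult_le])
    moreover have "degree (P - A) < card I"
    proof -
      have "degree (P - A) \<le> card I"
        using monic_linear_prod(1)[OF fin, of a] monic_linear_prod(1)[OF fin, of b]
        by (intro degree_diff_le) (auto simp: P_def A_def)
      moreover have "coeff (P - A) (card I) = 0"
        using monic_linear_prod(2)[OF fin, of a] monic_linear_prod(2)[OF fin, of b]
        by (simp add: P_def A_def)
      ultimately show ?thesis
        using c0 eq_zero_or_degree_less[of "P - A" "card I"] by auto
    qed
    ultimately have "degree (P - A - S) < card I" by (rule degree_diff_less[rotated])
    with le show False by simp
  qed
  hence eq: "P = A + S" by (simp add: algebra_simps)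
  show "(\<Sum>r\<in>I. d r) = (\<Sum>i\<in>I. a i) - (\<Sum>i\<in>I. b i)"
  proof (cases "I = {}")
    case False
    then obtain k where k: "Suc k = card I" using fin by (metis card_gt_0_iff gr0_implies_Suc)
    have k': "card (I - {r}) = k" if "r \<in> I" for r
      using cardI[OF that] k by simp
    have "coeff (B r) k = 1" if "r \<in> I" for r
      using monic_linear_prod(2)[of "I - {r}" a] fin k'[OF that] by (simp add: B_def)
    hence "coeff S k = (\<Sum>r\<in>I. d r)" by (simp add: S_def coeff_sum)
    moreover have "coeff P k = coeff A k + coeff S k" using eq by simp
    ultimately show ?thesis
      using monic_linear_prod(3)[OF fin k, of a] monic_linear_prod(3)[OF fin k, of b]
      by (simp add: P_def A_def algebra_simps)
  qed simp
  assume a0: "\<And>i. i \<in> I \<Longrightarrow> a i \<noteq> 0"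
  have nza: "(\<Prod>i\<in>I. - a i) \<noteq> 0" using fin a0 by auto
  have "poly (B r) 0 = (\<Prod>i\<in>I. - a i) / - a r" if r: "r \<in> I" for r
    using fin r a0[OF r] by (subst prod.remove[of _ r]) (auto simp: B_def poly_prod)
  hence "poly S 0 = (\<Sum>r\<in>I. d r * ((\<Prod>i\<in>I. - a i) / - a r))"
    by (simp add: S_def poly_sum)
  also have "\<dots> = - (\<Prod>i\<in>I. - a i) * (\<Sum>r\<in>I. d r / a r)"
    unfolding sum_distrib_left by (intro sum.cong) auto
  finally have "(\<Prod>i\<in>I. - b i) = (\<Prod>i\<in>I. - a i) - (\<Prod>i\<in>I. - a i) * (\<Sum>r\<in>I. d r / a r)"
    using arg_cong[OF eq, of "\<lambda>p. poly p 0"] by (simp add: P_def A_def poly_prod)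
  hence "(\<Sum>r\<in>I. d r / a r) = 1 - (\<Prod>i\<in>I. - b i) / (\<Prod>i\<in>I. - a i)"
    using nza by (simp add: field_simps)
  also have "(\<Prod>i\<in>I. - b i) / (\<Prod>i\<in>I. - a i) = (\<Prod>i\<in>I. b i) / (\<Prod>i\<in>I. a i)"
    unfolding prod_dividef[symmetric] by simp
  finally show "(\<Sum>r\<in>I. d r / a r) = 1 - (\<Prod>i\<in>I. b i) / (\<Prod>i\<in>I. a i)" .
qed

section \<open>Matrices with finite rows\<close>

text \<open>The product \<open>A * B\<close> means: first \<open>A\<close>, then \<open>B\<close>.\<close>

typedef (overloaded) ('i, 'a) kern =
  "{A :: 'i \<Rightarrow> 'i \<Rightarrow> 'a::zero. \<forall>i. finite {j. A i j \<noteq> 0}}"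
  morphisms entry Kern by (rule exI[of _ "\<lambda>_ _. 0"]) simp

lemma finite_entry: "finite {j. entry A i j \<noteq> 0}"
  using entry[of A] by simp

lemma kern_eqI: "(\<And>i j. entry A i j = entry B i j) \<Longrightarrow> A = B"
  by (simp add: entry_inject[symmetric] fun_eq_iff)

lemma entry_Kern:
  "(\<And>i. finite {j. A i j \<noteq> 0}) \<Longrightarrow> entry (Kern A) i j = A i j"
  by (subst Kern_inverse) auto

instantiation kern :: (type, field) ring_1
begin

definition "0 = Kern (\<lambda>_ _. 0)"
definition "1 = Kern (\<lambda>i j. if i = j then 1 else 0)"
definition "A + B = Kern (\<lambda>i j. entry A i j + entry B i j)"
definition "A - B = Kern (\<lambda>i j. entry A i j - entry B i j)"
definition "- A = Kern (\<lambda>i j. - entry A i j)"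
definition "A * B = Kern (\<lambda>i j. \<Sum>k\<in>{k. entry A i k \<noteq> 0}. entry A i k * entry B k j)"

lemma
  fixes A B :: "('a, 'b) kern"
  shows entry_0: "entry (0 :: ('a, 'b) kern) i j = 0"
    and entry_1: "entry (1 :: ('a, 'b) kern) i j = (if i = j then 1 else 0)"
    and entry_add: "entry (A + B) i j = entry A i j + entry B i j"
    and entry_diff: "entry (A - B) i j = entry A i j - entry B i j"
    and entry_uminus: "entry (- A) i j = - entry A i j"
proof -
  have "finite {j. entry A i j + entry B i j \<noteq> 0}" for i
    by (rule finite_subset[OF _ finite_UnI[OF finite_entry[of A i] finite_entry[of B i]]]) auto
  moreover have "finite {j. entry A i j - entry B i j \<noteq> 0}" for i
    by (rule finite_subset[OF _ finite_UnI[OF finite_entry[of A i] finite_entry[of B i]]]) auto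
  moreover have "finite {j. (if i = j then 1 else 0) \<noteq> (0 :: 'b)}" for i :: 'a
    by (rule finite_subset[of _ "{i}"]) auto
  ultimately show "entry (0 :: ('a, 'b) kern) i j = 0"
      "entry (1 :: ('a, 'b) kern) i j = (if i = j then 1 else 0)"
      "entry (A + B) i j = entry A i j + entry B i j"
      "entry (A - B) i j = entry A i j - entry B i j"
      "entry (- A) i j = - entry A i j"
    by (simp_all only: zero_kern_def one_kern_def plus_kern_def minus_kern_def uminus_kern_def)
      (subst entry_Kern; simp add: finite_entry)+
qed

lemma entry_times:
  fixes A B :: "('a, 'b) kern"
  assumes "finite S" "\<And>k. k \<notin> S \<Longrightarrow> entry A i k * entry B k j = 0"
  shows "entry (A * B) i j = (\<Sum>k\<in>S. entry A i k * entry B k j)"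
proof -
  have "entry (A * B) i j = (\<Sum>k\<in>{k. entry A i k \<noteq> 0}. entry A i k * entry B k j)"
    unfolding times_kern_def
  proof (rule entry_Kern)
    fix i
    have "{j. (\<Sum>k\<in>{k. entry A i k \<noteq> 0}. entry A i k * entry B k j) \<noteq> 0}
        \<subseteq> (\<Union>k\<in>{k. entry A i k \<noteq> 0}. {j. entry B k j \<noteq> 0})"
      by (auto elim!: sum.not_neutral_contains_not_neutral)
    thus "finite {j. (\<Sum>k\<in>{k. entry A i k \<noteq> 0}. entry A i k * entry B k j) \<noteq> 0}"
      by (rule finite_subset) (auto simp: finite_entry)
  qed
  also have "\<dots> = (\<Sum>k\<in>S. entry A i k * entry B k j)"
    using assms finite_entry[of A i]
    by (intro sum.mono_neutral_cong) auto
  finally show ?thesis .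
qed

instance
proof
  fix A B C :: "('a, 'b) kern"
  show "A * B * C = A * (B * C)"
  proof (rule kern_eqI)
    fix i j
    define S where "S = {k. entry A i k \<noteq> 0}"
    define T where "T = (\<Union>k\<in>S. {l. entry B k l \<noteq> 0})"
    have fin: "finite S" "finite T" by (auto simp: S_def T_def finite_entry)
    have AB: "entry (A * B) i l = (\<Sum>k\<in>S. entry A i k * entry B k l)" for l
      by (rule entry_times) (use fin in \<open>auto simp: S_def\<close>)
    have BC: "entry (B * C) k j = (\<Sum>l\<in>T. entry B k l * entry C l j)" if "k \<in> S" for k
      by (rule entry_times) (use fin that in \<open>auto simp: T_def\<close>)
    have "entry (A * B * C) i j = (\<Sum>l\<in>T. entry (A * B) i l * entry C l j)"
    proof (rule entry_times)
      fix l assume "l \<notin> T"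
      hence "entry (A * B) i l = 0" unfolding AB by (intro sum.neutral) (auto simp: T_def)
      thus "entry (A * B) i l * entry C l j = 0" by simp
    qed (use fin in auto)
    also have "\<dots> = (\<Sum>k\<in>S. entry A i k * (\<Sum>l\<in>T. entry B k l * entry C l j))"
      unfolding AB sum_distrib_left sum_distrib_right mult.assoc by (rule sum.swap)
    also have "\<dots> = (\<Sum>k\<in>S. entry A i k * entry (B * C) k j)"
      using BC by (intro sum.cong) auto
    also have "\<dots> = entry (A * (B * C)) i j"
      by (rule entry_times[symmetric]) (use fin in \<open>auto simp: S_def\<close>)
    finally show "entry (A * B * C) i j = entry (A * (B * C)) i j" .
  qed
  show "1 * A = A"
  proof (rule kern_eqI)
    fix i j show "entry (1 * A) i j = entry A i j"
      by (subst entry_times[of "{i}"]) (auto simp: entry_1)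
  qed
  show "A * 1 = A"
  proof (rule kern_eqI)
    fix i j show "entry (A * 1) i j = entry A i j"
      by (subst entry_times[of "{j}"]) (auto simp: entry_1)
  qed
  show "(A + B) * C = A * C + B * C"
  proof (rule kern_eqI)
    fix i j
    define S where "S = {k. entry A i k \<noteq> 0} \<union> {k. entry B i k \<noteq> 0}"
    have "finite S" by (auto simp: S_def finite_entry)
    hence "entry ((A + B) * C) i j = (\<Sum>k\<in>S. entry (A + B) i k * entry C k j)"
        "entry (A * C) i j = (\<Sum>k\<in>S. entry A i k * entry C k j)"
        "entry (B * C) i j = (\<Sum>k\<in>S. entry B i k * entry C k j)"
      by (rule entry_times; force simp: S_def entry_add)+
    thus "entry ((A + B) * C) i j = entry (A * C + B * C) i j"
      by (simp only: entry_add distrib_right sum.distrib)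
  qed
  show "A * (B + C) = A * B + A * C"
  proof (rule kern_eqI)
    fix i j
    define S where "S = {k. entry A i k \<noteq> 0}"
    have "finite S" by (auto simp: S_def finite_entry)
    hence "entry (A * (B + C)) i j = (\<Sum>k\<in>S. entry A i k * entry (B + C) k j)"
        "entry (A * B) i j = (\<Sum>k\<in>S. entry A i k * entry B k j)"
        "entry (A * C) i j = (\<Sum>k\<in>S. entry A i k * entry C k j)"
      by (rule entry_times; force simp: S_def)+
    thus "entry (A * (B + C)) i j = entry (A * B + A * C) i j"
      by (simp only: entry_add distrib_left sum.distrib)
  qed
  show "(0 :: ('a, 'b) kern) \<noteq> 1"
  proof
    assume "(0 :: ('a, 'b) kern) = 1"
    hence "entry (0 :: ('a, 'b) kern) undefined undefined = entry 1 undefined undefined" by simp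
    thus False by (simp add: entry_0 entry_1)
  qed
  show "A + B + C = A + (B + C)"
    by (rule kern_eqI) (simp only: entry_add add.assoc)
  show "A + B = B + A"
    by (rule kern_eqI) (simp only: entry_add add.commute)
  show "0 + A = A"
    by (rule kern_eqI) (simp only: entry_add entry_0 add_0_left)
  show "- A + A = 0"
    by (rule kern_eqI)
      (simp only: entry_add entry_0 entry_uminus ab_left_minus)
  show "A - B = A + - B"
    by (rule kern_eqI)
      (simp only: entry_add entry_diff entry_uminus diff_conv_add_uminus)
qed

end

definition kscale :: "'b::field \<Rightarrow> ('a, 'b) kern \<Rightarrow> ('a, 'b) kern" where
  "kscale c A = Kern (\<lambda>i j. c * entry A i j)"

lemma entry_kscale: "entry (kscale c A) i j = c * entry A i j"
  unfolding kscale_def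
  by (rule entry_Kern, rule finite_subset[OF _ finite_entry[of A]]) auto

lemma kscale_algebra:
  shows "kscale c (A + B) = kscale c A + kscale c B"
    and "kscale c (A - B) = kscale c A - kscale c B"
    and "kscale c (- A) = - kscale c A"
    and "kscale c (kscale d A) = kscale (c * d) A"
  by (rule kern_eqI; simp add: entry_add entry_diff entry_uminus entry_kscale
      distrib_left right_diff_distrib)+

lemma kscale_times: "kscale c A * B = kscale c (A * B)" "A * kscale c B = kscale c (A * B)"
proof -
  have "entry (kscale c A * B) i j = entry (kscale c (A * B)) i j" for i j
    using entry_times[OF finite_entry[of A i], of "kscale c A" i B j]
      entry_times[OF finite_entry[of A i], of A i B j]
    by (simp add: entry_kscale sum_distrib_left mult.assoc)
  thus "kscale c A * B = kscale c (A * B)" by (rule kern_eqI)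
  have "entry (A * kscale c B) i j = entry (kscale c (A * B)) i j" for i j
    using entry_times[OF finite_entry[of A i], of A i "kscale c B" j]
      entry_times[OF finite_entry[of A i], of A i B j]
    by (simp add: entry_kscale sum_distrib_left mult.left_commute)
  thus "A * kscale c B = kscale c (A * B)" by (rule kern_eqI)
qed

lemma entry_diag_times:
  assumes "\<And>i j. i \<noteq> j \<Longrightarrow> entry E i j = 0"
  shows "entry (E * A) i j = entry E i i * entry A i j"
    and "entry (A * E) i j = entry A i j * entry E j j"
  using assms by (subst entry_times[of "{i}"] entry_times[of "{j}"]; auto)+

text \<open>If \<open>E\<close> is diagonal with distinct eigenvalues, the vanishing of this expression determines
  \<open>X11\<close> off the diagonal from \<open>X10\<close>, \<open>X01\<close> and \<open>X00\<close>.\<close>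

definition exchange_defect ::
  "'b::field \<Rightarrow> 'b \<Rightarrow> 'b \<Rightarrow> ('a, 'b) kern \<Rightarrow> ('a, 'b) kern \<Rightarrow> ('a, 'b) kern \<Rightarrow>
   ('a, 'b) kern \<Rightarrow> ('a, 'b) kern \<Rightarrow> ('a, 'b) kern \<Rightarrow> ('a, 'b) kern \<Rightarrow> ('a, 'b) kern" where
  "exchange_defect c t u E L R X11 X10 X01 X00 =
     kscale c (E * X11 - X11 * E) + kscale (u * t) (E * X00 - X00 * E)
     - (kscale t (R * X10) - X10 * R + L * X01 - kscale t (X01 * L))"

text \<open>The Leibniz rule and \<open>C\<close>, \<open>C'\<close> expand the commutator of
  \<open>E\<close> with a product; then \<open>T\<close> and \<open>T'\<close> carry
  \<open>L\<close> and \<open>R\<close> to the outside, and the terms with \<open>E\<close> between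
  the two factors cancel. Both orders of the factors end in the same linear relation, so their
  difference satisfies it too, and its off-diagonal part is controlled by lower degrees.\<close>

lemma exchange_defect_products:
  assumes C: "L * D0 - kscale t (D0 * L) = kscale c (E * D1 - D1 * E)"
    and C': "P0 * R - kscale t (R * P0) = kscale c (P1 * E - E * P1)"
    and T: "D1 * R - R * D1 = kscale u (kscale t (D0 * E) - E * D0)"
    and T': "L * P1 - P1 * L = kscale u (kscale t (E * P0) - P0 * E)"
  shows "exchange_defect c t u E L R (P1 * D1) (P0 * D1) (P1 * D0) (P0 * D0) = 0"
    and "exchange_defect c t u E L R (D1 * P1) (D1 * P0) (D0 * P1) (D0 * P0) = 0"
proof -
  note alg = kscale_algebra kscale_times algebra_simps
  have C1: "kscale c (E * D1) = kscale c (D1 * E) + L * D0 - kscale t (D0 * L)"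
    using C by (simp add: alg)
  have C1': "kscale c (E * P1) = kscale c (P1 * E) - P0 * R + kscale t (R * P0)"
    using C' by (simp add: alg)
  have T1: "R * D1 = D1 * R - kscale u (kscale t (D0 * E) - E * D0)"
    using T by (simp add: alg)
  have T1': "P1 * L = L * P1 - kscale u (kscale t (E * P0) - P0 * E)"
    using T' by (simp add: alg)
  have "kscale c (E * (P1 * D1)) = kscale c (E * P1) * D1" by (simp add: alg)
  also have "\<dots> = P1 * kscale c (E * D1) - P0 * (R * D1) + kscale t (R * P0 * D1)"
    unfolding C1' by (simp add: alg)
  also have "\<dots> = kscale c (P1 * D1 * E) - kscale t (P1 * D0 * L) + (P1 * L) * D0
      - P0 * (R * D1) + kscale t (R * P0 * D1)"
    unfolding C1 by (simp add: alg)
  finally show "exchange_defect c t u E L R (P1 * D1) (P0 * D1) (P1 * D0) (P0 * D0) = 0"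
    unfolding exchange_defect_def T1 T1' by (simp add: alg)
  have "kscale c (E * (D1 * P1)) = kscale c (E * D1) * P1" by (simp add: alg)
  also have "\<dots> = D1 * kscale c (E * P1) + L * D0 * P1 - kscale t (D0 * (L * P1))"
    unfolding C1 by (simp add: alg)
  finally have *: "kscale c (E * (D1 * P1)) = D1 * kscale c (E * P1) + L * D0 * P1 -
      kscale t (D0 * (L * P1))" .
  have T2: "D1 * R = R * D1 + kscale u (kscale t (D0 * E) - E * D0)"
    using T by (simp add: alg)
  have T2': "L * P1 = P1 * L + kscale u (kscale t (E * P0) - P0 * E)"
    using T' by (simp add: alg)
  have "kscale c (E * (D1 * P1)) = kscale c (D1 * P1 * E) - D1 * P0 * R +
      kscale t ((D1 * R) * P0) + L * D0 * P1 - kscale t (D0 * (L * P1))"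
    unfolding * C1' by (simp add: alg)
  thus "exchange_defect c t u E L R (D1 * P1) (D1 * P0) (D0 * P1) (D0 * P0) = 0"
    unfolding exchange_defect_def T2 T2' by (simp add: alg)
qed

section \<open>Weights of interlacing partitions\<close>

text \<open>The skew shape \<open>l/m\<close> is a horizontal strip; parts are indexed from 0 and
  \<open>l\<close> is the larger partition.\<close>

definition interlaced :: "(nat \<Rightarrow> nat) \<Rightarrow> (nat \<Rightarrow> nat) \<Rightarrow> bool" where
  "interlaced l m \<longleftrightarrow> (\<forall>i. m i \<le> l i \<and> l (Suc i) \<le> m i)"

definition zero_from :: "nat \<Rightarrow> (nat \<Rightarrow> nat) \<Rightarrow> bool" where
  "zero_from N l \<longleftrightarrow> (\<forall>i\<ge>N. l i = 0)"

definition add_box :: "(nat \<Rightarrow> nat) \<Rightarrow> nat \<Rightarrow> nat \<Rightarrow> nat" where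
  "add_box l r = l(r := Suc (l r))"

lemma interlaced_decseq: "interlaced l m \<Longrightarrow> decseq l" "interlaced l m \<Longrightarrow> decseq m"
  unfolding interlaced_def by (intro decseq_SucI; meson le_trans)+

lemma interlaced_refl: "decseq l \<Longrightarrow> interlaced l l"
  by (simp add: interlaced_def decseq_SucD)

lemma zero_from_interlaced: "interlaced l m \<Longrightarrow> zero_from N l \<Longrightarrow> zero_from N m"
  unfolding interlaced_def zero_from_def by (metis le_zero_eq)

lemma zero_from_add_box: "zero_from N l \<Longrightarrow> r < N \<Longrightarrow> zero_from N (add_box l r)"
  by (simp add: zero_from_def add_box_def)

text \<open>The assumption \<open>row_inj\<close> makes the eigenvalues \<open>ev\<close> below distinct.\<close>

locale generic_qt =
  fixes q t :: "'a::field"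
  assumes q_nz: "q \<noteq> 0" and t_nz: "t \<noteq> 0"
    and monom_inj: "q ^ a * t ^ b = q ^ c * t ^ d \<Longrightarrow> a = c \<and> b = d"
    and row_inj: "(\<Sum>j<n. q ^ u j * t ^ j) = (\<Sum>j<n. q ^ v j * t ^ j) \<Longrightarrow> j < n \<Longrightarrow> u j = v j"
begin

abbreviation "g \<equiv> f_factor q t"

lemma monom_neq: "a \<noteq> c \<or> b \<noteq> d \<Longrightarrow> q ^ a * t ^ b \<noteq> q ^ c * t ^ d"
  using monom_inj by blast

lemma monom_neq_1: "a \<noteq> 0 \<or> b \<noteq> 0 \<Longrightarrow> q ^ a * t ^ b \<noteq> 1"
  using monom_neq[of a 0 b 0] by simp

lemma one_minus_monom_nz: "a \<noteq> 0 \<or> b \<noteq> 0 \<Longrightarrow> 1 - q ^ a * t ^ b \<noteq> 0"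
  using monom_neq_1[of a b] by simp

lemma g_0: "g 0 m = 1"
  by (simp add: f_factor_def)

lemma g_Suc: "g (Suc n) m = g n m * ((1 - q ^ n * t ^ (m + 1)) / (1 - q ^ (n + 1) * t ^ m))"
  by (simp add: f_factor_def)

lemma g_nz: "g n m \<noteq> 0"
  unfolding f_factor_def using one_minus_monom_nz by (auto simp del: power_Suc)

lemma g_eq_g_Suc: "g n k = g (Suc n) k * ((1 - q ^ Suc n * t ^ k) / (1 - q ^ n * t ^ Suc k))"
proof -
  have nz: "1 - q ^ Suc n * t ^ k \<noteq> 0" "1 - q ^ n * t ^ Suc k \<noteq> 0"
    by (rule one_minus_monom_nz, simp)+
  have "x = x * (u / v) * (v / u)" if "u \<noteq> 0" "v \<noteq> 0" for x u v :: 'a using that by simp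
  from this[OF nz(2,1), of "g n k"] show ?thesis unfolding g_Suc unfolding Suc_eq_plus1 .
qed

text \<open>Used with \<open>u = q ^ n * t ^ k\<close>, when the quotient of two row variables is
  the inverse of a monomial. Passing to the monomial itself costs a factor \<open>q / t\<close>;
  these factors make up the power of \<open>q / t\<close> in \<open>row_factor\<close>.\<close>

lemma reciprocal_ratio:
  assumes "u \<noteq> 0" "1 - t * u \<noteq> 0"
  shows "q / t * ((1 - 1 / (q * u)) / (1 - 1 / (t * u))) = (1 - q * u) / (1 - t * u)"
proof -
  have "(1 - 1 / (q * u)) = (q * u - 1) / (q * u)" "(1 - 1 / (t * u)) = (t * u - 1) / (t * u)"
    using assms q_nz t_nz by (auto simp: field_simps)
  moreover have "(t * u - 1) \<noteq> 0" using assms by simp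
  ultimately show ?thesis
    using assms q_nz t_nz by (simp add: divide_simps) (simp add: algebra_simps)
qed

text \<open>Up to a change of normalisation, \<open>W l m\<close> is the coefficient of the one-variable
  skew Macdonald polynomial of shape \<open>l/m\<close>, and \<open>1 / W l l\<close> the weight of an intermediate partition. The
  denominators \<open>g (l i) k\<close> and \<open>g (m i) k\<close> cancel in such a chain; they make all but finitely
  many factors equal to 1.\<close>

definition wl :: "(nat \<Rightarrow> nat) \<Rightarrow> (nat \<Rightarrow> nat) \<Rightarrow> nat \<Rightarrow> nat \<Rightarrow> 'a" where
  "wl l m i k = g (l i - m (i + k)) k / g (l i) k"

definition wr :: "(nat \<Rightarrow> nat) \<Rightarrow> (nat \<Rightarrow> nat) \<Rightarrow> nat \<Rightarrow> nat \<Rightarrow> 'a" where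
  "wr l m i k = g (m i - l (i + k + 1)) k / g (m i) k"

definition W :: "(nat \<Rightarrow> nat) \<Rightarrow> (nat \<Rightarrow> nat) \<Rightarrow> 'a" where
  "W l m = (if interlaced l m then
      let N = (LEAST N. zero_from N l) in \<Prod>i<N. \<Prod>k<N. wl l m i k * wr l m i k else 0)"

text \<open>For \<open>i \<ge> N\<close> all arguments of \<open>g\<close> are 0; for
  \<open>k \<ge> N\<close> the subtracted part is 0 and the normalising denominator cancels the
  numerator. So any bound on the number of rows may replace the least one, and weights of different
  pairs can be compared factor by factor.\<close>

lemma W_eq:
  assumes "interlaced l m" "zero_from N l"
  shows "W l m = (\<Prod>i<N. \<Prod>k<N. wl l m i k) * (\<Prod>i<N. \<Prod>k<N. wr l m i k)"
proof -
  define N0 where "N0 = (LEAST N. zero_from N l)"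
  have z0: "zero_from N0 l" unfolding N0_def using assms(2) by (rule LeastI)
  have le: "N0 \<le> N" unfolding N0_def using assms(2) by (rule Least_le)
  have zm: "zero_from N0 m" by (rule zero_from_interlaced[OF assms(1) z0])
  have triv: "wl l m i k * wr l m i k = 1" if "i \<ge> N0 \<or> k \<ge> N0" for i k
    using that z0 zm g_nz by (auto simp: wl_def wr_def zero_from_def g_0)
  have "W l m = (\<Prod>i<N0. \<Prod>k<N0. wl l m i k * wr l m i k)"
    using assms(1) by (simp add: W_def N0_def Let_def)
  also have "\<dots> = (\<Prod>i<N0. \<Prod>k<N. wl l m i k * wr l m i k)"
    using le triv by (intro prod.cong refl prod.mono_neutral_left) auto
  also have "\<dots> = (\<Prod>i<N. \<Prod>k<N. wl l m i k * wr l m i k)"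
    using le triv by (intro prod.mono_neutral_left) auto
  finally show ?thesis by (simp add: prod.distrib)
qed

lemma W_nz: "interlaced l m \<Longrightarrow> zero_from N l \<Longrightarrow> W l m \<noteq> 0"
  by (subst W_eq) (auto simp: wl_def wr_def g_nz)

lemma W_0: "\<not> interlaced l m \<Longrightarrow> W l m = 0"
  by (simp add: W_def)

section \<open>The effect of one added box on a weight\<close>

definition row_var :: "(nat \<Rightarrow> nat) \<Rightarrow> nat \<Rightarrow> 'a" where
  "row_var l i = q ^ l i / t ^ i"

lemma row_var_nz: "row_var l i \<noteq> 0"
  by (simp add: row_var_def q_nz t_nz)

lemma row_var_add_box: "row_var (add_box l r) i = (if i = r then q * row_var l i else row_var l i)"
  by (simp add: row_var_def add_box_def)

lemma row_var_eq_iff: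
  "q ^ a * row_var l i * t ^ b = q ^ c * row_var m j * t ^ d \<longleftrightarrow> a + l i = c + m j \<and> b + j = d + i"
proof -
  have "q ^ a * row_var l i * t ^ b = q ^ c * row_var m j * t ^ d \<longleftrightarrow>
      q ^ (a + l i) * t ^ (b + j) = q ^ (c + m j) * t ^ (d + i)"
    by (simp add: row_var_def field_simps t_nz power_add)
  also have "\<dots> \<longleftrightarrow> a + l i = c + m j \<and> b + j = d + i"
    using monom_inj[of "a + l i" "b + j" "c + m j" "d + i"] by auto
  finally show ?thesis .
qed

text \<open>The share of the change that depends only on the row, its variable and the row bound,
  not on the other partition of the pair. It cancels when two weights that gained the same box are
  divided.\<close>

definition row_factor :: "nat \<Rightarrow> nat \<Rightarrow> 'a \<Rightarrow> 'a" where
  "row_factor N r z = (q / t) ^ r * (\<Prod>j\<in>{r..<N}. (1 - q * z * t ^ j) / (1 - z * t ^ Suc j))"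

text \<open>Enlarging row \<open>r\<close> of \<open>l\<close> alters \<open>wl\<close> along the
  whole row \<open>r\<close> and \<open>wr\<close> only where \<open>i + k + 1 = r\<close>. Each
  altered \<open>g\<close> moves by one step. The first kind yields the factors with
  \<open>j \<ge> r\<close>, the second those with \<open>j < r\<close>, and together they fill the
  product over all rows of \<open>m\<close>. A box that breaks interlacing has
  \<open>l r = m (r - 1)\<close>, and there the product has a zero.\<close>

lemma W_add_box_left:
  assumes il: "interlaced l m" and zf: "zero_from N l" and r: "r < N"
  shows "W (add_box l r) m = W l m * row_factor N r (row_var l r) *
    (\<Prod>j<N. (1 - t * row_var l r / row_var m j) / (1 - q * row_var l r / row_var m j))"
proof (cases "interlaced (add_box l r) m")
  case False
  then obtain i where "\<not> (m i \<le> add_box l r i \<and> add_box l r (Suc i) \<le> m i)"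
    unfolding interlaced_def by blast
  moreover have "m i \<le> l i" "l (Suc i) \<le> m i" using il by (auto simp: interlaced_def)
  ultimately have i: "Suc i = r" "l r = m i" by (auto simp: add_box_def split: if_splits)
  have "t * row_var l r = row_var m i"
    using row_var_eq_iff[of 0 l r 1 0 m i 0] i by (simp add: mult.commute)
  hence "1 - t * row_var l r / row_var m i = 0" by (simp add: row_var_nz)
  moreover have "i < N" using i r by simp
  ultimately have "(\<Prod>j<N. (1 - t * row_var l r / row_var m j) / (1 - q * row_var l r / row_var m j)) = 0"
    by (intro prod_zero) auto
  thus ?thesis using False by (simp add: W_0)
next
  case il': True
  define z where "z = row_var l r"
  define h where "h j = (1 - t * z / row_var m j) / (1 - q * z / row_var m j)" for j
  let ?l = "add_box l r"
  have zm: "zero_from N m" by (rule zero_from_interlaced[OF il zf])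
  have ml: "m i \<le> l i" "l (Suc i) \<le> m i" for i using il by (auto simp: interlaced_def)
  have decm: "m j \<le> m i" if "i \<le> j" for i j
    using that interlaced_decseq(2)[OF il] by (simp add: decseqD)
  \<comment> \<open>The step of \<open>g\<close> in the numerator of \<open>wl\<close>, divided by
    the step of \<open>g\<close> in its normalising denominator.\<close>
  define \<rho> where "\<rho> j = h j * ((1 - q * z * t ^ j) / (1 - z * t ^ Suc j))" for j
  have wlr: "wl ?l m r k = wl l m r k * \<rho> (r + k)" for k
  proof -
    define a where "a = l r - m (r + k)"
    have le: "m (r + k) \<le> l r" using ml(1)[of r] decm[of r "r + k"] by simp
    have a: "Suc (l r) - m (r + k) = Suc a" "l r - m (r + k) = a" "l r = a + m (r + k)"
      using le by (auto simp: a_def)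
    have z1: "z * t ^ (r + k) = q ^ l r * t ^ k"
      by (simp add: z_def row_var_def power_add t_nz)
    have z2: "z / row_var m (r + k) = q ^ a * t ^ k"
      using a(3) q_nz by (simp add: z_def row_var_def power_add t_nz field_simps)
    have e: "t * z / row_var m (r + k) = q ^ a * t ^ (k + 1)"
            "q * z / row_var m (r + k) = q ^ (a + 1) * t ^ k"
            "q * z * t ^ (r + k) = q ^ (l r + 1) * t ^ k"
            "z * t ^ Suc (r + k) = q ^ l r * t ^ (k + 1)"
      using z2 z1 by (simp_all add: field_simps row_var_nz)
    show ?thesis
      unfolding \<rho>_def h_def e wl_def add_box_def
      using one_minus_monom_nz[of "a + 1" k] one_minus_monom_nz[of "l r + 1" k]
        one_minus_monom_nz[of "l r" "k + 1"] g_nz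
      by (simp add: a g_Suc del: power_Suc) (simp add: mult_ac)
  qed
  have wl_other: "wl ?l m i k = wl l m i k" if "i \<noteq> r" for i k
    using that by (simp add: wl_def add_box_def)
  have "(\<Prod>i<N. \<Prod>k<N. wl ?l m i k) = (\<Prod>k<N. wl ?l m r k) * (\<Prod>i\<in>{..<N}-{r}. \<Prod>k<N. wl ?l m i k)"
    using r by (intro prod.remove) auto
  also have "\<dots> = (\<Prod>k<N. \<rho> (r + k)) * ((\<Prod>k<N. wl l m r k) * (\<Prod>i\<in>{..<N}-{r}. \<Prod>k<N. wl l m i k))"
    by (simp add: wlr wl_other prod.distrib)
  also have "(\<Prod>k<N. wl l m r k) * (\<Prod>i\<in>{..<N}-{r}. \<Prod>k<N. wl l m i k) = (\<Prod>i<N. \<Prod>k<N. wl l m i k)"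
    using r by (intro prod.remove[symmetric]) auto
  also have "(\<Prod>k<N. \<rho> (r + k)) = (\<Prod>k<N - r. \<rho> (r + k))"
  proof (intro prod.mono_neutral_right ballI)
    fix k assume "k \<in> {..<N} - {..<N - r}"
    hence "m (r + k) = 0" using zm by (auto simp: zero_from_def)
    hence "wl ?l m r k = 1" "wl l m r k = 1" by (auto simp: wl_def g_nz)
    thus "\<rho> (r + k) = 1" using wlr[of k] by simp
  qed auto
  also have "\<dots> = (\<Prod>j\<in>{r..<N}. \<rho> j)"
    using r by (intro prod.reindex_bij_witness[of _ "\<lambda>j. j - r" "\<lambda>k. r + k"]) auto
  finally have A: "(\<Prod>i<N. \<Prod>k<N. wl ?l m i k) = (\<Prod>j\<in>{r..<N}. \<rho> j) * (\<Prod>i<N. \<Prod>k<N. wl l m i k)" .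
  \<comment> \<open>Here the subtracted part grows, so \<open>g\<close> steps down and the ratio
    appears inverted; each of the \<open>r\<close> rows above contributes one factor
    \<open>q / t\<close>.\<close>
  have wrr: "wr ?l m i (r - Suc i) = wr l m i (r - Suc i) * (q / t * h i)" if i: "i < r" for i
  proof -
    define k where "k = r - Suc i"
    have rk: "r = i + k + 1" using i by (simp add: k_def)
    have "Suc (l r) \<le> m (r - 1)"
      using il' i by (auto simp: interlaced_def add_box_def dest!: spec[of _ "r - 1"])
    also have "\<dots> \<le> m i" using i by (intro decm) auto
    finally have le: "Suc (l r) \<le> m i" .
    define n where "n = m i - Suc (l r)"
    have n: "m i - l r = Suc n" "m i - Suc (l r) = n" "m i = l r + n + 1" using le by (auto simp: n_def)
    have e1: "t * z / row_var m i = 1 / (q ^ Suc n * t ^ k)"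
      unfolding z_def row_var_def using q_nz t_nz
      by (simp add: n(3) rk power_add field_simps)
    have e2: "q * z / row_var m i = 1 / (q ^ n * t ^ Suc k)"
      unfolding z_def row_var_def using q_nz t_nz
      by (simp add: n(3) rk power_add field_simps)
    have nz: "1 - q ^ Suc n * t ^ k \<noteq> 0" "1 - q ^ n * t ^ Suc k \<noteq> 0"
      by (rule one_minus_monom_nz, simp)+
    have "q / t * h i = (1 - q ^ Suc n * t ^ k) / (1 - q ^ n * t ^ Suc k)"
      using reciprocal_ratio[of "q ^ n * t ^ k"] nz q_nz t_nz
      unfolding h_def e1 e2 by (simp add: mult_ac)
    moreover have "wr ?l m i k * g (m i) k = g n k" "wr l m i k * g (m i) k = g (Suc n) k"
      using g_nz[of "m i" k] rk n by (simp_all add: wr_def add_box_def)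
    moreover have "g n k = g (Suc n) k * ((1 - q ^ Suc n * t ^ k) / (1 - q ^ n * t ^ Suc k))"
      by (rule g_eq_g_Suc)
    ultimately have "wr ?l m i k * g (m i) k = wr l m i k * (q / t * h i) * g (m i) k"
      by (metis mult.assoc mult.commute)
    thus ?thesis using g_nz[of "m i" k] unfolding k_def[symmetric] by (simp only: mult_cancel_right) simp
  qed
  have wr_other: "wr ?l m i k = wr l m i k" if "i + k + 1 \<noteq> r" for i k
    using that by (simp add: wr_def add_box_def)
  have inner: "(\<Prod>k<N. wr ?l m i k) = (\<Prod>k<N. wr l m i k) * (if i < r then q / t * h i else 1)" for i
  proof (cases "i < r")
    case True
    let ?k = "r - Suc i"
    have k: "?k \<in> {..<N}" using r by auto
    have "(\<Prod>k\<in>{..<N}-{?k}. wr ?l m i k) = (\<Prod>k\<in>{..<N}-{?k}. wr l m i k)"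
      by (intro prod.cong refl wr_other) auto
    thus ?thesis using True wrr[OF True]
      by (subst (1 2) prod.remove[OF _ k]) auto
  qed (auto intro!: prod.cong wr_other)
  have "(\<Prod>i<N. \<Prod>k<N. wr ?l m i k)
      = (\<Prod>i<N. \<Prod>k<N. wr l m i k) * (\<Prod>i<N. if i < r then q / t * h i else 1)"
    unfolding inner by (simp add: prod.distrib)
  also have "(\<Prod>i<N. if i < r then q / t * h i else 1) = (\<Prod>i<r. q / t * h i)"
    using r by (intro prod.mono_neutral_cong_right) auto
  finally have B: "(\<Prod>i<N. \<Prod>k<N. wr ?l m i k)
      = (\<Prod>i<N. \<Prod>k<N. wr l m i k) * ((q / t) ^ r * (\<Prod>i<r. h i))"
    by (simp only: prod.distrib prod_constant card_lessThan)
  have split: "(\<Prod>j<N. h j) = (\<Prod>i<r. h i) * (\<Prod>j\<in>{r..<N}. h j)"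
    using r by (simp add: lessThan_atLeast0 prod.atLeastLessThan_concat)
  show ?thesis
    unfolding W_eq[OF il zf] W_eq[OF il' zero_from_add_box[OF zf r]] A B z_def[symmetric]
      h_def[symmetric] split row_factor_def \<rho>_def prod.distrib by (simp add: mult_ac)
qed

text \<open>The same computation shifted by one: now \<open>wr\<close> changes along row
  \<open>r\<close>, and \<open>wl\<close> where \<open>i + k = r\<close>. The latter includes
  \<open>i = r\<close>, so there are \<open>r + 1\<close> factors \<open>q / t\<close>, and row
  \<open>r\<close> is compared with the rows of \<open>l\<close> from \<open>r + 1\<close> on,
  whence the bound \<open>N - 1\<close>. The zero of the product is at \<open>j = r\<close>, for
  \<open>m r = l r\<close>.\<close>

lemma W_add_box_right:
  assumes il: "interlaced l m" and zf: "zero_from N l" and r: "r < N"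
  shows "W l (add_box m r) = W l m * (q / t * row_factor (N - 1) r (row_var m r)) *
    (\<Prod>j<N. (1 - row_var m r / row_var l j) / (1 - q * row_var m r / (t * row_var l j)))"
proof (cases "interlaced l (add_box m r)")
  case False
  then obtain i where "\<not> (add_box m r i \<le> l i \<and> l (Suc i) \<le> add_box m r i)"
    unfolding interlaced_def by blast
  moreover have "m i \<le> l i" "l (Suc i) \<le> m i" using il by (auto simp: interlaced_def)
  ultimately have i: "i = r" "l r = m r" by (auto simp: add_box_def split: if_splits)
  have "1 - row_var m r / row_var l r = 0"
    using i by (simp add: row_var_def q_nz t_nz)
  hence "(\<Prod>j<N. (1 - row_var m r / row_var l j) / (1 - q * row_var m r / (t * row_var l j))) = 0"
    using r by (intro prod_zero) auto
  thus ?thesis using False by (simp add: W_0)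
next
  case il': True
  define z where "z = row_var m r"
  define h where "h j = (1 - z / row_var l j) / (1 - q * z / (t * row_var l j))" for j
  let ?m = "add_box m r"
  have ml: "m i \<le> l i" "l (Suc i) \<le> m i" for i using il by (auto simp: interlaced_def)
  have decl: "l j \<le> l i" if "i \<le> j" for i j
    using that interlaced_decseq(1)[OF il] by (simp add: decseqD)
  define \<rho> where "\<rho> j = h (Suc j) * ((1 - q * z * t ^ j) / (1 - z * t ^ Suc j))" for j
  have wrr: "wr l ?m r k = wr l m r k * \<rho> (r + k)" for k
  proof -
    define a where "a = m r - l (r + k + 1)"
    have le: "l (r + k + 1) \<le> m r" using ml(2)[of r] decl[of "r + 1" "r + k + 1"] by simp
    have a: "Suc (m r) - l (Suc (r + k)) = Suc a" "m r - l (Suc (r + k)) = a"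
        "m r = a + l (Suc (r + k))"
      using le by (auto simp: a_def)
    have z1: "z * t ^ (r + k) = q ^ m r * t ^ k"
      by (simp add: z_def row_var_def power_add t_nz)
    have z2: "z / row_var l (Suc (r + k)) = q ^ a * t ^ (k + 1)"
      using a(3) q_nz by (simp add: z_def row_var_def power_add t_nz field_simps)
    have e: "q * z / (t * row_var l (Suc (r + k))) = q ^ (a + 1) * t ^ k"
            "q * z * t ^ (r + k) = q ^ (m r + 1) * t ^ k"
            "z * t ^ Suc (r + k) = q ^ m r * t ^ (k + 1)"
      using z2 z1 by (simp_all add: field_simps row_var_nz t_nz)
    show ?thesis
      unfolding \<rho>_def h_def e z2 wr_def add_box_def
      using one_minus_monom_nz[of "a + 1" k] one_minus_monom_nz[of "m r + 1" k]
        one_minus_monom_nz[of "m r" "k + 1"] g_nz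
      by (simp add: a g_Suc del: power_Suc) (simp add: mult_ac)
  qed
  have wr_other: "wr l ?m i k = wr l m i k" if "i \<noteq> r" for i k
    using that by (simp add: wr_def add_box_def)
  have "(\<Prod>i<N. \<Prod>k<N. wr l ?m i k) = (\<Prod>k<N. wr l ?m r k) * (\<Prod>i\<in>{..<N}-{r}. \<Prod>k<N. wr l ?m i k)"
    using r by (intro prod.remove) auto
  also have "\<dots> = (\<Prod>k<N. \<rho> (r + k)) * ((\<Prod>k<N. wr l m r k) * (\<Prod>i\<in>{..<N}-{r}. \<Prod>k<N. wr l m i k))"
    by (simp add: wrr wr_other prod.distrib)
  also have "(\<Prod>k<N. wr l m r k) * (\<Prod>i\<in>{..<N}-{r}. \<Prod>k<N. wr l m i k) = (\<Prod>i<N. \<Prod>k<N. wr l m i k)"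
    using r by (intro prod.remove[symmetric]) auto
  also have "(\<Prod>k<N. \<rho> (r + k)) = (\<Prod>k<N - 1 - r. \<rho> (r + k))"
  proof (intro prod.mono_neutral_right ballI)
    fix k assume "k \<in> {..<N} - {..<N - 1 - r}"
    hence "l (r + k + 1) = 0" using zf by (auto simp: zero_from_def)
    hence "wr l ?m r k = 1" "wr l m r k = 1" by (auto simp: wr_def g_nz)
    thus "\<rho> (r + k) = 1" using wrr[of k] by simp
  qed auto
  also have "\<dots> = (\<Prod>j\<in>{r..<N - 1}. \<rho> j)"
    using r by (intro prod.reindex_bij_witness[of _ "\<lambda>j. j - r" "\<lambda>k. r + k"]) auto
  finally have A: "(\<Prod>i<N. \<Prod>k<N. wr l ?m i k) = (\<Prod>j\<in>{r..<N - 1}. \<rho> j) * (\<Prod>i<N. \<Prod>k<N. wr l m i k)" .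
  have wll: "wl l ?m i (r - i) = wl l m i (r - i) * (q / t * h i)" if i: "i \<le> r" for i
  proof -
    define k where "k = r - i"
    have rk: "r = i + k" using i by (simp add: k_def)
    have "Suc (m r) \<le> l r"
      using il' by (auto simp: interlaced_def add_box_def dest!: spec[of _ r])
    also have "\<dots> \<le> l i" using i by (intro decl) auto
    finally have le: "Suc (m r) \<le> l i" .
    define n where "n = l i - Suc (m r)"
    have n: "l i - m r = Suc n" "l i - Suc (m r) = n" "l i = m r + n + 1" using le by (auto simp: n_def)
    have e1: "z / row_var l i = 1 / (q ^ Suc n * t ^ k)"
      unfolding z_def row_var_def using q_nz t_nz
      by (simp add: n(3) power_add field_simps) (simp add: rk power_add)
    have e2: "q * z / (t * row_var l i) = 1 / (q ^ n * t ^ Suc k)"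
      unfolding z_def row_var_def using q_nz t_nz
      by (simp add: n(3) power_add field_simps) (simp add: rk power_add)
    have nz: "1 - q ^ Suc n * t ^ k \<noteq> 0" "1 - q ^ n * t ^ Suc k \<noteq> 0"
      by (rule one_minus_monom_nz, simp)+
    have "q / t * h i = (1 - q ^ Suc n * t ^ k) / (1 - q ^ n * t ^ Suc k)"
      using reciprocal_ratio[of "q ^ n * t ^ k"] nz q_nz t_nz
      unfolding h_def e1 e2 by (simp add: mult_ac)
    moreover have "wl l ?m i k * g (l i) k = g n k" "wl l m i k * g (l i) k = g (Suc n) k"
      using g_nz[of "l i" k] rk n by (simp_all add: wl_def add_box_def)
    moreover have "g n k = g (Suc n) k * ((1 - q ^ Suc n * t ^ k) / (1 - q ^ n * t ^ Suc k))"
      by (rule g_eq_g_Suc)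
    ultimately have "wl l ?m i k * g (l i) k = wl l m i k * (q / t * h i) * g (l i) k"
      by (metis mult.assoc mult.commute)
    thus ?thesis using g_nz[of "l i" k] unfolding k_def[symmetric] by (simp only: mult_cancel_right) simp
  qed
  have wl_other: "wl l ?m i k = wl l m i k" if "i + k \<noteq> r" for i k
    using that by (simp add: wl_def add_box_def)
  have inner: "(\<Prod>k<N. wl l ?m i k) = (\<Prod>k<N. wl l m i k) * (if i \<le> r then q / t * h i else 1)" for i
  proof (cases "i \<le> r")
    case True
    let ?k = "r - i"
    have k: "?k \<in> {..<N}" using r by auto
    have "(\<Prod>k\<in>{..<N}-{?k}. wl l ?m i k) = (\<Prod>k\<in>{..<N}-{?k}. wl l m i k)"
      using True by (intro prod.cong refl wl_other) auto
    thus ?thesis using True wll[OF True]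
      by (subst (1 2) prod.remove[OF _ k]) auto
  qed (auto intro!: prod.cong wl_other)
  have "(\<Prod>i<N. \<Prod>k<N. wl l ?m i k)
      = (\<Prod>i<N. \<Prod>k<N. wl l m i k) * (\<Prod>i<N. if i \<le> r then q / t * h i else 1)"
    unfolding inner by (simp add: prod.distrib)
  also have "(\<Prod>i<N. if i \<le> r then q / t * h i else 1) = (\<Prod>i<Suc r. q / t * h i)"
    using r by (intro prod.mono_neutral_cong_right) auto
  finally have B: "(\<Prod>i<N. \<Prod>k<N. wl l ?m i k)
      = (\<Prod>i<N. \<Prod>k<N. wl l m i k) * ((q / t) ^ Suc r * (\<Prod>i<Suc r. h i))"
    by (simp only: prod.distrib prod_constant card_lessThan)
  have "(\<Prod>j\<in>{r..<N - 1}. h (Suc j)) = (\<Prod>j\<in>{Suc r..<N}. h j)"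
    using r by (subst prod.atLeast_Suc_lessThan_Suc_shift[symmetric, unfolded o_def]) simp
  hence split: "(\<Prod>j<N. h j) = (\<Prod>i<Suc r. h i) * (\<Prod>j\<in>{r..<N - 1}. h (Suc j))"
    using r prod.atLeastLessThan_concat[of 0 "Suc r" N h] by (simp add: lessThan_atLeast0)
  show ?thesis
    unfolding W_eq[OF il zf] W_eq[OF il' zf] A B z_def[symmetric]
      h_def[symmetric] split row_factor_def \<rho>_def prod.distrib power_Suc by (simp add: mult_ac)
qed

end

section \<open>One-box identities\<close>

definition del_box :: "(nat \<Rightarrow> nat) \<Rightarrow> nat \<Rightarrow> nat \<Rightarrow> nat" where
  "del_box l r = l(r := l r - 1)"

lemma add_del_box: "l r > 0 \<Longrightarrow> add_box (del_box l r) r = l"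
  by (auto simp: add_box_def del_box_def)

lemma del_add_box: "del_box (add_box l r) r = l"
  by (auto simp: add_box_def del_box_def)

lemma zero_from_del_box: "zero_from N l \<Longrightarrow> zero_from N (del_box l r)"
  by (auto simp: zero_from_def del_box_def)

lemma decseq_del_box: "decseq l \<Longrightarrow> l (Suc r) < l r \<Longrightarrow> decseq (del_box l r)"
  unfolding decseq_Suc_iff del_box_def by (auto; (metis Suc_leI Suc_pred diff_le_self le_trans less_Suc_eq_le not_less_zero neq0_conv)?)

context generic_qt
begin

text \<open>This is \<open>g 1 0\<close>, hence \<open>cauchy_coeff 1\<close>: the scalar by which
  adding one box and removing one box fail to commute.\<close>

definition cc :: 'a where "cc = (1 - t) / (1 - q)"

lemma one_minus_qt_nz: "1 - q \<noteq> 0" "1 - t \<noteq> 0" "q - t \<noteq> 0"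
  using monom_neq[of 1 0 0 0] monom_neq[of 0 0 1 0] monom_neq[of 1 0 0 1] by auto

lemma cc_nz: "cc \<noteq> 0"
  using one_minus_qt_nz by (simp add: cc_def)

text \<open>The terms of the four ways of passing from \<open>l\<close> to \<open>m\<close> by a horizontal strip and one box.
  As functions of the box they are residues of a rational function whose poles are the variables
  \<open>row_var l i\<close> and \<open>row_var m j\<close>, shifted by powers of \<open>q\<close> and \<open>t\<close>.\<close>

definition del_left :: "(nat \<Rightarrow> nat) \<Rightarrow> (nat \<Rightarrow> nat) \<Rightarrow> nat \<Rightarrow> 'a" where
  "del_left l m r = (if l (Suc r) < l r
     then W l (del_box l r) / W (del_box l r) (del_box l r) * W (del_box l r) m else 0)"

definition add_right :: "(nat \<Rightarrow> nat) \<Rightarrow> (nat \<Rightarrow> nat) \<Rightarrow> nat \<Rightarrow> 'a" where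
  "add_right l m s = (if decseq (add_box m s)
     then W l (add_box m s) / W (add_box m s) (add_box m s) * W (add_box m s) m else 0)"

definition del_right :: "(nat \<Rightarrow> nat) \<Rightarrow> (nat \<Rightarrow> nat) \<Rightarrow> nat \<Rightarrow> 'a" where
  "del_right l m s = (if m (Suc s) < m s
     then W l (del_box m s) * W m (del_box m s) / W (del_box m s) (del_box m s) else 0)"

definition add_left :: "(nat \<Rightarrow> nat) \<Rightarrow> (nat \<Rightarrow> nat) \<Rightarrow> nat \<Rightarrow> 'a" where
  "add_left l m r = (if decseq (add_box l r)
     then W (add_box l r) l / W (add_box l r) (add_box l r) * W (add_box l r) m else 0)"

lemma row_var_del_box:
  "l r > 0 \<Longrightarrow> row_var (del_box l r) i = (if i = r then row_var l r / q else row_var l i)"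
  using row_var_add_box[of "del_box l r" r i] q_nz by (auto simp: add_del_box)

text \<open>Two weights gain the same box, so \<open>row_factor\<close> cancels in their quotient.
  The constant \<open>cc\<close> is the factor of row \<open>r\<close> in the comparison of
  \<open>W l p\<close> with \<open>W p p\<close>, where the variable meets itself. For
  \<open>m r = l r\<close> the box cannot be removed without leaving \<open>m\<close>, and the
  product over \<open>m\<close> vanishes.\<close>

lemma del_left_eq:
  assumes il: "interlaced l m" and zf: "zero_from N l" and r: "r < N"
  shows "del_left l m r = W l m * cc *
    (\<Prod>j\<in>{..<N}-{r}. (1 - t * row_var l r / (q * row_var l j)) / (1 - row_var l r / row_var l j)) *
    (\<Prod>j<N. (1 - row_var l r / row_var m j) / (1 - t * row_var l r / (q * row_var m j)))"
proof (cases "m r = l r")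
  case True
  have "1 - row_var l r / row_var m r = 0"
    using True by (simp add: row_var_def q_nz t_nz)
  hence "(\<Prod>j<N. (1 - row_var l r / row_var m j) / (1 - t * row_var l r / (q * row_var m j))) = 0"
    using r by (intro prod_zero) auto
  moreover have "W (del_box l r) m = 0" if "l (Suc r) < l r"
    using that True by (intro W_0) (auto simp: interlaced_def del_box_def intro!: exI[of _ r])
  ultimately show ?thesis by (auto simp: del_left_def)
next
  case False
  define z where "z = row_var l r"
  define p where "p = del_box l r"
  have ml: "m i \<le> l i" "l (Suc i) \<le> m i" for i using il by (auto simp: interlaced_def)
  have lt: "m r < l r" using False ml(1)[of r] by simp
  hence rem: "l (Suc r) < l r" using ml(2)[of r] by simp
  have l: "l = add_box p r" using lt by (simp add: p_def add_del_box)
  have ilp: "interlaced p m"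
    using ml lt by (auto simp: interlaced_def p_def del_box_def; metis le_diff_conv2 Suc_leI le_simps(3) diff_le_self le_trans Suc_pred)
  have dp: "interlaced p p" using interlaced_refl[OF interlaced_decseq(1)[OF ilp]] .
  have zp: "zero_from N p" using zf by (simp add: p_def zero_from_del_box)
  have xr: "row_var p i = (if i = r then z / q else row_var l i)" for i
    using row_var_del_box[of l r i] lt by (auto simp: p_def z_def)
  define A where "A = row_factor N r (z / q)"
  have "W l m \<noteq> 0" by (rule W_nz[OF il zf])
  define H where "H = (\<Prod>j\<in>{..<N}-{r}. (1 - t * z / (q * row_var l j)) / (1 - z / row_var l j))"
  define h where "h = (\<Prod>j<N. (1 - t * z / (q * row_var m j)) / (1 - z / row_var m j))"
  have 1: "W l p = W p p * A * (cc * H)"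
  proof -
    have "W l p = W p p * A * (\<Prod>j<N. (1 - t * (z / q) / row_var p j) / (1 - q * (z / q) / row_var p j))"
      using W_add_box_left[OF dp zp r] by (simp add: l[symmetric] xr A_def)
    also have "(\<Prod>j<N. (1 - t * (z / q) / row_var p j) / (1 - q * (z / q) / row_var p j)) = cc * H"
      unfolding H_def
      by (subst prod.remove[of _ r]) (use r q_nz row_var_nz[of l r] in \<open>auto simp: xr cc_def z_def mult_ac\<close>)
    finally show ?thesis .
  qed
  have 2: "W l m = W p m * A * h"
  proof -
    have "W l m = W p m * A * (\<Prod>j<N. (1 - t * (z / q) / row_var m j) / (1 - q * (z / q) / row_var m j))"
      using W_add_box_left[OF ilp zp r] by (simp add: l[symmetric] xr A_def)
    also have "(\<Prod>j<N. (1 - t * (z / q) / row_var m j) / (1 - q * (z / q) / row_var m j)) = h"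
      unfolding h_def using q_nz by (intro prod.cong) (auto simp: mult_ac)
    finally show ?thesis .
  qed
  have nz: "h \<noteq> 0" "A \<noteq> 0" "W p p \<noteq> 0"
    using 2 \<open>W l m \<noteq> 0\<close> W_nz[OF dp zp] by auto
  have h': "(\<Prod>j<N. (1 - z / row_var m j) / (1 - t * z / (q * row_var m j))) = 1 / h"
    unfolding h_def by (simp add: prod_dividef)
  have "del_left l m r = W l p / W p p * W p m"
    using rem by (simp add: del_left_def p_def)
  also have "\<dots> = W l m * cc * H * (1 / h)"
    unfolding 1 2 using nz by simp
  finally show ?thesis unfolding h'[symmetric] by (simp add: H_def z_def)
qed

text \<open>The factor of row \<open>s\<close> in the diagonal weight is now
  \<open>(1 - 1 / q) / (1 - 1 / t)\<close>, the inverse of \<open>q / t * cc\<close>; as this weight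
  is a denominator, \<open>q / t * cc\<close> remains.\<close>

lemma add_right_eq:
  assumes il: "interlaced l m" and zf: "zero_from N l" and s: "s < N"
  shows "add_right l m s = W l m * (q / t * cc) *
    (\<Prod>j\<in>{..<N}-{s}. (1 - q * row_var m s / (t * row_var m j)) / (1 - row_var m s / row_var m j)) *
    (\<Prod>j<N. (1 - row_var m s / row_var l j) / (1 - q * row_var m s / (t * row_var l j)))"
proof (cases "interlaced l (add_box m s)")
  case False
  have "m s = l s"
    using False il unfolding interlaced_def add_box_def
    by (auto split: if_splits; metis Suc_leI le_SucI le_neq_implies_less)
  hence "1 - row_var m s / row_var l s = 0"
    by (simp add: row_var_def q_nz t_nz)
  hence "(\<Prod>j<N. (1 - row_var m s / row_var l j) / (1 - q * row_var m s / (t * row_var l j))) = 0"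
    using s by (intro prod_zero) auto
  thus ?thesis using False by (simp add: add_right_def W_0)
next
  case True
  define z where "z = row_var m s"
  define p where "p = add_box m s"
  have dp: "interlaced p p" using interlaced_refl[OF interlaced_decseq(2)[OF True]] by (simp add: p_def)
  have zm: "zero_from N m" by (rule zero_from_interlaced[OF il zf])
  have zp: "zero_from N p" unfolding p_def by (rule zero_from_add_box[OF zm s])
  have decm: "decseq m" by (rule interlaced_decseq(2)[OF il])
  have pm: "interlaced p m"
    using il True unfolding p_def interlaced_def add_box_def
    by (auto simp: decseq_SucD[OF decm]; metis decseq_SucD le_trans fun_upd_same)
  have xp: "row_var p i = (if i = s then q * z else row_var m i)" for i
    by (simp add: p_def z_def row_var_add_box)
  define A where "A = q / t * row_factor (N - 1) s z"
  define H where "H = (\<Prod>j\<in>{..<N}-{s}. (1 - z / row_var m j) / (1 - q * z / (t * row_var m j)))"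
  define h where "h = (\<Prod>j<N. (1 - z / row_var l j) / (1 - q * z / (t * row_var l j)))"
  have 1: "W p p = W p m * A * (t / (q * cc) * H)"
  proof -
    have "W p p = W p m * A * (\<Prod>j<N. (1 - z / row_var p j) / (1 - q * z / (t * row_var p j)))"
      using W_add_box_right[OF pm zp s] by (simp add: p_def[symmetric] z_def[symmetric] A_def)
    also have "(\<Prod>j<N. (1 - z / row_var p j) / (1 - q * z / (t * row_var p j)))
        = (1 - 1 / q) / (1 - 1 / t) * H"
      unfolding H_def
      by (subst prod.remove[of _ s]) (use s q_nz row_var_nz[of m s] in \<open>auto simp: xp z_def mult_ac\<close>)
    also have "(1 - 1 / q) / (1 - 1 / t) = t / (q * cc)"
      using q_nz t_nz one_minus_qt_nz by (simp add: cc_def divide_simps) (simp add: algebra_simps)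
    finally show ?thesis .
  qed
  have 2: "W l p = W l m * A * h"
    using W_add_box_right[OF il zf s] by (simp add: p_def z_def A_def h_def)
  have nz: "W p p \<noteq> 0" using W_nz[OF dp zp] .
  have nz': "W p m \<noteq> 0" "A \<noteq> 0" "H \<noteq> 0" using 1 nz by auto
  have h': "(\<Prod>j\<in>{..<N}-{s}. (1 - q * z / (t * row_var m j)) / (1 - z / row_var m j)) = 1 / H"
    unfolding H_def by (simp add: prod_dividef)
  have "add_right l m s = W l p / W p p * W p m"
    using interlaced_decseq(1)[OF dp] by (simp add: add_right_def p_def)
  also have "\<dots> = W l m * (q / t * cc) * (1 / H) * h"
    unfolding 1 2 using nz' q_nz t_nz cc_nz by simp
  finally show ?thesis unfolding h'[symmetric] by (simp add: h_def z_def)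
qed

text \<open>The row bound for \<open>l\<close> is one larger than that for \<open>m\<close>: with it
  the formula for adding on the right produces \<open>row_factor N\<close>, the same as the formula
  for adding on the left does for \<open>m\<close>, so that they cancel. The extra row also holds
  the zero for \<open>m s = l (Suc s)\<close> when \<open>s\<close> is the last row.\<close>

lemma del_right_eq:
  assumes il: "interlaced l m" and zf: "zero_from N l" and s: "s < N"
  shows "del_right l m s = W l m * (t / q * cc) *
    (\<Prod>j\<in>{..<N}-{s}. (1 - t * row_var m s / (q * row_var m j)) / (1 - row_var m s / row_var m j)) *
    (\<Prod>j<Suc N. (1 - row_var m s / (t * row_var l j)) / (1 - row_var m s / (q * row_var l j)))"
proof (cases "m s = l (Suc s)")
  case True
  have "1 - row_var m s / (t * row_var l (Suc s)) = 0"
    using True by (simp add: row_var_def q_nz t_nz)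
  hence "(\<Prod>j<Suc N. (1 - row_var m s / (t * row_var l j)) / (1 - row_var m s / (q * row_var l j))) = 0"
    using s by (intro prod_zero) auto
  moreover have "W l (del_box m s) = 0" if "m (Suc s) < m s"
    using that True by (intro W_0) (auto simp: interlaced_def del_box_def intro!: exI[of _ s])
  ultimately show ?thesis by (auto simp: del_right_def)
next
  case False
  define z where "z = row_var m s"
  define p where "p = del_box m s"
  have ml: "m i \<le> l i" "l (Suc i) \<le> m i" for i using il by (auto simp: interlaced_def)
  have lt: "l (Suc s) < m s" using False ml(2)[of s] by simp
  hence rem: "m (Suc s) < m s" using ml(1)[of "Suc s"] by simp
  have m: "m = add_box p s" using lt by (simp add: p_def add_del_box)
  have ilp: "interlaced l p"
    using ml lt by (auto simp: interlaced_def p_def del_box_def intro: diff_le_self le_trans)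
  have dp: "interlaced p p" using interlaced_refl[OF interlaced_decseq(2)[OF ilp]] .
  have zm: "zero_from N m" by (rule zero_from_interlaced[OF il zf])
  have zp: "zero_from N p" using zm by (simp add: p_def zero_from_del_box)
  have zf1: "zero_from (Suc N) l" using zf by (simp add: zero_from_def)
  have xr: "row_var p i = (if i = s then z / q else row_var m i)" for i
    using row_var_del_box[of m s i] lt by (auto simp: p_def z_def)
  define A where "A = row_factor N s (z / q)"
  have "W l m \<noteq> 0" by (rule W_nz[OF il zf])
  define H where "H = (\<Prod>j\<in>{..<N}-{s}. (1 - t * z / (q * row_var m j)) / (1 - z / row_var m j))"
  define h where "h = (\<Prod>j<Suc N. (1 - z / (q * row_var l j)) / (1 - z / (t * row_var l j)))"
  have 1: "W m p = W p p * A * (cc * H)"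
  proof -
    have "W m p = W p p * A * (\<Prod>j<N. (1 - t * (z / q) / row_var p j) / (1 - q * (z / q) / row_var p j))"
      using W_add_box_left[OF dp zp s] by (simp add: m[symmetric] xr A_def)
    also have "(\<Prod>j<N. (1 - t * (z / q) / row_var p j) / (1 - q * (z / q) / row_var p j)) = cc * H"
      unfolding H_def
      by (subst prod.remove[of _ s]) (use s q_nz row_var_nz[of m s] in \<open>auto simp: xr cc_def z_def mult_ac\<close>)
    finally show ?thesis .
  qed
  have 2: "W l m = W l p * (q / t * A) * h"
  proof -
    have "W l m = W l p * (q / t * A) *
        (\<Prod>j<Suc N. (1 - z / q / row_var l j) / (1 - q * (z / q) / (t * row_var l j)))"
      using W_add_box_right[OF ilp zf1, of s] s by (simp add: m[symmetric] xr A_def del: prod.lessThan_Suc)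
    also have "(\<Prod>j<Suc N. (1 - z / q / row_var l j) / (1 - q * (z / q) / (t * row_var l j))) = h"
      unfolding h_def using q_nz by (intro prod.cong) (auto simp: mult_ac)
    finally show ?thesis .
  qed
  have nz: "h \<noteq> 0" "A \<noteq> 0" "W p p \<noteq> 0"
    using 2 \<open>W l m \<noteq> 0\<close> W_nz[OF dp zp] by auto
  have h': "(\<Prod>j<Suc N. (1 - z / (t * row_var l j)) / (1 - z / (q * row_var l j))) = 1 / h"
    unfolding h_def by (simp add: prod_dividef del: prod.lessThan_Suc)
  have "del_right l m s = W l p * W m p / W p p"
    using rem by (simp add: del_right_def p_def)
  also have "\<dots> = W l m * (t / q * cc) * H * (1 / h)"
    unfolding 1 2 using nz q_nz t_nz by simp
  finally show ?thesis unfolding h'[symmetric] by (simp add: H_def z_def del: prod.lessThan_Suc)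
qed

text \<open>The new box may open row \<open>N\<close> of \<open>l\<close>, so \<open>r\<close> and
  the rows of \<open>l\<close> range over \<open>Suc N\<close> values, while \<open>m\<close> keeps
  \<open>N\<close> rows.\<close>

lemma add_left_eq:
  assumes il: "interlaced l m" and zf: "zero_from N l" and r: "r < Suc N"
  shows "add_left l m r = W l m * cc *
    (\<Prod>j\<in>{..<Suc N}-{r}. (1 - q * row_var l r / (t * row_var l j)) / (1 - row_var l r / row_var l j)) *
    (\<Prod>j<N. (1 - t * row_var l r / row_var m j) / (1 - q * row_var l r / row_var m j))"
proof (cases "interlaced (add_box l r) m")
  case False
  then obtain i where "\<not> (m i \<le> add_box l r i \<and> add_box l r (Suc i) \<le> m i)"
    unfolding interlaced_def by blast
  moreover have "m i \<le> l i" "l (Suc i) \<le> m i" using il by (auto simp: interlaced_def)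
  ultimately have i: "Suc i = r" "l r = m i" by (auto simp: add_box_def split: if_splits)
  have "1 - t * row_var l r / row_var m i = 0"
    using i q_nz t_nz by (simp add: row_var_def i(1)[symmetric])
  moreover have "i < N" using i r by simp
  ultimately have "(\<Prod>j<N. (1 - t * row_var l r / row_var m j) / (1 - q * row_var l r / row_var m j)) = 0"
    by (intro prod_zero) auto
  thus ?thesis using False by (simp add: add_left_def W_0)
next
  case True
  define z where "z = row_var l r"
  define p where "p = add_box l r"
  have decp: "decseq p" using interlaced_decseq(1)[OF True] by (simp add: p_def)
  have dp: "interlaced p p" using interlaced_refl[OF decp] .
  have zf1: "zero_from (Suc N) l" using zf by (simp add: zero_from_def)
  have zp: "zero_from (Suc N) p" unfolding p_def by (rule zero_from_add_box[OF zf1 r])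
  have decl: "decseq l" by (rule interlaced_decseq(1)[OF il])
  have pl: "interlaced p l"
    unfolding interlaced_def
  proof (intro allI conjI)
    fix i
    show "l i \<le> p i" by (simp add: p_def add_box_def)
    have "Suc (l r) \<le> l i" if "Suc i = r"
    proof -
      have "Suc (l r) \<le> m i" using True that by (auto simp: interlaced_def add_box_def dest!: spec[of _ i])
      also have "m i \<le> l i" using il by (auto simp: interlaced_def)
      finally show ?thesis .
    qed
    thus "p (Suc i) \<le> l i" using decseq_SucD[OF decl, of i] by (auto simp: p_def add_box_def)
  qed
  have zm: "zero_from N m" by (rule zero_from_interlaced[OF il zf])
  have xp: "row_var p i = (if i = r then q * z else row_var l i)" for i
    by (simp add: p_def z_def row_var_add_box)
  define A where "A = row_factor N r z"
  define H where "H = (\<Prod>j\<in>{..<Suc N}-{r}. (1 - z / row_var l j) / (1 - q * z / (t * row_var l j)))"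
  define h where "h = (\<Prod>j<N. (1 - t * z / row_var m j) / (1 - q * z / row_var m j))"
  have 1: "W p p = W p l * (q / t * A) * (t / (q * cc) * H)"
  proof -
    have "W p p = W p l * (q / t * A) * (\<Prod>j<Suc N. (1 - z / row_var p j) / (1 - q * z / (t * row_var p j)))"
      using W_add_box_right[OF pl zp r] by (simp add: p_def[symmetric] z_def[symmetric] A_def del: prod.lessThan_Suc)
    also have "(\<Prod>j<Suc N. (1 - z / row_var p j) / (1 - q * z / (t * row_var p j)))
        = (1 - 1 / q) / (1 - 1 / t) * H"
      unfolding H_def
      by (subst prod.remove[of _ r]) (use r q_nz row_var_nz[of l r] in \<open>auto simp: xp z_def mult_ac\<close>)
    also have "(1 - 1 / q) / (1 - 1 / t) = t / (q * cc)"
      using q_nz t_nz one_minus_qt_nz by (simp add: cc_def divide_simps) (simp add: algebra_simps)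
    finally show ?thesis .
  qed
  have 2: "W p m = W l m * A * h"
  proof -
    \<comment> \<open>Row \<open>N\<close> of \<open>m\<close> is empty, so its variable is
      \<open>1 / t ^ N\<close>; the extra factor of \<open>row_factor (Suc N)\<close> and the extra
      factor of the product over \<open>m\<close> then cancel.\<close>
    have zq: "z * t ^ N = q ^ l r * t ^ N / t ^ r" by (simp add: z_def row_var_def)
    have y: "row_var m N = 1 / t ^ N" using zm by (simp add: row_var_def zero_from_def)
    have nz: "1 - q * z * t ^ N \<noteq> 0" "1 - t * z * t ^ N \<noteq> 0"
    proof -
      have e: "z * t ^ N = q ^ l r * t ^ (N - r)"
        using r t_nz by (simp add: zq power_diff)
      show "1 - q * z * t ^ N \<noteq> 0"
        using one_minus_monom_nz[of "Suc (l r)" "N - r"] by (simp add: mult.assoc e)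
      show "1 - t * z * t ^ N \<noteq> 0"
        using one_minus_monom_nz[of "l r" "Suc (N - r)"] by (simp add: mult.assoc e mult.left_commute)
    qed
    have "row_factor (Suc N) r z = A * ((1 - q * z * t ^ N) / (1 - z * t ^ Suc N))"
      using r by (simp add: row_factor_def A_def)
    moreover have "(\<Prod>j<Suc N. (1 - t * z / row_var m j) / (1 - q * z / row_var m j)) =
        h * ((1 - t * z * t ^ N) / (1 - q * z * t ^ N))"
      by (simp add: h_def y)
    ultimately show ?thesis
      using W_add_box_left[OF il zf1 r] nz
      by (simp add: p_def[symmetric] z_def[symmetric] mult_ac del: prod.lessThan_Suc)
  qed
  have nz: "W p p \<noteq> 0" using W_nz[OF dp zp] .
  have nz': "W p l \<noteq> 0" "A \<noteq> 0" "H \<noteq> 0"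
    by (rule notI, use 1 nz in simp)+
  have h': "(\<Prod>j\<in>{..<Suc N}-{r}. (1 - q * z / (t * row_var l j)) / (1 - z / row_var l j)) = 1 / H"
    unfolding H_def by (simp add: prod_dividef)
  have "add_left l m r = W p l / W p p * W p m"
    using decp by (simp add: add_left_def p_def)
  also have "\<dots> = W l m * cc * (1 / H) * h"
    unfolding 1 2 using nz' q_nz t_nz cc_nz by simp
  finally show ?thesis unfolding h'[symmetric] by (simp add: h_def z_def)
qed

text \<open>If \<open>l\<close> and \<open>m\<close> do not interlace, poles collide and the residue argument breaks down,
  but then the terms agree in pairs.\<close>

lemma del_left_not_interlaced:
  assumes dl: "decseq l" and dm: "decseq m" and zf: "zero_from N l" "zero_from N m"
    and nil: "\<not> interlaced l m"
  shows "del_left l m 0 = 0"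
    and "del_left l m (Suc s) = add_right l m s"
    and "add_right l m s \<noteq> 0 \<Longrightarrow> row_var l (Suc s) = q * row_var m s / t"
proof -
  \<comment> \<open>If the removal of one box repairs the interlacing, the obstruction is a single
    excess box in row \<open>r = Suc i\<close> of \<open>l\<close>, and it can equally well be
    granted to row \<open>i\<close> of \<open>m\<close>. Row 0 of \<open>l\<close> is not bounded
    above by any row of \<open>m\<close>, so removing its box never helps.\<close>
  have C: "l (Suc i) = Suc (m i) \<and> r = Suc i \<and> interlaced l (add_box m i)"
    if "interlaced (del_box l r) m" "r = Suc i \<or> r = 0 \<and> i = 0" for r i
  proof -
    have 1: "m k \<le> l k" "k \<noteq> r \<Longrightarrow> Suc k \<noteq> r \<Longrightarrow> l (Suc k) \<le> m k" for k
      using that(1) by (auto simp: interlaced_def del_box_def split: if_splits dest!: spec[of _ k])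
    have 2: "l (Suc r) \<le> m r" 
      using that(1) by (auto simp: interlaced_def del_box_def split: if_splits dest!: spec[of _ r])
    have "l r \<le> Suc (m (r - 1))" if "r \<noteq> 0"
      using \<open>interlaced (del_box l r) m\<close> that
      by (auto simp: interlaced_def del_box_def split: if_splits dest!: spec[of _ "r - 1"])
    moreover obtain k where k: "\<not> (m k \<le> l k \<and> l (Suc k) \<le> m k)"
      using nil by (auto simp: interlaced_def)
    ultimately have "Suc k = r" "l r = Suc (m k)"
      using 1[of k] 2 by (metis le_antisym not_less_eq_eq diff_Suc_1 nat.distinct(1))+
    hence "r = Suc i" "l (Suc i) = Suc (m i)" using that(2) by auto
    moreover have "interlaced l (add_box m i)"
      unfolding interlaced_def
    proof (intro allI conjI)
      fix j
      show "add_box m i j \<le> l j"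
        using 1(1)[of j] calculation decseq_SucD[OF dl, of i] by (auto simp: add_box_def)
      show "l (Suc j) \<le> add_box m i j"
        using 1(2)[of j] 2 calculation by (auto simp: add_box_def)
    qed
    ultimately show ?thesis by simp
  qed
  show "del_left l m 0 = 0"
    using C[of 0 0] by (auto simp: del_left_def W_def)
  define r where "r = Suc s"
  define \<rho> where "\<rho> = del_box l r"
  define \<sigma> where "\<sigma> = add_box m s"
  have C': "l r = Suc (m s) \<and> interlaced \<rho> m \<and> l (Suc r) < l r"
    if il: "interlaced l \<sigma>"
  proof -
    have 1: "m k \<le> l k" "k \<noteq> s \<Longrightarrow> l (Suc k) \<le> m k" "l r \<le> Suc (m s)" for k
      using il[unfolded interlaced_def, rule_format, of k] il[unfolded interlaced_def, rule_format, of s]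
      by (auto simp: \<sigma>_def add_box_def r_def split: if_splits)
    obtain k where k: "\<not> (m k \<le> l k \<and> l (Suc k) \<le> m k)"
      using nil by (auto simp: interlaced_def)
    hence eq: "l r = Suc (m s)" using 1 by (cases "k = s") (auto simp: r_def)
    have "l (Suc r) \<le> m r" using 1(2)[of r] by (simp add: r_def)
    also have "\<dots> \<le> m s" using decseq_SucD[OF dm, of s] by (simp add: r_def)
    finally have "l (Suc r) < l r" using eq by simp
    moreover have "interlaced \<rho> m"
      unfolding interlaced_def
    proof (intro allI conjI)
      fix j
      show "m j \<le> \<rho> j"
        using 1(1)[of j] eq decseq_SucD[OF dm, of s] by (auto simp: \<rho>_def del_box_def r_def)
      show "\<rho> (Suc j) \<le> m j"
        using 1(2)[of j] eq by (cases "j = s") (auto simp: \<rho>_def del_box_def r_def)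
    qed
    ultimately show ?thesis using eq by simp
  qed
  have iff: "l (Suc r) < l r \<and> interlaced \<rho> m \<longleftrightarrow> decseq \<sigma> \<and> interlaced l \<sigma>"
    using C[of r s] C' interlaced_decseq(2)[of l \<sigma>] by (auto simp: r_def \<rho>_def \<sigma>_def)
  show "row_var l (Suc s) = q * row_var m s / t" if "add_right l m s \<noteq> 0"
  proof -
    have "interlaced l \<sigma>" using that by (auto simp: add_right_def W_def \<sigma>_def split: if_splits)
    thus ?thesis using C' by (simp add: row_var_def r_def)
  qed
  show "del_left l m (Suc s) = add_right l m s"
  proof (cases "decseq \<sigma> \<and> interlaced l \<sigma>")
    case False
    have "add_right l m s = 0" using False by (auto simp: add_right_def \<sigma>_def[symmetric] W_0)
    moreover have "del_left l m r = 0"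
      using False iff by (auto simp: del_left_def \<rho>_def[symmetric] W_0)
    ultimately show ?thesis by (simp add: r_def)
  next
    case True
    hence il: "interlaced l \<sigma>" and ds: "decseq \<sigma>" by auto
    from C'[OF il] have eq: "l r = Suc (m s)" and rm: "interlaced \<rho> m" and rem: "l (Suc r) < l r" by auto
    have l: "l = add_box \<rho> r" using eq by (simp add: \<rho>_def add_del_box)
    have rN: "r < N" using zf(1) eq by (auto simp: zero_from_def not_less[symmetric])
    hence sN: "s < N" by (simp add: r_def)
    have zr: "zero_from N \<rho>" using zf(1) by (simp add: \<rho>_def zero_from_del_box)
    have zs: "zero_from N \<sigma>" using zf(2) sN by (simp add: \<sigma>_def zero_from_add_box)
    have rr: "interlaced \<rho> \<rho>" using interlaced_refl[OF interlaced_decseq(1)[OF rm]] .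
    have ss: "interlaced \<sigma> \<sigma>" using interlaced_refl[OF ds] .
    have rs: "interlaced \<rho> \<sigma>"
      unfolding interlaced_def
    proof (intro allI conjI)
      fix j
      show "\<sigma> j \<le> \<rho> j"
        using il rm by (auto simp: interlaced_def \<sigma>_def \<rho>_def del_box_def add_box_def r_def
          dest!: spec[of _ j])
      show "\<rho> (Suc j) \<le> \<sigma> j"
        using rm by (auto simp: interlaced_def \<sigma>_def add_box_def le_SucI)
    qed
    have sm: "interlaced \<sigma> m"
      unfolding interlaced_def
    proof (intro allI conjI)
      fix j
      show "m j \<le> \<sigma> j" by (simp add: \<sigma>_def add_box_def)
      have "Suc (m s) \<le> l s" using il by (auto simp: interlaced_def \<sigma>_def add_box_def dest!: spec[of _ s])
      moreover have "l s \<le> m j" if "s = Suc j" using rm that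
        by (auto simp: interlaced_def \<rho>_def del_box_def r_def split: if_splits dest!: spec[of _ j])
      ultimately show "\<sigma> (Suc j) \<le> m j"
        using decseq_SucD[OF dm, of j] by (auto simp: \<sigma>_def add_box_def)
    qed
    define z where "z = row_var \<rho> r"
    \<comment> \<open>The rows that receive the two boxes have variables differing by the factor
      \<open>t\<close>. This turns the product for adding to \<open>m\<close> into the one for
      adding to \<open>l\<close>, so \<open>P1\<close> and \<open>P2\<close> each occur twice and
      drop out of the comparison.\<close>
    have tz: "row_var m s = t * z"
      using eq t_nz by (simp add: z_def row_var_def \<rho>_def del_box_def r_def)
    define a where "a = row_factor N r z"
    define b where "b = q / t * row_factor (N - 1) s (t * z)"
    define P1 where "P1 = (\<Prod>j<N. (1 - t * z / row_var \<rho> j) / (1 - q * z / row_var \<rho> j))"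
    define P2 where "P2 = (\<Prod>j<N. (1 - t * z / row_var \<sigma> j) / (1 - q * z / row_var \<sigma> j))"
    have cancel: "q * (t * z) / (t * u) = q * z / u" for u using t_nz by simp
    have e1: "W l \<rho> = W \<rho> \<rho> * a * P1"
      unfolding l a_def P1_def z_def by (rule W_add_box_left[OF rr zr rN])
    have e2: "W \<rho> \<sigma> = W \<rho> m * b * P1"
      using W_add_box_right[OF rm zr sN] by (simp only: \<sigma>_def[symmetric] tz cancel b_def P1_def)
    have e3: "W l \<sigma> = W \<rho> \<sigma> * a * P2"
      unfolding l a_def P2_def z_def by (rule W_add_box_left[OF rs zr rN])
    have e4: "W \<sigma> \<sigma> = W \<sigma> m * b * P2"
      using W_add_box_right[OF sm zs sN] by (simp only: \<sigma>_def[symmetric] tz cancel b_def P2_def)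
    have nz: "W \<sigma> \<sigma> \<noteq> 0" "W \<rho> \<rho> \<noteq> 0" using W_nz ss rr zs zr by auto
    hence nz': "W \<sigma> m \<noteq> 0" "b \<noteq> 0" "P2 \<noteq> 0" using e4 by auto
    have "del_left l m r = W l \<rho> / W \<rho> \<rho> * W \<rho> m" using rem by (simp add: del_left_def \<rho>_def)
    also have "\<dots> = W l \<sigma> / W \<sigma> \<sigma> * W \<sigma> m"
      unfolding e1 e3 e2 e4 using nz nz' by simp
    also have "\<dots> = add_right l m s" using ds by (simp add: add_right_def \<sigma>_def)
    finally show ?thesis by (simp add: r_def)
  qed
qed

text \<open>Here the partners lie in the same row: the obstruction is one box of row
  \<open>s\<close> of \<open>m\<close> that sticks out of \<open>l\<close>, and it can be removed
  from \<open>m\<close> or added to \<open>l\<close>. By the second claim the weights by inverse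
  variables agree as well.\<close>

lemma del_right_not_interlaced:
  assumes dl: "decseq l" and dm: "decseq m" and zf: "zero_from N l" "zero_from N m"
    and nil: "\<not> interlaced l m" and s: "s < N"
  shows "del_right l m s = add_left l m s"
    and "del_right l m s \<noteq> 0 \<Longrightarrow> row_var m s = q * row_var l s"
proof -
  define \<kappa> where "\<kappa> = del_box m s"
  define \<rho> where "\<rho> = add_box l s"
  have C: "m s = Suc (l s) \<and> interlaced \<rho> m" if "interlaced l \<kappa>"
  proof -
    have 1: "l (Suc k) \<le> m k" "k \<noteq> s \<Longrightarrow> m k \<le> l k" "m s \<le> Suc (l s)" for k
      using that[unfolded interlaced_def, rule_format, of k]
        that[unfolded interlaced_def, rule_format, of s]
      by (auto simp: \<kappa>_def del_box_def split: if_splits)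
    obtain k where "\<not> (m k \<le> l k \<and> l (Suc k) \<le> m k)"
      using nil by (auto simp: interlaced_def)
    hence eq: "m s = Suc (l s)" using 1 by (cases "k = s") auto
    have "interlaced \<rho> m"
      unfolding interlaced_def
    proof (intro allI conjI)
      fix j
      show "m j \<le> \<rho> j" using 1(2)[of j] eq by (auto simp: \<rho>_def add_box_def)
      show "\<rho> (Suc j) \<le> m j"
        using 1(1)[of j] eq decseq_SucD[OF dm, of j] by (auto simp: \<rho>_def add_box_def)
    qed
    thus ?thesis using eq by simp
  qed
  have C': "m s = Suc (l s) \<and> interlaced l \<kappa> \<and> m (Suc s) < m s" if il: "interlaced \<rho> m"
  proof -
    have 1: "l (Suc k) \<le> m k" "k \<noteq> s \<Longrightarrow> m k \<le> l k" "m s \<le> Suc (l s)" for k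
      using il[unfolded interlaced_def, rule_format, of k] il[unfolded interlaced_def, rule_format, of s]
      by (auto simp: \<rho>_def add_box_def split: if_splits)
    obtain k where "\<not> (m k \<le> l k \<and> l (Suc k) \<le> m k)"
      using nil by (auto simp: interlaced_def)
    hence eq: "m s = Suc (l s)" using 1 by (cases "k = s") auto
    have "interlaced l \<kappa>"
      unfolding interlaced_def
    proof (intro allI conjI)
      fix j
      show "\<kappa> j \<le> l j" using 1(2)[of j] eq by (auto simp: \<kappa>_def del_box_def)
      show "l (Suc j) \<le> \<kappa> j"
        using 1(1)[of j] eq decseq_SucD[OF dl, of j] by (auto simp: \<kappa>_def del_box_def)
    qed
    moreover have "m (Suc s) < m s"
      using 1(2)[of "Suc s"] decseq_SucD[OF dl, of s] eq by simp
    ultimately show ?thesis using eq by simp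
  qed
  have iff: "m (Suc s) < m s \<and> interlaced l \<kappa> \<longleftrightarrow> decseq \<rho> \<and> interlaced \<rho> m"
    using C C' interlaced_decseq(1)[of \<rho> m] by auto
  show "row_var m s = q * row_var l s" if "del_right l m s \<noteq> 0"
  proof -
    have "interlaced l \<kappa>" using that by (auto simp: del_right_def W_def \<kappa>_def split: if_splits)
    thus ?thesis using C by (simp add: row_var_def)
  qed
  show "del_right l m s = add_left l m s"
  proof (cases "decseq \<rho> \<and> interlaced \<rho> m")
    case False
    have "add_left l m s = 0" using False by (auto simp: add_left_def \<rho>_def[symmetric] W_0)
    moreover have "del_right l m s = 0"
      using False iff by (auto simp: del_right_def \<kappa>_def[symmetric] W_0)
    ultimately show ?thesis by simp
  next
    case True
    hence rm: "interlaced \<rho> m" and dr: "decseq \<rho>" by auto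
    from C'[OF rm] have eq: "m s = Suc (l s)" and lk: "interlaced l \<kappa>" and rem: "m (Suc s) < m s" by auto
    have m: "m = add_box \<kappa> s" using eq by (simp add: \<kappa>_def add_del_box)
    have zk: "zero_from N \<kappa>" using zf(2) by (simp add: \<kappa>_def zero_from_del_box)
    have zr: "zero_from N \<rho>" using zf(1) s by (simp add: \<rho>_def zero_from_add_box)
    have kk: "interlaced \<kappa> \<kappa>" using interlaced_refl[OF interlaced_decseq(2)[OF lk]] .
    have rr: "interlaced \<rho> \<rho>" using interlaced_refl[OF dr] .
    have rk: "interlaced \<rho> \<kappa>"
      unfolding interlaced_def
    proof (intro allI conjI)
      fix j
      show "\<kappa> j \<le> \<rho> j"
        using lk by (auto simp: interlaced_def \<rho>_def add_box_def le_SucI)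
      show "\<rho> (Suc j) \<le> \<kappa> j"
        using lk rm by (auto simp: interlaced_def \<kappa>_def \<rho>_def del_box_def add_box_def split: if_splits
          dest!: spec[of _ j])
    qed
    have rl: "interlaced \<rho> l"
      unfolding interlaced_def
    proof (intro allI conjI)
      fix j
      show "l j \<le> \<rho> j" by (simp add: \<rho>_def add_box_def)
      have "Suc (l s) \<le> l j" if "s = Suc j"
        using rm lk that by (auto simp: interlaced_def \<kappa>_def \<rho>_def add_box_def del_box_def
          split: if_splits dest!: spec[of _ j])
      thus "\<rho> (Suc j) \<le> l j"
        using decseq_SucD[OF dl, of j] by (auto simp: \<rho>_def add_box_def)
    qed
    define z where "z = row_var l s"
    have kz: "row_var \<kappa> s = z" using eq by (simp add: z_def row_var_def \<kappa>_def del_box_def)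
    define a where "a = row_factor N s z"
    define b where "b = q / t * row_factor (N - 1) s z"
    define P1 where "P1 = (\<Prod>j<N. (1 - t * z / row_var \<kappa> j) / (1 - q * z / row_var \<kappa> j))"
    define P2 where "P2 = (\<Prod>j<N. (1 - z / row_var \<rho> j) / (1 - q * z / (t * row_var \<rho> j)))"
    have e1: "W m \<kappa> = W \<kappa> \<kappa> * a * P1"
      using W_add_box_left[OF kk zk s] by (simp only: m[symmetric] kz a_def P1_def)
    have e2: "W \<rho> \<kappa> = W l \<kappa> * a * P1"
      unfolding \<rho>_def a_def P1_def z_def by (rule W_add_box_left[OF lk zf(1) s])
    have e3: "W \<rho> m = W \<rho> \<kappa> * b * P2"
      using W_add_box_right[OF rk zr s] by (simp only: m[symmetric] kz b_def P2_def)
    have e4: "W \<rho> \<rho> = W \<rho> l * b * P2"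
      using W_add_box_right[OF rl zr s] by (simp only: \<rho>_def[symmetric] z_def b_def P2_def)
    have nz: "W \<rho> \<rho> \<noteq> 0" "W \<kappa> \<kappa> \<noteq> 0" using W_nz kk rr zk zr by auto
    hence nz': "W \<rho> l \<noteq> 0" "b \<noteq> 0" "P2 \<noteq> 0" using e4 by auto
    have "del_right l m s = W l \<kappa> * W m \<kappa> / W \<kappa> \<kappa>" using rem by (simp add: del_right_def \<kappa>_def)
    also have "\<dots> = W \<rho> l / W \<rho> \<rho> * W \<rho> m"
      unfolding e1 e3 e2 e4 using nz nz' by simp
    also have "\<dots> = add_left l m s" using dr by (simp add: add_left_def \<rho>_def)
    finally show ?thesis .
  qed
qed

section \<open>Summation over the moved box by residues\<close>

lemma Plus_minus: "(A <+> B) - {Inl r} = (A - {r}) <+> B" "(A <+> B) - {Inr r} = A <+> (B - {r})"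
  by auto

lemma row_var_inj: "row_var l i = row_var l j \<Longrightarrow> i = j"
  using row_var_eq_iff[of 0 l i 0 0 l j 0] by simp

text \<open>The poles are the inverse variables \<open>1 / x i\<close> and \<open>1 / y j\<close>,
  with corresponding zeros \<open>u / x i\<close> and \<open>v / y j\<close>; the disjoint sum of
  the index sets makes this one instance of the general identity. Multiplying by the variable
  removes the factor in front, so the second conclusion concerns the plain products.\<close>

lemma partial_fractions_two:
  fixes A B :: "nat set" and x y :: "nat \<Rightarrow> 'a" and u v :: 'a
  assumes fin: "finite A" "finite B"
    and nz: "\<And>i. i \<in> A \<Longrightarrow> x i \<noteq> 0" "\<And>j. j \<in> B \<Longrightarrow> y j \<noteq> 0"
    and inj: "inj_on x A" "inj_on y B" "\<And>i j. i \<in> A \<Longrightarrow> j \<in> B \<Longrightarrow> x i \<noteq> y j"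
  defines "d1 \<equiv> \<lambda>r. (1 / x r) * (1 - u) *
      (\<Prod>i\<in>A-{r}. (1 - u * x r / x i) / (1 - x r / x i)) * (\<Prod>j\<in>B. (1 - v * x r / y j) / (1 - x r / y j))"
    and "d2 \<equiv> \<lambda>s. (1 / y s) * (1 - v) *
      (\<Prod>j\<in>B-{s}. (1 - v * y s / y j) / (1 - y s / y j)) * (\<Prod>i\<in>A. (1 - u * y s / x i) / (1 - y s / x i))"
  shows "(\<Sum>r\<in>A. d1 r) + (\<Sum>s\<in>B. d2 s) = (1 - u) * (\<Sum>i\<in>A. 1 / x i) + (1 - v) * (\<Sum>j\<in>B. 1 / y j)"
    and "(\<Sum>r\<in>A. x r * d1 r) + (\<Sum>s\<in>B. y s * d2 s) = 1 - u ^ card A * v ^ card B"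
proof -
  define I where "I = A <+> B"
  define a where "a = case_sum (\<lambda>i. 1 / x i) (\<lambda>j. 1 / y j)"
  define b where "b = case_sum (\<lambda>i. u / x i) (\<lambda>j. v / y j)"
  define d where "d r = (\<Prod>i\<in>I. a r - b i) / (\<Prod>i\<in>I-{r}. a r - a i)" for r
  have finI: "finite I" using fin by (simp add: I_def)
  have injI: "inj_on a I"
  proof (rule inj_onI)
    fix r s assume "r \<in> I" "s \<in> I" "a r = a s"
    thus "r = s"
      using inj(3) inj(3)[symmetric]
      by (cases r; cases s) (auto simp: I_def a_def dest: inj_onD[OF inj(1)] inj_onD[OF inj(2)])
  qed
  have a0: "a i \<noteq> 0" if "i \<in> I" for i using that nz by (auto simp: I_def a_def)
  have ratio: "(1 / z - w / c) / (1 / z - 1 / c) = (1 - w * z / c) / (1 - z / c)"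
    if "z \<noteq> 0" for z w c :: 'a
  proof -
    have "1 - w * z / c = z * (1 / z - w / c)" "1 - z / c = z * (1 / z - 1 / c)"
      using that by (simp_all add: right_diff_distrib)
    thus ?thesis using that by simp
  qed
  have dI: "d (Inl r) = d1 r" if r: "r \<in> A" for r
  proof -
    have z: "x r \<noteq> 0" using nz r by simp
    have "d (Inl r) = ((1 / x r - u / x r) * (\<Prod>i\<in>A-{r}. 1 / x r - u / x i) * (\<Prod>j\<in>B. 1 / x r - v / y j)) /
        ((\<Prod>i\<in>A-{r}. 1 / x r - 1 / x i) * (\<Prod>j\<in>B. 1 / x r - 1 / y j))"
      unfolding d_def I_def Plus_minus using fin r
      by (simp add: prod.Plus a_def b_def prod.remove[of A r] mult.assoc)
    also have "\<dots> = (1 / x r - u / x r) * (\<Prod>i\<in>A-{r}. (1 / x r - u / x i) / (1 / x r - 1 / x i)) *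
        (\<Prod>j\<in>B. (1 / x r - v / y j) / (1 / x r - 1 / y j))"
      by (simp add: prod_dividef)
    also have "\<dots> = d1 r" unfolding ratio[OF z] d1_def by (simp add: diff_divide_distrib)
    finally show ?thesis .
  qed
  have dR: "d (Inr s) = d2 s" if s: "s \<in> B" for s
  proof -
    have z: "y s \<noteq> 0" using nz s by simp
    have "d (Inr s) = ((1 / y s - v / y s) * (\<Prod>i\<in>B-{s}. 1 / y s - v / y i) * (\<Prod>j\<in>A. 1 / y s - u / x j)) /
        ((\<Prod>i\<in>B-{s}. 1 / y s - 1 / y i) * (\<Prod>j\<in>A. 1 / y s - 1 / x j))"
      unfolding d_def I_def Plus_minus using fin s
      by (simp add: prod.Plus a_def b_def prod.remove[of B s] mult_ac)
    also have "\<dots> = (1 / y s - v / y s) * (\<Prod>i\<in>B-{s}. (1 / y s - v / y i) / (1 / y s - 1 / y i)) *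
        (\<Prod>j\<in>A. (1 / y s - u / x j) / (1 / y s - 1 / x j))"
      by (simp add: prod_dividef)
    also have "\<dots> = d2 s" unfolding ratio[OF z] d2_def by (simp add: diff_divide_distrib)
    finally show ?thesis .
  qed
  have sums: "(\<Sum>i\<in>I. f i) = (\<Sum>i\<in>A. f (Inl i)) + (\<Sum>j\<in>B. f (Inr j))" for f :: "nat + nat \<Rightarrow> 'a"
    unfolding I_def using fin by (simp add: sum.Plus)
  have prods: "(\<Prod>i\<in>I. f i) = (\<Prod>i\<in>A. f (Inl i)) * (\<Prod>j\<in>B. f (Inr j))" for f :: "nat + nat \<Rightarrow> 'a"
    unfolding I_def using fin by (simp add: prod.Plus)
  have "(\<Sum>r\<in>I. d r) = (\<Sum>i\<in>I. a i) - (\<Sum>i\<in>I. b i)"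
    unfolding d_def by (rule partial_fractions(1)[OF finI injI])
  thus "(\<Sum>r\<in>A. d1 r) + (\<Sum>s\<in>B. d2 s) = (1 - u) * (\<Sum>i\<in>A. 1 / x i) + (1 - v) * (\<Sum>j\<in>B. 1 / y j)"
    unfolding sums using dI dR
    by (simp add: a_def b_def diff_divide_distrib sum_distrib_left sum_subtractf)
  have nzp: "(\<Prod>i\<in>A. x i) \<noteq> 0" "(\<Prod>j\<in>B. y j) \<noteq> 0" using nz fin by auto
  have "(\<Sum>r\<in>I. d r / a r) = 1 - (\<Prod>i\<in>I. b i) / (\<Prod>i\<in>I. a i)"
    unfolding d_def by (rule partial_fractions(2)[OF finI injI a0])
  also have "(\<Prod>i\<in>I. b i) / (\<Prod>i\<in>I. a i) = u ^ card A * v ^ card B"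
    using nzp by (simp add: prods a_def b_def prod_dividef)
  finally show "(\<Sum>r\<in>A. x r * d1 r) + (\<Sum>s\<in>B. y s * d2 s) = 1 - u ^ card A * v ^ card B"
    unfolding sums using dI dR by (simp add: a_def mult.commute)
qed

text \<open>The terms on both sides are residues of one rational function, with one pole for each of
  the \<open>N\<close> variables of \<open>l\<close> and of the \<open>N\<close> variables of
  \<open>m\<close> scaled by \<open>q / t\<close>. The two families have ratios \<open>u\<close> and
  \<open>v\<close> with \<open>u * v = 1\<close>, so the unweighted total is
  \<open>1 - (u * v) ^ N = 0\<close>.\<close>

lemma del_left_sums:
  assumes dl: "decseq l" and dm: "decseq m" and zf: "zero_from N l" "zero_from N m"
  shows "(\<Sum>r<N. del_left l m r) = (\<Sum>s<N. add_right l m s)" (is ?A)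
    and "(\<Sum>r<N. del_left l m r / row_var l r) - t * (\<Sum>s<N. add_right l m s / (q * row_var m s)) =
      cc * ((\<Sum>j<N. 1 / row_var l j) - (\<Sum>j<N. 1 / row_var m j)) * W l m" (is ?B)
proof -
  have "?A \<and> ?B"
  proof (cases "interlaced l m")
    case False
    note off = del_left_not_interlaced[OF dl dm zf False]
    have last: "del_left l m N = 0" using zf by (simp add: del_left_def zero_from_def)
    \<comment> \<open>Without interlacing, row \<open>Suc s\<close> of \<open>l\<close> is paired
      with row \<open>s\<close> of \<open>m\<close>; rows 0 and \<open>N\<close> of \<open>l\<close>
      contribute nothing.\<close>
    have shift: "(\<Sum>r<N. F r * del_left l m r) = (\<Sum>s<N. F (Suc s) * add_right l m s)" for F
    proof -
      have "(\<Sum>r<N. F r * del_left l m r) = (\<Sum>r<Suc N. F r * del_left l m r)" by (simp add: last)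
      also have "\<dots> = (\<Sum>s<N. F (Suc s) * add_right l m s)"
        by (subst sum.lessThan_Suc_shift) (simp add: off(1,2))
      finally show ?thesis .
    qed
    have A: ?A using shift[of "\<lambda>_. 1"] by simp
    have "1 / row_var l (Suc s) * add_right l m s = t * (add_right l m s / (q * row_var m s))" for s
      using off(3)[of s] q_nz t_nz by (cases "add_right l m s = 0") auto
    hence "(\<Sum>r<N. 1 / row_var l r * del_left l m r) = t * (\<Sum>s<N. add_right l m s / (q * row_var m s))"
      unfolding shift by (simp add: sum_distrib_left)
    thus ?thesis using A False by (simp add: W_0)
  next
    case il: True
    have ml: "m i \<le> l i" "l (Suc i) \<le> m i" for i using il by (auto simp: interlaced_def)
    define x where "x = row_var l"
    define y where "y = row_var m"
    define y' where "y' j = q * y j / t" for j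
    define u where "u = t / q"
    define v where "v = q / t"
    have unz: "u \<noteq> 0" "v \<noteq> 0" "1 - u \<noteq> 0" "1 - v = - (1 - u) / u" "u * v = 1"
      using q_nz t_nz one_minus_qt_nz by (auto simp: u_def v_def field_simps)
    have xnz: "x i \<noteq> 0" "y i \<noteq> 0" "y' i \<noteq> 0" for i
      using row_var_nz q_nz t_nz by (auto simp: x_def y_def y'_def)
    have inj: "inj_on x A" "inj_on y' A" for A
      using row_var_inj q_nz t_nz by (auto simp: inj_on_def x_def y'_def y_def)
    \<comment> \<open>Poles of different families could meet only for
      \<open>l (Suc j) = Suc (m j)\<close>, which interlacing excludes.\<close>
    have xy: "x i \<noteq> y' j" for i j
    proof
      assume "x i = y' j"
      hence "q ^ 0 * row_var l i * t ^ 1 = q ^ 1 * row_var m j * t ^ 0"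
        using t_nz by (simp add: x_def y'_def y_def field_simps)
      hence "l i = Suc (m j) \<and> i = Suc j" by (subst (asm) row_var_eq_iff) auto
      thus False using ml(2)[of j] by auto
    qed
    define d1 where "d1 r = (1 / x r) * (1 - u) *
      (\<Prod>i\<in>{..<N}-{r}. (1 - u * x r / x i) / (1 - x r / x i)) * (\<Prod>j\<in>{..<N}. (1 - v * x r / y' j) / (1 - x r / y' j))" for r
    define d2 where "d2 s = (1 / y' s) * (1 - v) *
      (\<Prod>j\<in>{..<N}-{s}. (1 - v * y' s / y' j) / (1 - y' s / y' j)) * (\<Prod>i\<in>{..<N}. (1 - u * y' s / x i) / (1 - y' s / x i))" for s
    have pf: "(\<Sum>r<N. d1 r) + (\<Sum>s<N. d2 s) = (1 - u) * (\<Sum>i<N. 1 / x i) + (1 - v) * (\<Sum>j<N. 1 / y' j)"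
      "(\<Sum>r<N. x r * d1 r) + (\<Sum>s<N. y' s * d2 s) = 1 - u ^ N * v ^ N"
      using partial_fractions_two[of "{..<N}" "{..<N}" x y' u v] xnz inj xy
      unfolding d1_def d2_def by simp_all
    have e1: "del_left l m r * (1 - u) = W l m * cc * (x r * d1 r)" if "r < N" for r
    proof -
      have "v * x r / y' j = x r / y j" "x r / y' j = t * x r / (q * y j)" for j
        using q_nz t_nz by (auto simp: v_def y'_def)
      thus ?thesis unfolding del_left_eq[OF il zf(1) that] d1_def
        using xnz by (simp add: x_def[symmetric] y_def[symmetric] u_def)
    qed
    have e2: "add_right l m s * (1 - u) = - W l m * cc * (y' s * d2 s)" if "s < N" for s
    proof -
      have c: "v * y' s / y' j = q * y s / (t * y j)" "y' s / y' j = y s / y j"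
         "u * y' s / x j = y s / x j" "y' s / x j = q * y s / (t * x j)" for j
        using q_nz t_nz by (auto simp: u_def v_def y'_def)
      have "q / t * (1 - u) = - (1 - v)"
        using q_nz t_nz by (simp add: u_def v_def field_simps)
      hence k: "q / t * cc * (1 - u) = - cc * (1 - v)" by (metis mult.commute mult.left_commute mult_minus_left mult_minus_right)
      define R1 where "R1 = (\<Prod>j\<in>{..<N}-{s}. (1 - q * y s / (t * y j)) / (1 - y s / y j))"
      define R2 where "R2 = (\<Prod>i<N. (1 - y s / x i) / (1 - q * y s / (t * x i)))"
      have d: "y' s * d2 s = (1 - v) * R1 * R2"
        unfolding d2_def c R1_def R2_def using xnz by simp
      have "add_right l m s = W l m * (q / t * cc) * R1 * R2"
        unfolding add_right_eq[OF il zf(1) that] by (simp add: x_def y_def R1_def R2_def)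
      hence "add_right l m s * (1 - u) = W l m * (q / t * cc * (1 - u)) * R1 * R2" by (simp add: mult_ac)
      also have "\<dots> = - W l m * cc * (y' s * d2 s)"
        unfolding k d by (simp add: mult_ac)
      finally show ?thesis .
    qed
    have "((\<Sum>r<N. del_left l m r) - (\<Sum>s<N. add_right l m s)) * (1 - u) =
        (\<Sum>r<N. del_left l m r * (1 - u)) - (\<Sum>s<N. add_right l m s * (1 - u))"
      by (simp add: left_diff_distrib sum_distrib_right)
    also have "\<dots> = W l m * cc * ((\<Sum>r<N. x r * d1 r) + (\<Sum>s<N. y' s * d2 s))"
      using e1 e2 by (simp add: distrib_left sum_distrib_left sum_negf)
    also have "\<dots> = 0" unfolding pf(2) using unz(5) by (simp add: power_mult_distrib[symmetric])
    finally have A: ?A using unz(3) by simp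
    have "((\<Sum>r<N. del_left l m r / x r) - t * (\<Sum>s<N. add_right l m s / (q * y s))) * k =
        (\<Sum>r<N. del_left l m r * k / x r) - (\<Sum>s<N. add_right l m s * k / y' s)" for k
    proof -
      have "(\<Sum>r<N. del_left l m r / x r) * k = (\<Sum>r<N. del_left l m r * k / x r)"
        by (simp add: sum_distrib_right)
      moreover have "t * (\<Sum>s<N. add_right l m s / (q * y s)) * k = (\<Sum>s<N. add_right l m s * k / y' s)"
        by (simp add: sum_distrib_right sum_distrib_left y'_def mult_ac)
      ultimately show ?thesis by (simp only: left_diff_distrib)
    qed
    hence "((\<Sum>r<N. del_left l m r / x r) - t * (\<Sum>s<N. add_right l m s / (q * y s))) * (1 - u) =
        (\<Sum>r<N. del_left l m r * (1 - u) / x r) - (\<Sum>s<N. add_right l m s * (1 - u) / y' s)" .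
    also have "\<dots> = W l m * cc * ((\<Sum>r<N. d1 r) + (\<Sum>s<N. d2 s))"
      using e1 e2 xnz by (simp add: distrib_left sum_distrib_left sum_negf mult.assoc)
    also have "(\<Sum>r<N. d1 r) + (\<Sum>s<N. d2 s) = (1 - u) * ((\<Sum>i<N. 1 / x i) - (\<Sum>j<N. 1 / y j))"
    proof -
      have "(1 - v) * (1 / y' j) = - (1 - u) * (1 / y j)" for j
        using q_nz t_nz xnz(2)[of j] by (simp add: u_def v_def y'_def field_simps)
      hence "(1 - v) * (\<Sum>j<N. 1 / y' j) = - (1 - u) * (\<Sum>j<N. 1 / y j)"
        unfolding sum_distrib_left by (intro sum.cong refl) blast
      thus ?thesis unfolding pf(1) by (simp add: algebra_simps)
    qed
    finally have "((\<Sum>r<N. del_left l m r / x r) - t * (\<Sum>s<N. add_right l m s / (q * y s))) * (1 - u) =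
      (cc * ((\<Sum>i<N. 1 / x i) - (\<Sum>j<N. 1 / y j)) * W l m) * (1 - u)" by (simp only: mult_ac)
    hence ?B using unz(3) unfolding x_def y_def by (simp only: mult_cancel_right) simp
    thus ?thesis using A by blast
  qed
  thus ?A ?B by auto
qed

text \<open>Now \<open>m\<close> has \<open>N\<close> poles and \<open>l\<close> has
  \<open>N + 1\<close>, because a box can open a new row. The unweighted total is
  \<open>1 - u ^ N * v ^ Suc N = 1 - v\<close>; this surplus is the source of the term
  \<open>cc * W l m\<close>.\<close>

lemma del_right_sums:
  assumes dl: "decseq l" and dm: "decseq m" and zf: "zero_from N l" "zero_from N m"
  shows "(\<Sum>r<Suc N. add_left l m r) - (\<Sum>s<N. del_right l m s) = cc * W l m" (is ?A)
    and "(\<Sum>s<N. del_right l m s / row_var m s) - (\<Sum>r<Suc N. add_left l m r / (q * row_var l r)) =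
      cc / q * (t * (\<Sum>j<N. 1 / row_var m j) - (\<Sum>j<Suc N. 1 / row_var l j)) * W l m" (is ?B)
proof -
  have zf1: "zero_from (Suc N) l" "zero_from (Suc N) m" using zf by (auto simp: zero_from_def)
  have "?A \<and> ?B"
  proof (cases "interlaced l m")
    case False
    note off = del_right_not_interlaced[OF dl dm zf1 False]
    have last: "del_right l m N = 0" using zf by (simp add: del_right_def zero_from_def)
    have "(\<Sum>r<Suc N. add_left l m r) = (\<Sum>r<Suc N. del_right l m r)"
      using off(1) by (intro sum.cong) auto
    hence A: ?A using False by (simp add: last W_0)
    have "add_left l m s / (q * row_var l s) = del_right l m s / row_var m s" if "s < Suc N" for s
      using off[OF that] q_nz by (cases "del_right l m s = 0") auto
    hence "(\<Sum>r<Suc N. add_left l m r / (q * row_var l r)) = (\<Sum>r<Suc N. del_right l m r / row_var m r)"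
      by (intro sum.cong) auto
    thus ?thesis using A False by (simp add: last W_0)
  next
    case il: True
    have ml: "m i \<le> l i" "l (Suc i) \<le> m i" for i using il by (auto simp: interlaced_def)
    define x where "x = row_var l"
    define y where "y = row_var m"
    define x' where "x' j = q * x j" for j
    define u where "u = t / q"
    define v where "v = q / t"
    have unz: "u \<noteq> 0" "v \<noteq> 0" "1 - v \<noteq> 0" "u * v = 1"
      using q_nz t_nz one_minus_qt_nz by (auto simp: u_def v_def field_simps)
    have xnz: "x i \<noteq> 0" "y i \<noteq> 0" "x' i \<noteq> 0" for i
      using row_var_nz q_nz t_nz by (auto simp: x_def y_def x'_def)
    have inj: "inj_on y A" "inj_on x' A" for A
      using row_var_inj q_nz t_nz by (auto simp: inj_on_def x_def x'_def y_def)
    have xy: "y i \<noteq> x' j" for i j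
    proof
      assume "y i = x' j"
      hence "q ^ 0 * row_var m i * t ^ 0 = q ^ 1 * row_var l j * t ^ 0"
        by (simp add: x_def x'_def y_def)
      hence "m i = Suc (l j) \<and> j = i" by (subst (asm) row_var_eq_iff) auto
      thus False using ml(1)[of j] by auto
    qed
    define d1 where "d1 r = (1 / y r) * (1 - u) *
      (\<Prod>i\<in>{..<N}-{r}. (1 - u * y r / y i) / (1 - y r / y i)) * (\<Prod>j\<in>{..<Suc N}. (1 - v * y r / x' j) / (1 - y r / x' j))" for r
    define d2 where "d2 s = (1 / x' s) * (1 - v) *
      (\<Prod>j\<in>{..<Suc N}-{s}. (1 - v * x' s / x' j) / (1 - x' s / x' j)) * (\<Prod>i\<in>{..<N}. (1 - u * x' s / y i) / (1 - x' s / y i))" for s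
    have pf: "(\<Sum>r<N. d1 r) + (\<Sum>s<Suc N. d2 s) = (1 - u) * (\<Sum>i<N. 1 / y i) + (1 - v) * (\<Sum>j<Suc N. 1 / x' j)"
      "(\<Sum>r<N. y r * d1 r) + (\<Sum>s<Suc N. x' s * d2 s) = 1 - u ^ N * v ^ Suc N"
      using partial_fractions_two[of "{..<N}" "{..<Suc N}" y x' u v] xnz inj xy
      unfolding d1_def d2_def by (simp_all del: sum.lessThan_Suc prod.lessThan_Suc power_Suc)
    have e1: "del_right l m s * (1 - v) = - W l m * cc * (y s * d1 s)" if "s < N" for s
    proof -
      have c: "v * y s / x' j = y s / (t * x j)" "y s / x' j = y s / (q * x j)" for j
        using q_nz t_nz by (auto simp: v_def x'_def)
      have "t / q * (1 - v) = - (1 - u)"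
        using q_nz t_nz by (simp add: u_def v_def field_simps)
      hence k: "t / q * cc * (1 - v) = - cc * (1 - u)" by (metis mult.commute mult.left_commute mult_minus_left mult_minus_right)
      define R1 where "R1 = (\<Prod>j\<in>{..<N}-{s}. (1 - t * y s / (q * y j)) / (1 - y s / y j))"
      define R2 where "R2 = (\<Prod>i<Suc N. (1 - y s / (t * x i)) / (1 - y s / (q * x i)))"
      have d: "y s * d1 s = (1 - u) * R1 * R2"
        unfolding d1_def c R1_def R2_def using xnz by (simp add: u_def del: prod.lessThan_Suc)
      have "del_right l m s = W l m * (t / q * cc) * R1 * R2"
        unfolding del_right_eq[OF il zf(1) that] by (simp add: x_def y_def R1_def R2_def del: prod.lessThan_Suc)
      hence "del_right l m s * (1 - v) = W l m * (t / q * cc * (1 - v)) * R1 * R2" by (simp add: mult_ac)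
      also have "\<dots> = - W l m * cc * (y s * d1 s)"
        unfolding k d by (simp add: mult_ac)
      finally show ?thesis .
    qed
    have e2: "add_left l m r * (1 - v) = W l m * cc * (x' r * d2 r)" if "r < Suc N" for r
    proof -
      have c: "v * x' r / x' j = q * x r / (t * x j)" "x' r / x' j = x r / x j"
         "u * x' r / y j = t * x r / y j" "x' r / y j = q * x r / y j" for j
        using q_nz t_nz by (auto simp: u_def v_def x'_def)
      show ?thesis unfolding add_left_eq[OF il zf(1) that] d2_def c
        using xnz by (simp add: x_def[symmetric] y_def[symmetric] del: prod.lessThan_Suc)
    qed
    have "((\<Sum>r<Suc N. add_left l m r) - (\<Sum>s<N. del_right l m s)) * (1 - v) =
        (\<Sum>r<Suc N. add_left l m r * (1 - v)) - (\<Sum>s<N. del_right l m s * (1 - v))"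
      by (simp add: left_diff_distrib sum_distrib_right del: sum.lessThan_Suc)
    also have "\<dots> = W l m * cc * ((\<Sum>r<N. y r * d1 r) + (\<Sum>s<Suc N. x' s * d2 s))"
      using e1 e2 by (simp add: distrib_left sum_distrib_left sum_negf del: sum.lessThan_Suc)
    also have "(\<Sum>r<N. y r * d1 r) + (\<Sum>s<Suc N. x' s * d2 s) = 1 - v"
    proof -
      have "u ^ N * v ^ Suc N = (u * v) ^ N * v" by (simp add: power_mult_distrib)
      thus ?thesis unfolding pf(2) using unz(4) by simp
    qed
    finally have "((\<Sum>r<Suc N. add_left l m r) - (\<Sum>s<N. del_right l m s)) * (1 - v) = cc * W l m * (1 - v)"
      by (simp only: mult_ac)
    hence A: ?A using unz(3) by (simp only: mult_cancel_right) simp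
    have "((\<Sum>s<N. del_right l m s / y s) - (\<Sum>r<Suc N. add_left l m r / (q * x r))) * k =
        (\<Sum>s<N. del_right l m s * k / y s) - (\<Sum>r<Suc N. add_left l m r * k / x' r)" for k
      by (simp add: left_diff_distrib sum_distrib_right x'_def del: sum.lessThan_Suc)
    hence "((\<Sum>s<N. del_right l m s / y s) - (\<Sum>r<Suc N. add_left l m r / (q * x r))) * (1 - v) =
        (\<Sum>s<N. del_right l m s * (1 - v) / y s) - (\<Sum>r<Suc N. add_left l m r * (1 - v) / x' r)" .
    also have "\<dots> = - W l m * cc * ((\<Sum>r<N. d1 r) + (\<Sum>s<Suc N. d2 s))"
      using e1 e2 xnz by (simp add: distrib_left sum_distrib_left sum_negf mult.assoc del: sum.lessThan_Suc)
    also have "(\<Sum>r<N. d1 r) + (\<Sum>s<Suc N. d2 s) =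
        - (1 - v) * (1 / q) * (t * (\<Sum>i<N. 1 / y i) - (\<Sum>j<Suc N. 1 / x j))"
    proof -
      define k where "k = 1 - v"
      have a: "1 - u = - k * (1 / q) * t"
        using q_nz t_nz by (simp add: k_def u_def v_def field_simps)
      have b: "(\<Sum>j<Suc N. 1 / x' j) = (1 / q) * (\<Sum>j<Suc N. 1 / x j)"
        unfolding sum_distrib_left x'_def by simp
      show ?thesis unfolding pf(1) a b k_def[symmetric]
        by (simp add: right_diff_distrib mult_ac del: sum.lessThan_Suc)
    qed
    also have "- W l m * cc * (- (1 - v) * (1 / q) * Z) = cc / q * Z * W l m * (1 - v)" for Z
    proof -
      have "- a * c * (- k * (1 / q) * z) = c / q * z * a * k" for a c k z :: 'a by simp
      thus ?thesis by blast
    qed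
    finally have "((\<Sum>s<N. del_right l m s / y s) - (\<Sum>r<Suc N. add_left l m r / (q * x r))) * (1 - v) =
      cc / q * (t * (\<Sum>j<N. 1 / y j) - (\<Sum>j<Suc N. 1 / x j)) * W l m * (1 - v)" .
    hence ?B using unz(3) unfolding x_def y_def by (simp only: mult_cancel_right) simp
    thus ?thesis using A by blast
  qed
  thus ?A ?B by auto
qed

end

section \<open>Commutation relations\<close>

definition is_partition :: "(nat \<Rightarrow> nat) \<Rightarrow> bool" where
  "is_partition l \<longleftrightarrow> decseq l \<and> (\<exists>N. zero_from N l)"

definition part_size :: "(nat \<Rightarrow> nat) \<Rightarrow> nat" where
  "part_size l = (\<Sum>i | l i \<noteq> 0. l i)"

lemma part_size_eq: "zero_from N l \<Longrightarrow> part_size l = (\<Sum>i<N. l i)"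
  unfolding part_size_def
  by (intro sum.mono_neutral_left) (auto simp: zero_from_def not_less[symmetric])

lemma partitionE:
  assumes "is_partition l" "is_partition m"
  obtains N where "zero_from N l" "zero_from N m" "decseq l" "decseq m"
proof -
  from assms obtain N M where "zero_from N l" "zero_from M m" "decseq l" "decseq m"
    by (auto simp: is_partition_def)
  thus ?thesis using that[of "max N M"] by (auto simp: zero_from_def)
qed

lemma partition_interlaced: "interlaced l m \<Longrightarrow> is_partition l \<Longrightarrow> is_partition m"
  using interlaced_decseq zero_from_interlaced unfolding is_partition_def by blast

lemma part_size_interlaced:
  assumes "interlaced l m" "is_partition l"
  shows "part_size m \<le> part_size l"
proof -
  obtain N where "zero_from N l" using assms(2) by (auto simp: is_partition_def)
  moreover from this have "zero_from N m" by (rule zero_from_interlaced[OF assms(1)])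
  ultimately show ?thesis using assms(1) by (simp add: part_size_eq sum_mono interlaced_def)
qed

lemma zero_from_part_size:
  assumes "is_partition l" "part_size l \<le> n"
  shows "zero_from n l"
proof (rule ccontr)
  assume "\<not> zero_from n l"
  then obtain i where i: "n \<le> i" "l i > 0" by (auto simp: zero_from_def)
  obtain N where N: "zero_from N l" "decseq l" using partitionE[OF assms(1,1)] by metis
  have "i < N" using N i by (auto simp: zero_from_def not_less[symmetric])
  have "1 \<le> l j" if "j \<le> i" for j
    using decseqD[OF N(2) that] i by simp
  hence "(\<Sum>j\<le>i. 1) \<le> (\<Sum>j\<le>i. l j)" by (intro sum_mono) auto
  also have "\<dots> \<le> (\<Sum>j<N. l j)" using \<open>i < N\<close> by (intro sum_mono2) auto
  finally have "Suc i \<le> part_size l" using N by (simp add: part_size_eq)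
  thus False using assms i by simp
qed

lemma le_part_size:
  assumes "is_partition l"
  shows "l i \<le> part_size l"
proof -
  obtain N where N: "zero_from N l" using assms by (auto simp: is_partition_def)
  show ?thesis
  proof (cases "i < N")
    case True
    hence "l i \<le> (\<Sum>i<N. l i)" by (intro member_le_sum) auto
    thus ?thesis using N by (simp add: part_size_eq)
  qed (use N in \<open>simp add: zero_from_def\<close>)
qed

lemma finite_partitions: "finite {l. is_partition l \<and> part_size l \<le> n}"
proof (rule finite_subset)
  show "{l. is_partition l \<and> part_size l \<le> n} \<subseteq>
      {f. \<forall>x. (x \<in> {..<n} \<longrightarrow> f x \<in> {..n}) \<and> (x \<notin> {..<n} \<longrightarrow> f x = 0)}"
  proof
    fix l assume "l \<in> {l. is_partition l \<and> part_size l \<le> n}"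
    hence l: "is_partition l" "part_size l \<le> n" by auto
    have "l x \<le> n" for x using le_part_size[OF l(1), of x] l(2) by simp
    moreover have "l x = 0" if "\<not> x < n" for x
      using zero_from_part_size[OF l] that by (simp add: zero_from_def)
    ultimately show "l \<in> {f. \<forall>x. (x \<in> {..<n} \<longrightarrow> f x \<in> {..n}) \<and> (x \<notin> {..<n} \<longrightarrow> f x = 0)}"
      by auto
  qed
qed (rule finite_set_of_finite_funs; simp)

lemma part_size_add_box: "zero_from N l \<Longrightarrow> part_size (add_box l r) = Suc (part_size l)"
proof -
  assume "zero_from N l"
  hence z: "zero_from (max N (Suc r)) l" by (auto simp: zero_from_def)
  have "part_size (add_box l r) = (\<Sum>i<max N (Suc r). l i + (if i = r then 1 else 0))"
    using z zero_from_add_box[OF z, of r]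
    by (subst part_size_eq[of "max N (Suc r)"]) (auto simp: add_box_def intro!: sum.cong)
  thus ?thesis using z by (simp add: part_size_eq sum.distrib sum.delta)
qed

lemma partition_add_box: "is_partition l \<Longrightarrow> decseq (add_box l r) \<Longrightarrow> is_partition (add_box l r)"
  unfolding is_partition_def
proof (elim conjE exE, intro conjI, assumption)
  fix N assume "zero_from N l"
  hence "zero_from (max N (Suc r)) (add_box l r)" by (auto simp: zero_from_def add_box_def)
  thus "\<exists>N. zero_from N (add_box l r)" by blast
qed

lemma partition_del_box: "is_partition l \<Longrightarrow> l (Suc r) < l r \<Longrightarrow> is_partition (del_box l r)"
  using decseq_del_box zero_from_del_box unfolding is_partition_def by blast

lemma part_size_del_box: "is_partition l \<Longrightarrow> l (Suc r) < l r \<Longrightarrow> part_size l = Suc (part_size (del_box l r))"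
  using part_size_add_box[of _ "del_box l r" r] partition_del_box[of l r]
  by (auto simp: add_del_box is_partition_def)

lemma interlaced_Suc_size:
  assumes il: "interlaced l m" and pl: "is_partition l" and zf: "zero_from N l"
    and size: "part_size l = Suc (part_size m)"
  obtains r where "r < N" "l (Suc r) < l r" "m = del_box l r" "l = add_box m r"
proof -
  have zm: "zero_from N m" by (rule zero_from_interlaced[OF il zf])
  have ml: "m i \<le> l i" "l (Suc i) \<le> m i" for i using il by (auto simp: interlaced_def)
  have "(\<Sum>i<N. l i - m i) = 1"
    using size zf zm ml by (simp add: part_size_eq sum_subtractf_nat)
  from this[unfolded sum_eq_1_iff[OF finite_lessThan]]
  obtain r where r: "r < N" "l r - m r = 1" "\<And>i. i < N \<Longrightarrow> i \<noteq> r \<Longrightarrow> l i - m i = 0"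
    by auto
  have "m i = l i" if "i \<noteq> r" for i
    using r(3)[of i] ml(1)[of i] that zf zm by (cases "i < N") (auto simp: zero_from_def)
  moreover have "l r = Suc (m r)" using r(2) by simp
  ultimately have "l = add_box m r" by (auto simp: add_box_def)
  moreover from this have "m = del_box l r" by (simp add: del_add_box)
  moreover have "l (Suc r) < l r" using \<open>l r = Suc (m r)\<close> ml(2)[of r] by simp
  ultimately show ?thesis using that r(1) by blast
qed

text \<open>\<open>b\<close> is the end of the product that loses the box, either \<open>l\<close>
  or \<open>m\<close>. The sum over intermediate partitions becomes the sum over rows that the
  residue identities evaluate.\<close>

lemma times_del_box:
  assumes pl: "is_partition b" and zf: "zero_from N b"
    and supp: "\<And>\<rho>. entry A l \<rho> * entry B \<rho> m \<noteq> 0 \<Longrightarrow> interlaced b \<rho> \<and> part_size b = Suc (part_size \<rho>)"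
  shows "entry (A * B) l m =
    (\<Sum>r<N. if b (Suc r) < b r then entry A l (del_box b r) * entry B (del_box b r) m else 0)"
proof -
  define R where "R = {r \<in> {..<N}. b (Suc r) < b r}"
  have "inj_on (del_box b) R"
  proof
    fix r s assume rs: "r \<in> R" "s \<in> R" "del_box b r = del_box b s"
    show "r = s" using fun_cong[OF rs(3), of r] rs(1,2)
      by (auto simp: R_def del_box_def split: if_splits)
  qed
  moreover have "entry (A * B) l m = (\<Sum>\<rho>\<in>del_box b ` R. entry A l \<rho> * entry B \<rho> m)"
  proof (rule entry_times)
    fix \<rho> assume \<rho>: "\<rho> \<notin> del_box b ` R"
    show "entry A l \<rho> * entry B \<rho> m = 0"
    proof (rule ccontr)
      assume "entry A l \<rho> * entry B \<rho> m \<noteq> 0"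
      from supp[OF this] show False
        using interlaced_Suc_size[OF _ pl zf] \<rho> by (metis (no_types, lifting) R_def image_eqI lessThan_iff mem_Collect_eq)
    qed
  qed (simp add: R_def)
  ultimately show ?thesis by (simp add: sum.reindex R_def sum.inter_filter[symmetric])
qed

text \<open>The range has \<open>Suc N\<close> rows because the new box may open row
  \<open>N\<close>; a box further down would leave a gap.\<close>

lemma times_add_box:
  assumes pl: "is_partition b" and zf: "zero_from N b"
    and supp: "\<And>\<rho>. entry A l \<rho> * entry B \<rho> m \<noteq> 0 \<Longrightarrow>
      is_partition \<rho> \<and> interlaced \<rho> b \<and> part_size \<rho> = Suc (part_size b)"
  shows "entry (A * B) l m =
    (\<Sum>r<Suc N. if decseq (add_box b r) then entry A l (add_box b r) * entry B (add_box b r) m else 0)"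
proof -
  define R where "R = {r \<in> {..<Suc N}. decseq (add_box b r)}"
  have "inj_on (add_box b) R"
  proof
    fix r s assume rs: "add_box b r = add_box b s"
    show "r = s" using fun_cong[OF rs, of r]
      by (auto simp: add_box_def split: if_splits)
  qed
  moreover have "entry (A * B) l m = (\<Sum>\<rho>\<in>add_box b ` R. entry A l \<rho> * entry B \<rho> m)"
  proof (rule entry_times)
    fix \<rho> assume \<rho>: "\<rho> \<notin> add_box b ` R"
    show "entry A l \<rho> * entry B \<rho> m = 0"
    proof (rule ccontr)
      assume "entry A l \<rho> * entry B \<rho> m \<noteq> 0"
      from supp[OF this] have s: "is_partition \<rho>" "interlaced \<rho> b" "part_size \<rho> = Suc (part_size b)" by auto
      then obtain M where M: "zero_from M \<rho>" by (auto simp: is_partition_def)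
      from interlaced_Suc_size[OF s(2,1) M s(3)] obtain r where r: "\<rho> = add_box b r" by metis
      have "decseq \<rho>" using s by (simp add: is_partition_def)
      moreover have "r < Suc N"
      proof (rule ccontr)
        assume "\<not> r < Suc N"
        hence "\<rho> r \<le> \<rho> N" "\<rho> N = b N"
          using decseqD[OF \<open>decseq \<rho>\<close>, of N r] by (auto simp: r add_box_def)
        thus False using zf by (simp add: r add_box_def zero_from_def)
      qed
      ultimately show False using \<rho> r by (auto simp: R_def)
    qed
  qed (simp add: R_def)
  ultimately show ?thesis by (simp add: sum.reindex R_def sum.inter_filter[symmetric] del: sum.lessThan_Suc)
qed

section \<open>The operators and their matrix entries\<close>

context generic_qt
begin

text \<open>The degree is an integer so that shifted degrees may become negative, where the operator
  is 0 and no case distinction arises. Dividing by the diagonal weight of the source gives a product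
  one factor \<open>1 / W l l\<close> for each intermediate \<open>l\<close>.\<close>

definition Down :: "int \<Rightarrow> (nat \<Rightarrow> nat, 'a) kern" where
  "Down i = Kern (\<lambda>l m. if is_partition l \<and> int (part_size l) = int (part_size m) + i then W l m / W l l else 0)"

definition Up :: "int \<Rightarrow> (nat \<Rightarrow> nat, 'a) kern" where
  "Up i = Kern (\<lambda>k m. if is_partition m \<and> int (part_size m) = int (part_size k) + i then W m k / W k k else 0)"

text \<open>The sum of \<open>1 / row_var l j\<close> over all rows, in which the geometric series
  of the \<open>t ^ j\<close> has been replaced by \<open>1 / (1 - t)\<close>, so that a finite sum
  remains.\<close>

definition ev :: "(nat \<Rightarrow> nat) \<Rightarrow> 'a" where
  "ev l = (\<Sum>j | l j \<noteq> 0. (1 / q ^ l j - 1) * t ^ j) + 1 / (1 - t)"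

definition Ev :: "(nat \<Rightarrow> nat, 'a) kern" where
  "Ev = Kern (\<lambda>l m. if l = m \<and> is_partition l then ev l else 0)"

lemma W_nonzeroD: "W l m \<noteq> 0 \<Longrightarrow> interlaced l m"
  using W_0 by blast

lemma entry_Down: "entry (Down i) l m =
    (if is_partition l \<and> int (part_size l) = int (part_size m) + i then W l m / W l l else 0)"
  unfolding Down_def
proof (rule entry_Kern)
  fix l
  show "finite {m. (if is_partition l \<and> int (part_size l) = int (part_size m) + i then W l m / W l l else 0) \<noteq> 0}"
    by (rule finite_subset[OF _ finite_partitions[of "part_size l"]])
      (auto dest!: W_nonzeroD intro: partition_interlaced part_size_interlaced)
qed

lemma entry_Up: "entry (Up i) k m =
    (if is_partition m \<and> int (part_size m) = int (part_size k) + i then W m k / W k k else 0)"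
  unfolding Up_def
proof (rule entry_Kern)
  fix k
  show "finite {m. (if is_partition m \<and> int (part_size m) = int (part_size k) + i then W m k / W k k else 0) \<noteq> 0}"
    by (rule finite_subset[OF _ finite_partitions[of "nat (int (part_size k) + i)"]]) auto
qed

lemma entry_Ev: "entry Ev l m = (if l = m \<and> is_partition l then ev l else 0)"
  unfolding Ev_def
  by (rule entry_Kern, rule finite_subset[of _ "{l}" for l]) (auto split: if_splits)

lemma Down_nonzeroD:
  "entry (Down i) l m \<noteq> 0 \<Longrightarrow>
    is_partition l \<and> is_partition m \<and> interlaced l m \<and> int (part_size l) = int (part_size m) + i"
  by (auto simp: entry_Down split: if_splits dest!: W_nonzeroD intro: partition_interlaced)

lemma Up_nonzeroD:
  "entry (Up i) k m \<noteq> 0 \<Longrightarrow>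
    is_partition k \<and> is_partition m \<and> interlaced m k \<and> int (part_size m) = int (part_size k) + i"
  by (auto simp: entry_Up split: if_splits dest!: W_nonzeroD intro: partition_interlaced)

lemma ev_eq: "zero_from N l \<Longrightarrow> ev l = (\<Sum>j<N. 1 / row_var l j) + t ^ N / (1 - t)"
proof -
  assume zf: "zero_from N l"
  have "(\<Sum>j | l j \<noteq> 0. (1 / q ^ l j - 1) * t ^ j) = (\<Sum>j<N. (1 / q ^ l j - 1) * t ^ j)"
    using zf by (intro sum.mono_neutral_left) (auto simp: zero_from_def not_less[symmetric])
  also have "\<dots> = (\<Sum>j<N. 1 / row_var l j) - (\<Sum>j<N. t ^ j)"
    by (simp add: left_diff_distrib sum_subtractf row_var_def)
  also have "(\<Sum>j<N. t ^ j) = (1 - t ^ N) / (1 - t)"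
    using one_minus_qt_nz by (subst sum_gp_strict) auto
  finally show ?thesis by (simp add: ev_def diff_divide_distrib)
qed

lemma ev_add_box:
  assumes "zero_from N l"
  shows "ev (add_box l r) - ev l = (1 - q) / (q * row_var l r)"
proof -
  define M where "M = max N (Suc r)"
  have z: "zero_from M l" "r < M" using assms by (auto simp: zero_from_def M_def)
  have "(\<Sum>j<M. 1 / row_var (add_box l r) j) =
      1 / (q * row_var l r) + (\<Sum>j\<in>{..<M}-{r}. 1 / row_var l j)"
    using z by (subst sum.remove[of _ r]) (auto simp: row_var_add_box)
  moreover have "(\<Sum>j<M. 1 / row_var l j) = 1 / row_var l r + (\<Sum>j\<in>{..<M}-{r}. 1 / row_var l j)"
    using z by (subst sum.remove[of _ r]) auto
  ultimately show ?thesis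
    using ev_eq[OF z(1)] ev_eq[OF zero_from_add_box[OF z]] row_var_nz[of l r] q_nz
    by (simp add: field_simps)
qed

text \<open>As commutators, \<open>Low\<close> and \<open>Raise\<close> are transposes of each other
  without computation. Entrywise they move one box, weighted by the inverse variable of its row with
  the box included.\<close>

definition Low :: "(nat \<Rightarrow> nat, 'a) kern" where
  "Low = kscale (1 / (1 - q)) (Ev * Down 1 - Down 1 * Ev)"

definition Raise :: "(nat \<Rightarrow> nat, 'a) kern" where
  "Raise = kscale (1 / (1 - q)) (Up 1 * Ev - Ev * Up 1)"

lemma entry_Ev_times: "entry (Ev * A) l m = (if is_partition l then ev l * entry A l m else 0)"
    "entry (A * Ev) l m = (if is_partition m then entry A l m * ev m else 0)"
  by (subst entry_diag_times; simp add: entry_Ev)+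

lemma entry_Low: "entry Low l m = (ev l - ev m) / (1 - q) * entry (Down 1) l m"
proof (cases "entry (Down 1) l m = 0")
  case False
  thus ?thesis
    using Down_nonzeroD[OF False] by (simp add: Low_def entry_kscale entry_diff entry_Ev_times left_diff_distrib
        right_diff_distrib diff_divide_distrib mult_ac)
qed (simp add: Low_def entry_kscale entry_diff entry_Ev_times)

lemma entry_Raise: "entry Raise k m = (ev m - ev k) / (1 - q) * entry (Up 1) k m"
proof (cases "entry (Up 1) k m = 0")
  case False
  thus ?thesis
    using Up_nonzeroD[OF False] by (simp add: Raise_def entry_kscale entry_diff entry_Ev_times left_diff_distrib
        right_diff_distrib diff_divide_distrib mult_ac)
qed (simp add: Raise_def entry_kscale entry_diff entry_Ev_times)

lemma ev_diff_del:
  assumes "is_partition l" "l (Suc r) < l r"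
  shows "(ev l - ev (del_box l r)) / (1 - q) = 1 / row_var l r"
proof -
  obtain N where "zero_from N l" using assms by (auto simp: is_partition_def)
  hence "zero_from N (del_box l r)" by (rule zero_from_del_box)
  from ev_add_box[OF this, of r] show ?thesis
    using assms one_minus_qt_nz q_nz by (simp add: add_del_box row_var_del_box)
qed

lemma ev_diff_add:
  assumes "is_partition l"
  shows "(ev (add_box l r) - ev l) / (1 - q) = 1 / (q * row_var l r)"
  using assms ev_add_box[of _ l r] one_minus_qt_nz by (auto simp: is_partition_def)

lemma entry_Down_Down:
  assumes pl: "is_partition l" and pm: "is_partition m"
    and N: "zero_from N l" "zero_from N m" "decseq l" "decseq m"
    and size: "int (part_size l) = int (part_size m) + i + 1"
  shows "entry (Down 1 * Down i) l m = (\<Sum>r<N. del_left l m r) / W l l"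
    and "entry (Down i * Down 1) l m = (\<Sum>s<N. add_right l m s) / W l l"
    and "entry (Low * Down i) l m = (\<Sum>r<N. del_left l m r / row_var l r) / W l l"
    and "entry (Down i * Low) l m = (\<Sum>s<N. add_right l m s / (q * row_var m s)) / W l l"
proof -
  have supp1: "interlaced l \<rho> \<and> part_size l = Suc (part_size \<rho>)" if "entry (Down 1) l \<rho> \<noteq> 0" for \<rho>
    using Down_nonzeroD[OF that] by auto
  have supp2: "is_partition \<rho> \<and> interlaced \<rho> m \<and> part_size \<rho> = Suc (part_size m)"
    if "entry (Down 1) \<rho> m \<noteq> 0" for \<rho>
    using Down_nonzeroD[OF that] by auto
  have e1: "(if l (Suc r) < l r then entry (Down 1) l (del_box l r) * entry (Down i) (del_box l r) m else 0)
      = del_left l m r / W l l" for r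
    using pl size part_size_del_box[of l r] partition_del_box[of l r]
    by (auto simp: del_left_def entry_Down)
  show "entry (Down 1 * Down i) l m = (\<Sum>r<N. del_left l m r) / W l l"
    by (subst times_del_box[OF pl N(1)]) (use supp1 in \<open>auto simp: e1 sum_divide_distrib\<close>)
  have e3: "(if l (Suc r) < l r then entry Low l (del_box l r) * entry (Down i) (del_box l r) m else 0)
      = del_left l m r / row_var l r / W l l" for r
    using e1[of r] pl ev_diff_del[of l r]
    by (auto simp: entry_Low del_left_def split: if_splits)
  show "entry (Low * Down i) l m = (\<Sum>r<N. del_left l m r / row_var l r) / W l l"
    by (subst times_del_box[OF pl N(1)]) (use supp1 in \<open>auto simp: e3 entry_Low sum_divide_distrib\<close>)
  \<comment> \<open>The formula for products runs over \<open>Suc N\<close> rows, but a box in row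
    \<open>N\<close> of \<open>m\<close> does not fit into \<open>l\<close>, which is empty
    there.\<close>
  have last: "add_right l m N = 0"
    using N by (auto simp: add_right_def W_def interlaced_def zero_from_def add_box_def dest!: spec[of _ N])
  have e2: "(if decseq (add_box m s) then entry (Down i) l (add_box m s) * entry (Down 1) (add_box m s) m else 0)
      = add_right l m s / W l l" for s
    using pl pm size part_size_add_box[OF N(2)] partition_add_box[of m s]
    by (auto simp: add_right_def entry_Down)
  show "entry (Down i * Down 1) l m = (\<Sum>s<N. add_right l m s) / W l l"
    by (subst times_add_box[OF pm N(2)]) (use supp2 in \<open>auto simp: e2 sum_divide_distrib last\<close>)
  have e4: "(if decseq (add_box m s) then entry (Down i) l (add_box m s) * entry Low (add_box m s) m else 0)
      = add_right l m s / (q * row_var m s) / W l l" for s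
    using e2[of s] pm ev_diff_add[of m s]
    by (auto simp: entry_Low add_right_def split: if_splits)
  show "entry (Down i * Low) l m = (\<Sum>s<N. add_right l m s / (q * row_var m s)) / W l l"
    by (subst times_add_box[OF pm N(2)]) (use supp2 in \<open>auto simp: e4 entry_Low sum_divide_distrib last\<close>)
qed

lemma entry_Up_Down:
  assumes pl: "is_partition l" and pm: "is_partition m"
    and N: "zero_from N l" "zero_from N m" "decseq l" "decseq m"
    and size: "int (part_size l) = int (part_size m) + i - 1"
  shows "entry (Up 1 * Down i) l m = (\<Sum>r<Suc N. add_left l m r) / W l l"
    and "entry (Down i * Up 1) l m = (\<Sum>s<N. del_right l m s) / W l l"
    and "entry (Raise * Down i) l m = (\<Sum>r<Suc N. add_left l m r / (q * row_var l r)) / W l l"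
    and "entry (Down i * Raise) l m = (\<Sum>s<N. del_right l m s / row_var m s) / W l l"
proof -
  have supp1: "is_partition \<rho> \<and> interlaced \<rho> l \<and> part_size \<rho> = Suc (part_size l)" if "entry (Up 1) l \<rho> \<noteq> 0" for \<rho>
    using Up_nonzeroD[OF that] by auto
  have supp2: "interlaced m \<rho> \<and> part_size m = Suc (part_size \<rho>)"
    if "entry (Up 1) \<rho> m \<noteq> 0" for \<rho>
    using Up_nonzeroD[OF that] by auto
  have e1: "(if decseq (add_box l r) then entry (Up 1) l (add_box l r) * entry (Down i) (add_box l r) m else 0)
      = add_left l m r / W l l" for r
    using pl size part_size_add_box[OF N(1), of r] partition_add_box[of l r]
    by (auto simp: add_left_def entry_Down entry_Up)
  show "entry (Up 1 * Down i) l m = (\<Sum>r<Suc N. add_left l m r) / W l l"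
    by (subst times_add_box[OF pl N(1)])
      (use supp1 in \<open>auto simp: e1 sum_divide_distrib simp del: sum.lessThan_Suc\<close>)
  have e3: "(if decseq (add_box l r) then entry Raise l (add_box l r) * entry (Down i) (add_box l r) m else 0)
      = add_left l m r / (q * row_var l r) / W l l" for r
    using e1[of r] pl ev_diff_add[of l r]
    by (auto simp: entry_Raise add_left_def split: if_splits)
  show "entry (Raise * Down i) l m = (\<Sum>r<Suc N. add_left l m r / (q * row_var l r)) / W l l"
    by (subst times_add_box[OF pl N(1)])
      (use supp1 in \<open>auto simp: e3 entry_Raise sum_divide_distrib simp del: sum.lessThan_Suc\<close>)
  have e2: "(if m (Suc s) < m s then entry (Down i) l (del_box m s) * entry (Up 1) (del_box m s) m else 0)
      = del_right l m s / W l l" for s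
    using pl pm size part_size_del_box[of m s] partition_del_box[of m s]
    by (auto simp: del_right_def entry_Down entry_Up)
  show "entry (Down i * Up 1) l m = (\<Sum>s<N. del_right l m s) / W l l"
    by (subst times_del_box[OF pm N(2)]) (use supp2 in \<open>auto simp: e2 sum_divide_distrib\<close>)
  have e4: "(if m (Suc s) < m s then entry (Down i) l (del_box m s) * entry Raise (del_box m s) m else 0)
      = del_right l m s / row_var m s / W l l" for s
    using e2[of s] pm ev_diff_del[of m s]
    by (auto simp: entry_Raise del_right_def split: if_splits)
  show "entry (Down i * Raise) l m = (\<Sum>s<N. del_right l m s / row_var m s) / W l l"
    by (subst times_del_box[OF pm N(2)]) (use supp2 in \<open>auto simp: e4 entry_Raise sum_divide_distrib\<close>)
qed

text \<open>Homogeneity of degree exactly \<open>d\<close>, with support on partitions. It reduces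
  an operator identity to entries of the right size, which are those that the residue sums
  evaluate.\<close>

definition bounded_deg :: "int \<Rightarrow> (nat \<Rightarrow> nat, 'a) kern \<Rightarrow> bool" where
  "bounded_deg d A \<longleftrightarrow> (\<forall>l m. entry A l m \<noteq> 0 \<longrightarrow>
     is_partition l \<and> is_partition m \<and> int (part_size m) = int (part_size l) + d)"

lemma bounded_deg_times:
  assumes "bounded_deg d A" "bounded_deg e B"
  shows "bounded_deg (d + e) (A * B)"
  unfolding bounded_deg_def
proof (intro allI impI)
  fix l m assume nz: "entry (A * B) l m \<noteq> 0"
  have "entry (A * B) l m = (\<Sum>k\<in>{k. entry A l k \<noteq> 0}. entry A l k * entry B k m)"
    by (rule entry_times) (auto simp: finite_entry)
  with nz obtain k where "entry A l k \<noteq> 0" "entry B k m \<noteq> 0"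
    by (metis (no_types, lifting) mult_eq_0_iff sum.not_neutral_contains_not_neutral)
  thus "is_partition l \<and> is_partition m \<and> int (part_size m) = int (part_size l) + (d + e)"
    using assms unfolding bounded_deg_def by force
qed

lemma bounded_deg_intros:
  "bounded_deg (- i) (Down i)" "bounded_deg i (Up i)" "bounded_deg 0 Ev"
  "bounded_deg (- 1) Low" "bounded_deg 1 Raise"
  "bounded_deg d A \<Longrightarrow> bounded_deg d B \<Longrightarrow> bounded_deg d (A + B)"
  "bounded_deg d A \<Longrightarrow> bounded_deg d B \<Longrightarrow> bounded_deg d (A - B)"
  "bounded_deg d A \<Longrightarrow> bounded_deg d (kscale c A)"
  unfolding bounded_deg_def
  by (auto dest!: Down_nonzeroD Up_nonzeroD
      simp: entry_Ev entry_Low entry_Raise entry_add entry_diff entry_kscale split: if_splits)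
    (metis add.right_neutral diff_0_right)+

lemma bounded_deg_eqI:
  assumes "bounded_deg d A" "bounded_deg d B"
    "\<And>l m. is_partition l \<Longrightarrow> is_partition m \<Longrightarrow> int (part_size m) = int (part_size l) + d \<Longrightarrow> entry A l m = entry B l m"
  shows "A = B"
  using assms unfolding bounded_deg_def by (intro kern_eqI) metis

section \<open>Commutation relations for \<open>Down\<close>\<close>

lemma Down_Down_1: "Down 1 * Down i = Down i * Down 1"
proof (rule bounded_deg_eqI)
  show "bounded_deg (- 1 - i) (Down 1 * Down i)" "bounded_deg (- 1 - i) (Down i * Down 1)"
    using bounded_deg_times[OF bounded_deg_intros(1)[of 1] bounded_deg_intros(1)[of i]]
      bounded_deg_times[OF bounded_deg_intros(1)[of i] bounded_deg_intros(1)[of 1]]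
    by (simp_all only: diff_conv_add_uminus add.commute)
  fix l m assume p: "is_partition l" "is_partition m" "int (part_size m) = int (part_size l) + (- 1 - i)"
  then obtain N where N: "zero_from N l" "zero_from N m" "decseq l" "decseq m" using partitionE by blast
  show "entry (Down 1 * Down i) l m = entry (Down i * Down 1) l m"
    using p(3) by (simp add: entry_Down_Down[OF p(1,2) N] del_left_sums(1)[OF N(3,4,1,2)])
qed

lemma Low_Down: "Low * Down i - kscale t (Down i * Low) =
    kscale cc (Ev * Down (i + 1) - Down (i + 1) * Ev)"
proof (rule bounded_deg_eqI)
  show "bounded_deg (- 1 - i) (Low * Down i - kscale t (Down i * Low))"
    using bounded_deg_times[OF bounded_deg_intros(4) bounded_deg_intros(1)[of i]]
      bounded_deg_times[OF bounded_deg_intros(1)[of i] bounded_deg_intros(4)]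
    by (intro bounded_deg_intros) (simp_all only: diff_conv_add_uminus add.commute)
  show "bounded_deg (- 1 - i) (kscale cc (Ev * Down (i + 1) - Down (i + 1) * Ev))"
    using bounded_deg_times[OF bounded_deg_intros(3) bounded_deg_intros(1)[of "i + 1"]]
      bounded_deg_times[OF bounded_deg_intros(1)[of "i + 1"] bounded_deg_intros(3)]
    by (intro bounded_deg_intros) (simp_all add: algebra_simps)
  fix l m assume p: "is_partition l" "is_partition m" "int (part_size m) = int (part_size l) + (- 1 - i)"
  then obtain N where N: "zero_from N l" "zero_from N m" "decseq l" "decseq m" using partitionE by blast
  have s: "int (part_size l) = int (part_size m) + i + 1" using p by simp
  have "entry (Low * Down i - kscale t (Down i * Low)) l m =
      ((\<Sum>r<N. del_left l m r / row_var l r) - t * (\<Sum>s<N. add_right l m s / (q * row_var m s))) / W l l"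
    by (simp add: entry_diff entry_kscale entry_Down_Down[OF p(1,2) N s] diff_divide_distrib)
  also have "\<dots> = cc * (ev l - ev m) * W l m / W l l"
    unfolding del_left_sums(2)[OF N(3,4,1,2)] by (simp add: ev_eq[OF N(1)] ev_eq[OF N(2)])
  also have "\<dots> = entry (kscale cc (Ev * Down (i + 1) - Down (i + 1) * Ev)) l m"
    using p s by (simp add: entry_kscale entry_diff entry_Ev_times entry_Down field_simps)
      (simp add: diff_divide_distrib)
  finally show "entry (Low * Down i - kscale t (Down i * Low)) l m =
      entry (kscale cc (Ev * Down (i + 1) - Down (i + 1) * Ev)) l m" .
qed

lemma Up_Down: "Up 1 * Down (i + 1) - Down (i + 1) * Up 1 = kscale cc (Down i)"
proof (rule bounded_deg_eqI)
  show "bounded_deg (- i) (Up 1 * Down (i + 1) - Down (i + 1) * Up 1)"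
    using bounded_deg_times[OF bounded_deg_intros(2)[of 1] bounded_deg_intros(1)[of "i + 1"]]
      bounded_deg_times[OF bounded_deg_intros(1)[of "i + 1"] bounded_deg_intros(2)[of 1]]
    by (intro bounded_deg_intros) (simp_all add: algebra_simps)
  show "bounded_deg (- i) (kscale cc (Down i))" by (intro bounded_deg_intros)
  fix l m assume p: "is_partition l" "is_partition m" "int (part_size m) = int (part_size l) + - i"
  then obtain N where N: "zero_from N l" "zero_from N m" "decseq l" "decseq m" using partitionE by blast
  have s: "int (part_size l) = int (part_size m) + (i + 1) - 1" using p by simp
  show "entry (Up 1 * Down (i + 1) - Down (i + 1) * Up 1) l m = entry (kscale cc (Down i)) l m"
    using p del_right_sums(1)[OF N(3,4,1,2)]
    by (simp add: entry_diff entry_kscale entry_Up_Down[OF p(1,2) N s] entry_Down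
        diff_divide_distrib[symmetric] del: sum.lessThan_Suc)
qed

lemma Down_Raise: "Down (i + 1) * Raise - Raise * Down (i + 1) =
    kscale (cc / q) (kscale t (Down i * Ev) - Ev * Down i)"
proof (rule bounded_deg_eqI)
  show "bounded_deg (- i) (Down (i + 1) * Raise - Raise * Down (i + 1))"
    using bounded_deg_times[OF bounded_deg_intros(5) bounded_deg_intros(1)[of "i + 1"]]
      bounded_deg_times[OF bounded_deg_intros(1)[of "i + 1"] bounded_deg_intros(5)]
    by (intro bounded_deg_intros) (simp_all add: algebra_simps)
  show "bounded_deg (- i) (kscale (cc / q) (kscale t (Down i * Ev) - Ev * Down i))"
    using bounded_deg_times[OF bounded_deg_intros(3) bounded_deg_intros(1)[of i]]
      bounded_deg_times[OF bounded_deg_intros(1)[of i] bounded_deg_intros(3)]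
    by (intro bounded_deg_intros) simp_all
  fix l m assume p: "is_partition l" "is_partition m" "int (part_size m) = int (part_size l) + - i"
  then obtain N where N: "zero_from N l" "zero_from N m" "decseq l" "decseq m" using partitionE by blast
  have s: "int (part_size l) = int (part_size m) + (i + 1) - 1" using p by simp
  have N1: "zero_from (Suc N) l" using N(1) by (simp add: zero_from_def)
  \<comment> \<open>The row bounds differ by one, and the factor \<open>t\<close> of
    \<open>ev m\<close> makes up for it: both geometric tails are
    \<open>t ^ Suc N / (1 - t)\<close>.\<close>
  have "t * (\<Sum>j<N. 1 / row_var m j) - (\<Sum>j<Suc N. 1 / row_var l j) = t * ev m - ev l"
    using ev_eq[OF N1] ev_eq[OF N(2)] by (simp add: algebra_simps del: sum.lessThan_Suc)
  hence "entry (Down (i + 1) * Raise - Raise * Down (i + 1)) l m =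
      cc / q * (t * ev m - ev l) * W l m / W l l"
    using del_right_sums(2)[OF N(3,4,1,2)]
    by (simp add: entry_diff entry_Up_Down[OF p(1,2) N s] diff_divide_distrib[symmetric] del: sum.lessThan_Suc)
  thus "entry (Down (i + 1) * Raise - Raise * Down (i + 1)) l m =
      entry (kscale (cc / q) (kscale t (Down i * Ev) - Ev * Down i)) l m"
    using p by (simp add: entry_kscale entry_diff entry_Ev_times entry_Down)
      (simp add: algebra_simps diff_divide_distrib)
qed

end

section \<open>The skew Cauchy identity\<close>

lemma exchange_defect_linear:
  "exchange_defect c t u E L R (A - A') (B - B') (C - C') (D - D') =
    exchange_defect c t u E L R A B C D - exchange_defect c t u E L R A' B' C' D'"
  "exchange_defect c t u E L R (A + A') (B + B') (C + C') (D + D') =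
    exchange_defect c t u E L R A B C D + exchange_defect c t u E L R A' B' C' D'"
  "exchange_defect c t u E L R (kscale x A) (kscale x B) (kscale x C) (kscale x D) =
    kscale x (exchange_defect c t u E L R A B C D)"
  "exchange_defect c t u E L R 0 0 0 0 = 0"
proof -
  have z: "kscale c 0 = (0 :: ('a, 'b) kern)" for c
    by (rule kern_eqI) (simp add: entry_kscale entry_0)
  note alg = kscale_algebra kscale_times algebra_simps
  show "exchange_defect c t u E L R (A - A') (B - B') (C - C') (D - D') =
    exchange_defect c t u E L R A B C D - exchange_defect c t u E L R A' B' C' D'"
    "exchange_defect c t u E L R (A + A') (B + B') (C + C') (D + D') =
    exchange_defect c t u E L R A B C D + exchange_defect c t u E L R A' B' C' D'"
    "exchange_defect c t u E L R (kscale x A) (kscale x B) (kscale x C) (kscale x D) =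
    kscale x (exchange_defect c t u E L R A B C D)"
    unfolding exchange_defect_def by (simp_all add: alg)
  show "exchange_defect c t u E L R 0 0 0 0 = 0"
    unfolding exchange_defect_def by (simp add: z)
qed

lemma exchange_defect_sum:
  assumes "finite S"
  shows "exchange_defect c t u E L R (\<Sum>k\<in>S. A k) (\<Sum>k\<in>S. B k) (\<Sum>k\<in>S. C k) (\<Sum>k\<in>S. D k) =
    (\<Sum>k\<in>S. exchange_defect c t u E L R (A k) (B k) (C k) (D k))"
  using assms by (induction S rule: finite_induct) (simp_all add: exchange_defect_linear)

lemma entry_sum: "entry (\<Sum>k\<in>S. A k) i j = (\<Sum>k\<in>S. entry (A k) i j)"
  by (induction S rule: infinite_finite_induct) (simp_all add: entry_0 entry_add)

definition one_row :: "nat \<Rightarrow> nat \<Rightarrow> nat" where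
  "one_row n = (\<lambda>i. if i = 0 then n else 0)"

lemma partition_one_row: "is_partition (one_row n)" "part_size (one_row n) = n" "zero_from 1 (one_row n)"
proof -
  show z: "zero_from 1 (one_row n)" by (simp add: zero_from_def one_row_def)
  show "part_size (one_row n) = n" using part_size_eq[OF z] by (simp add: one_row_def)
  show "is_partition (one_row n)"
    using z by (auto simp: is_partition_def one_row_def intro!: decseq_SucI)
qed

section \<open>Transposition with respect to the diagonal weights\<close>

context generic_qt
begin

text \<open>\<open>B\<close> is the adjoint of \<open>A\<close> for a diagonal form given by the
  weights \<open>W l l\<close>. On partitions these weights are nonzero, so the condition on the
  support makes \<open>B\<close> determined by \<open>A\<close>. The relations for \<open>Up\<close>
  are then adjoints of those for \<open>Down\<close>, with reversed factors.\<close>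

definition transposed :: "(nat \<Rightarrow> nat, 'a) kern \<Rightarrow> (nat \<Rightarrow> nat, 'a) kern \<Rightarrow> bool" where
  "transposed A B \<longleftrightarrow> (\<forall>k m. entry B k m * W k k = entry A m k * W m m) \<and>
     (\<forall>k m. entry A k m \<noteq> 0 \<or> entry B k m \<noteq> 0 \<longrightarrow> is_partition k \<and> is_partition m)"

lemma W_diag_nz: "is_partition l \<Longrightarrow> W l l \<noteq> 0"
  using W_nz interlaced_refl by (auto simp: is_partition_def)

lemma transposed_Down: "transposed (Down i) (Up i)"
  unfolding transposed_def
proof (intro conjI allI impI)
  fix k m
  show "entry (Up i) k m * W k k = entry (Down i) m k * W m m"
    using W_diag_nz[of m] W_diag_nz[of k] partition_interlaced[of m k] W_0[of m k]
    by (cases "interlaced m k") (auto simp: entry_Up entry_Down)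
qed (auto dest: Down_nonzeroD Up_nonzeroD)

lemma transposed_sym: "transposed A B \<Longrightarrow> transposed B A"
  by (auto simp: transposed_def)

lemma transposed_Ev: "transposed Ev Ev"
  by (auto simp: transposed_def entry_Ev split: if_splits)

lemma transposed_diff: "transposed A A' \<Longrightarrow> transposed B B' \<Longrightarrow> transposed (A - B) (A' - B')"
  unfolding transposed_def entry_diff left_diff_distrib by (metis diff_zero)

lemma transposed_kscale: "transposed A A' \<Longrightarrow> transposed (kscale c A) (kscale c A')"
  by (auto simp: transposed_def entry_kscale mult.assoc)

lemma transposed_times:
  assumes A: "transposed A A'" and B: "transposed B B'"
  shows "transposed (A * B) (B' * A')"
proof -
  have nz: "entry A m r * entry B r k \<noteq> 0 \<or> entry B' k r * entry A' r m \<noteq> 0 \<Longrightarrow>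
      is_partition m \<and> is_partition r \<and> is_partition k" for m r k
    using A B unfolding transposed_def by force
  have eq: "entry B' k r * entry A' r m * W k k = entry A m r * entry B r k * W m m" for k r m
  proof (cases "is_partition r")
    case True
    have "entry B' k r * entry A' r m * W k k = entry B r k * (entry A' r m * W r r)"
      using B by (simp add: transposed_def mult_ac)
    also have "\<dots> = entry A m r * entry B r k * W m m"
      using A by (simp add: transposed_def mult_ac)
    finally show ?thesis .
  next
    case False
    hence "entry A m r * entry B r k = 0" "entry B' k r * entry A' r m = 0"
      using nz[of m r k] by blast+
    thus ?thesis by (simp only: mult_zero_left)
  qed
  have sums: "entry (A * B) m k = (\<Sum>r\<in>{r. entry A m r \<noteq> 0}. entry A m r * entry B r k)" for m k
    by (rule entry_times) (auto simp: finite_entry)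
  have sums': "entry (B' * A') k m = (\<Sum>r\<in>{r. entry A m r \<noteq> 0}. entry B' k r * entry A' r m)" for m k
  proof (rule entry_times)
    fix r assume "r \<notin> {r. entry A m r \<noteq> 0}"
    hence "entry B' k r * entry A' r m * W k k = 0" unfolding eq by simp
    thus "entry B' k r * entry A' r m = 0" using W_diag_nz[of k] nz[of m r k] by auto
  qed (auto simp: finite_entry)
  show ?thesis
    unfolding transposed_def
  proof (intro conjI allI impI)
    fix k m show "entry (B' * A') k m * W k k = entry (A * B) m k * W m m"
      unfolding sums sums' sum_distrib_right by (simp add: eq)
  next
    fix k m assume "entry (A * B) k m \<noteq> 0 \<or> entry (B' * A') k m \<noteq> 0"
    hence "(\<exists>r. entry A k r * entry B r m \<noteq> 0) \<or> (\<exists>r. entry B' k r * entry A' r m \<noteq> 0)"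
      unfolding sums sums' by (metis (no_types, lifting) sum.not_neutral_contains_not_neutral)
    thus "is_partition k" "is_partition m" using nz by blast+
  qed
qed

lemma transposed_unique: "transposed A B \<Longrightarrow> transposed A C \<Longrightarrow> B = C"
proof (rule kern_eqI)
  fix k m assume *: "transposed A B" "transposed A C"
  hence "entry B k m * W k k = entry C k m * W k k" by (simp add: transposed_def)
  thus "entry B k m = entry C k m"
    using * W_diag_nz[of k] unfolding transposed_def by (metis mult_right_cancel)
qed

lemma transposed_Low: "transposed Low Raise"
  unfolding Low_def Raise_def
  by (intro transposed_kscale transposed_diff transposed_times transposed_Ev transposed_Down)

lemma transposed_Raise: "transposed Raise Low"
  by (rule transposed_sym[OF transposed_Low])

lemma transposed_Up: "transposed (Up i) (Down i)"
  by (rule transposed_sym[OF transposed_Down])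

lemmas transposed_intros = transposed_kscale transposed_diff transposed_times transposed_Ev
  transposed_Down transposed_Up transposed_Low transposed_Raise

lemma Up_Raise: "Up i * Raise - kscale t (Raise * Up i) =
    kscale cc (Up (i + 1) * Ev - Ev * Up (i + 1))"
proof (rule transposed_unique)
  show "transposed (Low * Down i - kscale t (Down i * Low)) (Up i * Raise - kscale t (Raise * Up i))"
    by (intro transposed_intros)
  show "transposed (Low * Down i - kscale t (Down i * Low)) (kscale cc (Up (i + 1) * Ev - Ev * Up (i + 1)))"
    unfolding Low_Down by (intro transposed_intros)
qed

lemma Up_Up_1: "Up i * Up 1 = Up 1 * Up i"
proof (rule transposed_unique)
  show "transposed (Down 1 * Down i) (Up i * Up 1)" by (intro transposed_intros)
  show "transposed (Down 1 * Down i) (Up 1 * Up i)"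
    unfolding Down_Down_1 by (intro transposed_intros)
qed

lemma Low_Up: "Low * Up (i + 1) - Up (i + 1) * Low =
    kscale (cc / q) (kscale t (Ev * Up i) - Up i * Ev)"
proof (rule transposed_unique)
  show "transposed (Down (i + 1) * Raise - Raise * Down (i + 1)) (Low * Up (i + 1) - Up (i + 1) * Low)"
    by (intro transposed_intros)
  show "transposed (Down (i + 1) * Raise - Raise * Down (i + 1))
      (kscale (cc / q) (kscale t (Ev * Up i) - Up i * Ev))"
    unfolding Down_Raise by (intro transposed_intros)
qed

text \<open>The entry of \<open>Up n * Down n\<close> at the empty partition: only the single row of
  length \<open>n\<close> differs from it by a horizontal strip of size \<open>n\<close>.\<close>

definition cauchy_coeff :: "nat \<Rightarrow> 'a" where
  "cauchy_coeff n = W (one_row n) (one_row 0) * W (one_row n) (one_row 0) / W (one_row n) (one_row n)"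

text \<open>The cut-off \<open>K\<close> does not depend on \<open>i\<close> and \<open>j\<close>,
  so that lowering a degree keeps the shape of the sum. For \<open>K > i\<close> nothing is lost,
  because the omitted terms contain \<open>Down\<close> of negative degree.\<close>

definition comm_defect :: "nat \<Rightarrow> int \<Rightarrow> int \<Rightarrow> (nat \<Rightarrow> nat, 'a) kern" where
  "comm_defect K i j = Up j * Down i -
     (\<Sum>k<K. kscale (cauchy_coeff k) (Down (i - int k) * Up (j - int k)))"

section \<open>Vanishing of the commutation defect\<close>

lemma Down_neg: "i < 0 \<Longrightarrow> Down i = 0"
proof (rule kern_eqI, rule ccontr)
  fix l m assume "i < 0" "entry (Down i) l m \<noteq> entry 0 l m"
  thus False using Down_nonzeroD[of i l m] part_size_interlaced[of l m] by (simp add: entry_0)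
qed

lemma Up_neg: "i < 0 \<Longrightarrow> Up i = 0"
proof (rule kern_eqI, rule ccontr)
  fix l m assume "i < 0" "entry (Up i) l m \<noteq> entry 0 l m"
  thus False using Up_nonzeroD[of i l m] part_size_interlaced[of m l] by (simp add: entry_0)
qed

lemma kscale_0: "kscale c (0 :: (nat \<Rightarrow> nat, 'a) kern) = 0" 
  by (rule kern_eqI) (simp add: entry_kscale entry_0)

lemma comm_defect_neg: "i < 0 \<or> j < 0 \<Longrightarrow> comm_defect K i j = 0"
proof -
  assume *: "i < 0 \<or> j < 0"
  hence "Up j * Down i = 0" by (auto simp: Up_neg Down_neg)
  moreover have "Down (i - int k) * Up (j - int k) = 0" for k
    using * Down_neg[of "i - int k"] Up_neg[of "j - int k"] by auto
  ultimately show ?thesis by (simp add: comm_defect_def kscale_0)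
qed

lemma exchange_defect_comm_defect:
  "exchange_defect cc t (cc / q) Ev Low Raise (comm_defect K (i + 1) (j + 1)) (comm_defect K (i + 1) j)
     (comm_defect K i (j + 1)) (comm_defect K i j) = 0"
proof -
  have 1: "exchange_defect cc t (cc / q) Ev Low Raise (Up (j + 1) * Down (i + 1)) (Up j * Down (i + 1))
      (Up (j + 1) * Down i) (Up j * Down i) = 0" for i j
    by (rule exchange_defect_products(1)[OF Low_Down Up_Raise Down_Raise Low_Up])
  have 2: "exchange_defect cc t (cc / q) Ev Low Raise (Down (i + 1) * Up (j + 1)) (Down (i + 1) * Up j)
      (Down i * Up (j + 1)) (Down i * Up j) = 0" for i j
    by (rule exchange_defect_products(2)[OF Low_Down Up_Raise Down_Raise Low_Up])
  have e: "i + 1 - int k = (i - int k) + 1" for i k by simp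
  show ?thesis
    unfolding comm_defect_def exchange_defect_linear exchange_defect_sum[OF finite_lessThan] 1
    unfolding e 2 by (simp add: kscale_0)
qed

text \<open>\<open>Up 1\<close> commutes with every \<open>Up j\<close>, and its commutator with
  \<open>Down i\<close> is \<open>cc\<close> times \<open>Down (i - 1)\<close>. Hence a defect
  commutes with \<open>Up 1\<close> as soon as the defect with \<open>i - 1\<close> is 0.\<close>

lemma Up_1_comm_defect:
  "Up 1 * comm_defect K i j - comm_defect K i j * Up 1 = kscale cc (comm_defect K (i - 1) j)"
proof -
  have ud: "Up 1 * Down i = Down i * Up 1 + kscale cc (Down (i - 1))" for i
    using Up_Down[of "i - 1"] by (simp add: algebra_simps)
  have 1: "Up 1 * (Up j * Down i) - (Up j * Down i) * Up 1 = kscale cc (Up j * Down (i - 1))" for i j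
  proof -
    have "Up 1 * (Up j * Down i) = (Up j * Up 1) * Down i"
      unfolding Up_Up_1[of j] by (simp only: mult.assoc)
    hence "Up 1 * (Up j * Down i) = Up j * (Up 1 * Down i)" by (simp only: mult.assoc)
    thus ?thesis by (simp add: ud kscale_times algebra_simps)
  qed
  have 2: "Up 1 * (Down i * Up j) - (Down i * Up j) * Up 1 = kscale cc (Down (i - 1) * Up j)" for i j
  proof -
    have "Up 1 * (Down i * Up j) = (Up 1 * Down i) * Up j" by (simp only: mult.assoc)
    also have "\<dots> = Down i * (Up 1 * Up j) + kscale cc (Down (i - 1) * Up j)"
      by (simp add: ud kscale_times algebra_simps)
    finally show ?thesis by (simp add: Up_Up_1[of j, symmetric] mult.assoc)
  qed
  have e: "i - int k - 1 = i - 1 - int k" for k by simp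
  have sumk: "kscale c (\<Sum>k\<in>S. A k) = (\<Sum>k\<in>S. kscale c (A k))" for c S and A :: "nat \<Rightarrow> (nat \<Rightarrow> nat, 'a) kern"
    by (induction S rule: infinite_finite_induct) (simp_all add: kscale_0 kscale_algebra)
  have "Up 1 * comm_defect K i j - comm_defect K i j * Up 1 =
     (Up 1 * (Up j * Down i) - (Up j * Down i) * Up 1) -
     (\<Sum>k<K. kscale (cauchy_coeff k) (Up 1 * (Down (i - int k) * Up (j - int k)) -
        (Down (i - int k) * Up (j - int k)) * Up 1))"
    unfolding comm_defect_def
    by (simp only: left_diff_distrib right_diff_distrib sum_distrib_left sum_distrib_right
        kscale_times kscale_algebra sum_subtractf) (simp add: algebra_simps)
  also have "\<dots> = kscale cc (comm_defect K (i - 1) j)"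
    unfolding 1 2 e comm_defect_def kscale_algebra sumk
    by (simp add: mult.commute)
  finally show ?thesis .
qed

text \<open>A high power of \<open>q\<close> makes all exponents nonnegative, and then
  \<open>row_inj\<close> compares the rows one by one.\<close>

lemma ev_inj:
  assumes "is_partition l" "is_partition m" "ev l = ev m"
  shows "l = m"
proof -
  obtain N where N: "zero_from N l" "zero_from N m" using partitionE[OF assms(1,2)] by metis
  define K where "K = part_size l + part_size m"
  have le: "l j \<le> K" "m j \<le> K" for j
    using le_part_size[OF assms(1), of j] le_part_size[OF assms(2), of j] by (auto simp: K_def)
  have e: "q ^ K * (1 / row_var l j) = q ^ (K - l j) * t ^ j" "q ^ K * (1 / row_var m j) = q ^ (K - m j) * t ^ j" for j
    using q_nz le[of j] by (auto simp: row_var_def power_diff)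
  have "(\<Sum>j<N. 1 / row_var l j) = (\<Sum>j<N. 1 / row_var m j)"
    using assms(3) by (simp add: ev_eq[OF N(1)] ev_eq[OF N(2)])
  hence "q ^ K * (\<Sum>j<N. 1 / row_var l j) = q ^ K * (\<Sum>j<N. 1 / row_var m j)" by simp
  hence "(\<Sum>j<N. q ^ (K - l j) * t ^ j) = (\<Sum>j<N. q ^ (K - m j) * t ^ j)"
    unfolding sum_distrib_left e .
  hence "K - l j = K - m j" if "j < N" for j
    using row_inj[where n = N and u = "\<lambda>j. K - l j" and v = "\<lambda>j. K - m j"] that by blast
  hence "l j = m j" if "j < N" for j using that le[of j] by (metis diff_diff_cancel)
  thus ?thesis using N by (intro ext) (metis not_less zero_from_def)
qed

lemma part_size_0: "is_partition l \<Longrightarrow> part_size l = 0 \<Longrightarrow> l = one_row 0"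
  using zero_from_part_size[of l 0] by (auto simp: zero_from_def one_row_def)

lemma interlaced_row_0:
  assumes "interlaced l (one_row 0)"
  shows "l = one_row (l 0)"
proof
  fix i show "l i = one_row (l 0) i"
    using assms by (cases i) (auto simp: interlaced_def one_row_def dest!: spec[of _ "i - 1"])
qed

lemma interlaced_from_row_0: "interlaced (one_row 0) m \<Longrightarrow> m = one_row 0"
  by (auto simp: interlaced_def one_row_def)

lemma interlaced_row: "interlaced (one_row n) (one_row 0)"
  by (auto simp: interlaced_def one_row_def)

lemma W_row_0: "W (one_row 0) (one_row 0) = 1"
  using W_eq[of "one_row 0" "one_row 0" 0] interlaced_row[of 0] by (simp add: one_row_def zero_from_def)

lemma removable_box:
  assumes "is_partition l" "part_size l \<noteq> 0"
  obtains r where "l (Suc r) < l r"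
proof (rule ccontr)
  assume "\<not> thesis"
  hence "l r \<le> l (Suc r)" for r using that by (meson not_less)
  hence le: "l i \<le> l (i + k)" for i k by (induction k) (auto intro: le_trans)
  obtain N where N: "zero_from N l" using assms by (auto simp: is_partition_def)
  have "l i = 0" for i using le[of i N] N by (simp add: zero_from_def)
  thus False using assms by (simp add: part_size_def)
qed

lemma W_single_box_nz: "is_partition l \<Longrightarrow> l (Suc r) < l r \<Longrightarrow> W l (del_box l r) \<noteq> 0"
proof -
  assume p: "is_partition l" "l (Suc r) < l r"
  hence "interlaced l (del_box l r)"
    by (auto simp: interlaced_def del_box_def is_partition_def decseq_SucD)
  thus ?thesis using p W_nz by (auto simp: is_partition_def)
qed

lemma bounded_deg_comm_defect: "bounded_deg (j - i) (comm_defect K i j)"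
proof -
  have z: "bounded_deg (j - i) (0 :: (nat \<Rightarrow> nat, 'a) kern)" by (simp add: bounded_deg_def entry_0)
  have "bounded_deg (j - i) (\<Sum>k<K. kscale (cauchy_coeff k) (Down (i - int k) * Up (j - int k)))" for K
  proof (induction K)
    case (Suc K)
    have "bounded_deg (j - i) (Down (i - int K) * Up (j - int K))"
      using bounded_deg_times[OF bounded_deg_intros(1)[of "i - int K"] bounded_deg_intros(2)[of "j - int K"]]
      by simp
    thus ?case using Suc by (auto intro!: bounded_deg_intros(6,8))
  qed (simp add: z)
  moreover have "bounded_deg (j - i) (Up j * Down i)"
    using bounded_deg_times[OF bounded_deg_intros(2)[of j] bounded_deg_intros(1)[of i]] by simp
  ultimately show ?thesis unfolding comm_defect_def by (rule bounded_deg_intros(7)[rotated])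
qed

text \<open>Nothing can be removed from the empty partition, so among the products of
  \<open>Down\<close> and \<open>Up\<close> only the one of degree 0 contributes, at
  \<open>k = i\<close>; there \<open>cauchy_coeff i\<close> is exactly what is needed.\<close>

lemma comm_defect_row_0:
  assumes "i < K"
  shows "entry (comm_defect K (int i) (int i)) (one_row 0) (one_row 0) = 0"
proof -
  have 1: "entry (Up (int i) * Down (int i)) (one_row 0) (one_row 0) = cauchy_coeff i"
  proof -
    have "entry (Up (int i) * Down (int i)) (one_row 0) (one_row 0) =
        (\<Sum>\<rho>\<in>{one_row i}. entry (Up (int i)) (one_row 0) \<rho> * entry (Down (int i)) \<rho> (one_row 0))"
    proof (rule entry_times)
      fix \<rho> assume "\<rho> \<notin> {one_row i}"
      thus "entry (Up (int i)) (one_row 0) \<rho> * entry (Down (int i)) \<rho> (one_row 0) = 0"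
        using Up_nonzeroD[of "int i" "one_row 0" \<rho>] interlaced_row_0[of \<rho>] partition_one_row(2)
        by (metis add_0 insertI1 mult_eq_0_iff of_nat_0 of_nat_eq_iff)
    qed simp
    thus ?thesis by (simp add: entry_Up entry_Down partition_one_row cauchy_coeff_def W_row_0)
  qed
  have 2: "entry (Down (int i - int k) * Up (int i - int k)) (one_row 0) (one_row 0) = (if k = i then 1 else 0)" for k
  proof -
    have "entry (Down (int i - int k) * Up (int i - int k)) (one_row 0) (one_row 0) =
        (\<Sum>\<rho>\<in>{one_row 0}. entry (Down (int i - int k)) (one_row 0) \<rho> * entry (Up (int i - int k)) \<rho> (one_row 0))"
    proof (rule entry_times)
      fix \<rho> assume "\<rho> \<notin> {one_row 0}"
      thus "entry (Down (int i - int k)) (one_row 0) \<rho> * entry (Up (int i - int k)) \<rho> (one_row 0) = 0"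
        using Down_nonzeroD[of "int i - int k" "one_row 0" \<rho>] interlaced_from_row_0[of \<rho>] by auto
    qed simp
    thus ?thesis by (auto simp: entry_Up entry_Down partition_one_row W_row_0)
  qed
  show ?thesis
    using assms by (simp add: comm_defect_def entry_diff entry_sum entry_kscale 1 2 if_distrib sum.delta cong: if_cong)
qed

lemma comm_defect_zero:
  assumes "i < int K"
  shows "comm_defect K i j = 0"
  using assms
proof (induction "nat (i + j)" arbitrary: i j rule: less_induct)
  case less
  show ?case
  proof (cases "i < 0 \<or> j < 0")
    case False
    hence ij: "0 \<le> i" "0 \<le> j" by auto
    have z0: "comm_defect K (i - 1) j = 0"
      using less ij comm_defect_neg by (cases "i = 0") auto
    moreover have "comm_defect K i (j - 1) = 0"
      using less ij comm_defect_neg by (cases "j = 0") auto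
    moreover have "comm_defect K (i - 1) (j - 1) = 0"
      using less ij comm_defect_neg by (cases "i = 0"; cases "j = 0") auto
    \<comment> \<open>With the three lower defects equal to 0, the exchange relation is reduced to
      the commutator with \<open>Ev\<close>.\<close>
    ultimately have "kscale cc (Ev * comm_defect K i j - comm_defect K i j * Ev) = 0"
      using exchange_defect_comm_defect[of K "i - 1" "j - 1"]
      by (simp add: exchange_defect_def kscale_0)
    hence comm: "entry (kscale cc (Ev * comm_defect K i j - comm_defect K i j * Ev)) l m = 0" for l m
      by (simp add: entry_0)
    have supp: "is_partition l \<and> is_partition m \<and> int (part_size m) = int (part_size l) + (j - i)"
      if "entry (comm_defect K i j) l m \<noteq> 0" for l m
      using bounded_deg_comm_defect[of j i K] that unfolding bounded_deg_def by blast
    have diag: "l = m" if nz: "entry (comm_defect K i j) l m \<noteq> 0" for l m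
    proof -
      have "(ev l - ev m) * entry (comm_defect K i j) l m = 0"
        using comm[of l m] supp[OF nz] cc_nz
        by (simp add: entry_kscale entry_diff entry_Ev_times left_diff_distrib mult.commute)
      thus ?thesis using nz supp[OF nz] ev_inj[of l m] by simp
    qed
    show ?thesis
    proof (rule kern_eqI, rule ccontr)
      fix l m assume "entry (comm_defect K i j) l m \<noteq> entry 0 l m"
      hence nz: "entry (comm_defect K i j) l m \<noteq> 0" by (simp add: entry_0)
      from diag[OF nz] nz have nz: "entry (comm_defect K i j) l l \<noteq> 0" by simp
      from supp[OF nz] have l: "is_partition l" "i = j" by auto
      have Ucomm: "Up 1 * comm_defect K i j = comm_defect K i j * Up 1"
        using Up_1_comm_defect[of K i j] by (simp add: z0 kscale_0)
      \<comment> \<open>As a diagonal matrix that commutes with \<open>Up 1\<close>, the defect has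
        equal eigenvalues at two partitions that differ by one box, the entry of \<open>Up 1\<close>
        between them being nonzero. So the eigenvalue is traced down to the empty partition.\<close>
      have "entry (comm_defect K i j) l l = 0" using l(1)
      proof (induction "part_size l" arbitrary: l rule: less_induct)
        case less
        show ?case
        proof (cases "part_size l = 0")
          case True
          hence "l = one_row 0" using part_size_0 less by simp
          thus ?thesis using comm_defect_row_0[of "nat i" K] assms ij \<open>i < int K\<close> l(2) by simp
        next
          case False
          obtain r where r: "l (Suc r) < l r" using removable_box[OF less.prems False] .
          define p where "p = del_box l r"
          have p: "is_partition p" "part_size l = Suc (part_size p)"
            using partition_del_box[OF less.prems r] part_size_del_box[OF less.prems r] by (auto simp: p_def)
          have u: "entry (Up 1) p l \<noteq> 0"
            using p less.prems W_single_box_nz[OF less.prems r] W_diag_nz[OF p(1)]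
            by (simp add: entry_Up p_def[symmetric])
          have "entry (Up 1 * comm_defect K i j) p l = entry (Up 1) p l * entry (comm_defect K i j) l l"
            using diag by (subst entry_times[of "{l}"]) auto
          moreover have "entry (comm_defect K i j * Up 1) p l = entry (comm_defect K i j) p p * entry (Up 1) p l"
            using diag by (subst entry_times[of "{p}"]) auto
          moreover have "entry (comm_defect K i j) p p = 0" using less.hyps[of p] p by simp
          ultimately show ?thesis using u Ucomm by simp
        qed
      qed
      with nz show False by simp
    qed
  qed (rule comm_defect_neg)
qed

text \<open>The degrees are chosen such that both products lead from \<open>v\<close> to
  \<open>m\<close>, the first one through partitions of size \<open>n\<close>. As
  \<open>i \<le> n\<close>, the cut-off \<open>Suc n\<close> is large enough.\<close>

theorem skew_cauchy:
  assumes m: "is_partition m" and v: "is_partition v"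
  shows "(\<Sum>l | is_partition l \<and> part_size l = n. W l m * W l v / W l l) =
    (\<Sum>k\<le>n. cauchy_coeff k * (\<Sum>l | is_partition l \<and> part_size l + n = part_size m + part_size v + k.
        W m l * W v l / W l l))"
proof -
  define i where "i = int n - int (part_size m)"
  define j where "j = int n - int (part_size v)"
  have fin: "finite {l. is_partition l \<and> part_size l = n}" for n
    by (rule finite_subset[OF _ finite_partitions[of n]]) auto
  have nz: "W v v \<noteq> 0" by (rule W_diag_nz[OF v])
  have 1: "entry (Up j * Down i) v m =
      (\<Sum>l | is_partition l \<and> part_size l = n. W l m * W l v / W l l) / W v v"
  proof -
    have "entry (Up j * Down i) v m =
        (\<Sum>l | is_partition l \<and> part_size l = n. entry (Up j) v l * entry (Down i) l m)"
      by (rule entry_times) (auto simp: fin entry_Up entry_Down j_def split: if_splits)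
    also have "\<dots> = (\<Sum>l | is_partition l \<and> part_size l = n. W l m * W l v / W l l / W v v)"
      by (intro sum.cong) (auto simp: entry_Up entry_Down j_def i_def mult_ac)
    finally show ?thesis by (simp add: sum_divide_distrib)
  qed
  have 2: "entry (Down (i - int k) * Up (j - int k)) v m =
      (\<Sum>l | is_partition l \<and> part_size l + n = part_size m + part_size v + k. W m l * W v l / W l l) / W v v" for k
  proof -
    let ?S = "{l. is_partition l \<and> part_size l + n = part_size m + part_size v + k}"
    have "entry (Down (i - int k) * Up (j - int k)) v m =
        (\<Sum>l\<in>?S. entry (Down (i - int k)) v l * entry (Up (j - int k)) l m)"
    proof (rule entry_times)
      show "finite ?S"
        by (rule finite_subset[OF _ finite_partitions[of "part_size m + part_size v + k"]]) auto
      fix l assume "l \<notin> ?S"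
      hence "entry (Down (i - int k)) v l = 0"
        using Down_nonzeroD[of "i - int k" v l] by (rule_tac ccontr) (auto simp: i_def)
      thus "entry (Down (i - int k)) v l * entry (Up (j - int k)) l m = 0" by simp
    qed
    also have "\<dots> = (\<Sum>l\<in>?S. W m l * W v l / W l l / W v v)"
      using m v by (intro sum.cong) (auto simp: entry_Up entry_Down j_def i_def mult_ac)
    finally show ?thesis by (simp add: sum_divide_distrib)
  qed
  have "comm_defect (Suc n) i j = 0" by (rule comm_defect_zero) (simp add: i_def)
  hence "entry (Up j * Down i) v m = entry (\<Sum>k<Suc n. kscale (cauchy_coeff k) (Down (i - int k) * Up (j - int k))) v m"
    by (simp add: comm_defect_def)
  thus ?thesis
    unfolding 1 entry_sum entry_kscale 2 lessThan_Suc_atMost using nz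
    by (simp add: sum_divide_distrib[symmetric])
qed

lemma cauchy_coeff_eq: "cauchy_coeff n = g n 0"
proof -
  have il: "interlaced (one_row n) (one_row n)"
    by (rule interlaced_refl) (use partition_one_row in \<open>simp add: is_partition_def\<close>)
  note N = partition_one_row(3)
  have "W (one_row n) (one_row 0) = 1"
    using W_eq[OF interlaced_row N] g_nz by (simp add: wl_def wr_def one_row_def g_0)
  moreover have "W (one_row n) (one_row n) = 1 / g n 0"
    using W_eq[OF il N] g_nz by (simp add: wl_def wr_def one_row_def g_0)
  ultimately show ?thesis by (simp add: cauchy_coeff_def)
qed

end

section \<open>Infinite \<open>q\<close>-Pochhammer symbols\<close>

definition fps_dilate :: "'a::comm_ring_1 \<Rightarrow> 'a fps \<Rightarrow> 'a fps" where
  "fps_dilate x f = Abs_fps (\<lambda>n. x ^ n * fps_nth f n)"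

lemma fps_dilate_nth: "fps_nth (fps_dilate x f) n = x ^ n * fps_nth f n"
  by (simp add: fps_dilate_def)

lemma fps_dilate_mult: "fps_dilate x (f * g) = fps_dilate x f * fps_dilate x g"
proof (rule fps_ext)
  fix n
  have "x ^ n * (fps_nth f i * fps_nth g (n - i)) = x ^ i * fps_nth f i * (x ^ (n - i) * fps_nth g (n - i))"
    if "i \<le> n" for i
    using that by (simp add: mult_ac flip: power_add)
  thus "fps_nth (fps_dilate x (f * g)) n = fps_nth (fps_dilate x f * fps_dilate x g) n"
    by (simp add: fps_dilate_nth fps_mult_nth sum_distrib_left)
qed

lemma fps_X_power_compose_nth:
  fixes f :: "'a::comm_ring_1 fps"
  assumes "e \<ge> 1"
  shows "fps_nth (f oo fps_X ^ e) n = (if e dvd n then fps_nth f (n div e) else 0)"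
proof -
  have "fps_nth (f oo fps_X ^ e) n = (\<Sum>i=0..n. if n = e * i then fps_nth f i else 0)"
    unfolding fps_compose_nth by (intro sum.cong) (auto simp: fps_X_power_nth simp flip: power_mult)
  also have "\<dots> = (if e dvd n then fps_nth f (n div e) else 0)"
  proof (cases "e dvd n")
    case True
    then obtain k where k: "n = e * k" by auto
    have "k \<in> {0..n}" using assms by (auto simp: k)
    moreover have "(if n = e * i then fps_nth f i else 0) = (if k = i then fps_nth f i else 0)" for i
      using assms by (auto simp: k)
    ultimately show ?thesis using assms k by (simp add: sum.delta)
  qed (auto intro!: sum.neutral)
  finally show ?thesis .
qed

context generic_qt
begin

text \<open>Euler's expansion of the infinite product with parameter \<open>a * s\<close>: the
  coefficients are \<open>(-a)^m q^(m(m-1)/2) / (q;q)_m\<close>.\<close>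

definition euler_series :: "'a \<Rightarrow> 'a fps" where
  "euler_series a = Abs_fps (\<lambda>m. \<Prod>i<m. - a * q ^ i / (1 - q ^ (i + 1)))"

text \<open>The scalar series of the skew Cauchy identity, with coefficients
  \<open>(t;q)_k / (q;q)_k\<close>.\<close>

definition binomial_series :: "'a fps" where
  "binomial_series = Abs_fps (\<lambda>k. g k 0)"

lemma q_pow_nz: "1 - q ^ Suc i \<noteq> 0"
  using one_minus_monom_nz[of "Suc i" 0] by simp

lemma euler_series_dilate:
  "fps_dilate (q ^ n) (euler_series a) =
     (1 - fps_const (a * q ^ n) * fps_X) * fps_dilate (q ^ Suc n) (euler_series a)"
proof (rule fps_ext)
  fix m
  show "fps_nth (fps_dilate (q ^ n) (euler_series a)) m =
     fps_nth ((1 - fps_const (a * q ^ n) * fps_X) * fps_dilate (q ^ Suc n) (euler_series a)) m"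
  proof (cases m)
    case 0
    thus ?thesis by (simp add: fps_dilate_nth left_diff_distrib mult.assoc)
  next
    case (Suc k)
    define e where "e = fps_nth (euler_series a) k"
    have E: "fps_nth (euler_series a) (Suc k) = e * (- a * q ^ k / (1 - q ^ Suc k))"
      by (simp add: euler_series_def e_def)
    have "(q ^ n) ^ Suc k * (e * (- a * q ^ k / (1 - q ^ Suc k))) =
        (q ^ Suc n) ^ Suc k * (e * (- a * q ^ k / (1 - q ^ Suc k))) - a * q ^ n * ((q ^ Suc n) ^ k * e)"
    proof -
      have p: "(q ^ Suc n) ^ Suc k = (q ^ n) ^ Suc k * q ^ Suc k" "(q ^ Suc n) ^ k = (q ^ n) ^ k * q ^ k"
        by (simp_all add: power_mult_distrib mult_ac)
      have "u * (e * (- a * v / w)) = u * (1 - w) * (e * (- a * v / w)) - u * v * a * e"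
        if "w \<noteq> 0" for u v w :: 'a
        using that by (simp add: field_simps)
      from this[OF q_pow_nz[of k], of "(q ^ n) ^ Suc k" "q ^ k"] show ?thesis
        unfolding p by (simp add: mult_ac)
    qed
    thus ?thesis
      by (simp add: Suc fps_dilate_nth left_diff_distrib mult.assoc E e_def[symmetric] del: power_Suc)
  qed
qed

text \<open>Iterating the q-difference equation gives an exact remainder after \<open>n\<close>
  factors, from which the convergence of the partial products is read off.\<close>

lemma euler_series_split:
  "euler_series a = (\<Prod>k<n. 1 - fps_const (a * q ^ k) * fps_X) * fps_dilate (q ^ n) (euler_series a)"
proof (induction n)
  case 0
  show ?case by (rule fps_ext) (simp add: fps_dilate_nth)
next
  case (Suc n)
  show ?case
    by (subst Suc.IH, subst euler_series_dilate) (simp add: mult.assoc)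
qed

lemma binomial_series_dilate:
  "(1 - fps_X) * binomial_series = (1 - fps_const t * fps_X) * fps_dilate q binomial_series"
proof (rule fps_ext)
  fix m
  show "fps_nth ((1 - fps_X) * binomial_series) m =
     fps_nth ((1 - fps_const t * fps_X) * fps_dilate q binomial_series) m"
  proof (cases m)
    case 0
    thus ?thesis by (simp add: fps_dilate_nth left_diff_distrib mult.assoc)
  next
    case (Suc k)
    define b where "b = fps_nth binomial_series k"
    have B: "fps_nth binomial_series (Suc k) = b * ((1 - q ^ k * t) / (1 - q ^ Suc k))"
      by (simp add: binomial_series_def b_def g_Suc del: power_Suc)
    have "b * ((1 - q ^ k * t) / (1 - q ^ Suc k)) - b =
        q ^ Suc k * (b * ((1 - q ^ k * t) / (1 - q ^ Suc k))) - t * (q ^ k * b)"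
      using q_pow_nz[of k] by (simp add: divide_simps del: power_Suc) (simp add: algebra_simps)
    thus ?thesis
      by (simp add: Suc fps_dilate_nth left_diff_distrib mult.assoc B b_def[symmetric] del: power_Suc)
  qed
qed

lemma euler_series_unique:
  assumes "f = (1 - fps_const a * fps_X) * fps_dilate q f" "fps_nth f 0 = 1"
  shows "f = euler_series a"
proof (rule fps_ext)
  fix m show "fps_nth f m = fps_nth (euler_series a) m"
  proof (induction m)
    case (Suc k)
    have "fps_nth f (Suc k) = fps_nth ((1 - fps_const a * fps_X) * fps_dilate q f) (Suc k)"
      using assms(1) by simp
    hence "fps_nth f (Suc k) * (1 - q ^ Suc k) = - a * q ^ k * fps_nth f k"
      by (simp add: fps_dilate_nth left_diff_distrib mult.assoc algebra_simps del: power_Suc)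
    thus ?case using q_pow_nz[of k] Suc by (simp add: euler_series_def field_simps del: power_Suc)
  qed (simp add: assms(2) euler_series_def)
qed

text \<open>Both sides have constant term 1 and solve the q-difference equation with parameter
  \<open>t\<close>, which determines each coefficient from the previous one. In the product, the
  factor \<open>1 - s\<close> produced by the first series is turned into \<open>1 - t s\<close> by
  the second.\<close>

theorem q_binomial_theorem: "euler_series t = euler_series 1 * binomial_series"
proof (rule euler_series_unique[symmetric])
  have e: "euler_series 1 = (1 - fps_X) * fps_dilate q (euler_series 1)"
  proof -
    have "fps_dilate 1 (euler_series 1) = euler_series 1" by (rule fps_ext) (simp add: fps_dilate_nth)
    thus ?thesis using euler_series_dilate[of 0 1] by simp
  qed
  have "euler_series 1 * binomial_series = fps_dilate q (euler_series 1) * ((1 - fps_X) * binomial_series)"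
    by (subst e) (simp only: mult_ac)
  also have "\<dots> = (1 - fps_const t * fps_X) * fps_dilate q (euler_series 1 * binomial_series)"
    unfolding binomial_series_dilate fps_dilate_mult by (simp only: mult_ac)
  finally show "euler_series 1 * binomial_series =
      (1 - fps_const t * fps_X) * fps_dilate q (euler_series 1 * binomial_series)" .
qed (simp add: euler_series_def binomial_series_def g_0)

end

section \<open>The field of rational functions and its q-adic valuation ring\<close>

lemma Qvar_Tvar_monom: "Qvar ^ a * Tvar ^ b = Fract (monom (monom 1 b) a) 1"
proof -
  have q: "Qvar ^ a = Fract (monom 1 a) 1" for a
  proof (induction a)
    case 0
    have "monom (1 :: rat poly) 0 = 1" by (simp add: monom_0 one_pCons)
    thus ?case by (simp only: power_0 One_fract_def)
  qed (simp add: Qvar_def monom_Suc)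
  have t: "Tvar ^ b = Fract [:monom 1 b:] 1" for b
  proof (induction b)
    case 0
    have "[:monom (1::rat) 0:] = 1" by (simp add: monom_0 one_pCons)
    thus ?case by (simp only: power_0 One_fract_def)
  qed (simp add: Tvar_def monom_Suc)
  show ?thesis by (simp add: q t smult_monom mult.commute[of "monom 1 a"])
qed

lemma Fract_sum: "(\<Sum>j\<in>S. Fract (f j) 1) = Fract (\<Sum>j\<in>S. f j) (1 :: 'b::idom)"
  by (induction S rule: infinite_finite_induct) (simp_all add: Zero_fract_def)

interpretation qt: generic_qt Qvar Tvar
proof
  have neq: "Fract a 1 = Fract b 1 \<longleftrightarrow> a = b" for a b :: "rat poly poly" by (simp add: eq_fract)
  show "a = c \<and> b = d" if "Qvar ^ a * Tvar ^ b = Qvar ^ c * Tvar ^ d" for a b c d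
  proof -
    have "coeff (coeff (monom (monom (1::rat) b) a) a) b = coeff (coeff (monom (monom 1 d) c) a) b"
      using that unfolding Qvar_Tvar_monom neq by simp
    thus ?thesis by (auto split: if_splits)
  qed
  show "Qvar \<noteq> 0" "Tvar \<noteq> 0"
    by (simp_all add: Qvar_def Tvar_def Zero_fract_def eq_fract)
  show "u j = v j" if eq: "(\<Sum>j<n. Qvar ^ u j * Tvar ^ j) = (\<Sum>j<n. Qvar ^ v j * Tvar ^ j)" and j: "j < n"
    for u v :: "nat \<Rightarrow> nat" and n j
  proof -
    \<comment> \<open>The \<open>j\<close>-th term is the only one with \<open>t ^ j\<close>, so its
      power of \<open>q\<close> can be read off as a coefficient.\<close>
    have c: "coeff (coeff (\<Sum>j<n. monom (monom (1::rat) j) (w j)) k) j = (if w j = k then 1 else 0)" for w k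
    proof -
      have "coeff (coeff (\<Sum>j<n. monom (monom (1::rat) j) (w j)) k) j =
          (\<Sum>i<n. if i = j then (if w j = k then 1 else 0) else 0)"
        unfolding coeff_sum by (intro sum.cong) auto
      thus ?thesis using j by simp
    qed
    have "(\<Sum>j<n. monom (monom (1::rat) j) (u j)) = (\<Sum>j<n. monom (monom 1 j) (v j))"
      using eq unfolding Qvar_Tvar_monom Fract_sum neq .
    hence "(if u j = u j then 1 else 0) = (if v j = u j then 1 else (0::rat))" by (simp only: c[symmetric])
    thus ?thesis by (auto split: if_splits)
  qed
qed

text \<open>The valuation ring of the q-adic valuation: nonvanishing of the denominator at
  \<open>q = 0\<close> means that \<open>q\<close> does not divide it.\<close>

definition q_integral :: "ratqt \<Rightarrow> bool" where
  "q_integral x \<longleftrightarrow> (\<exists>a b. poly b 0 \<noteq> 0 \<and> x = Fract a b)"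

lemma q_integral_add: "q_integral x \<Longrightarrow> q_integral y \<Longrightarrow> q_integral (x + y)"
proof -
  assume "q_integral x" "q_integral y"
  then obtain a b c d where *: "poly b 0 \<noteq> 0" "x = Fract a b" "poly d 0 \<noteq> 0" "y = Fract c d"
    by (auto simp: q_integral_def)
  hence "b \<noteq> 0" "d \<noteq> 0" by auto
  thus ?thesis unfolding q_integral_def
    by (intro exI[of _ "a * d + c * b"] exI[of _ "b * d"]) (simp add: *)
qed

lemma q_integral_mult: "q_integral x \<Longrightarrow> q_integral y \<Longrightarrow> q_integral (x * y)"
proof -
  assume "q_integral x" "q_integral y"
  then obtain a b c d where *: "poly b 0 \<noteq> 0" "x = Fract a b" "poly d 0 \<noteq> 0" "y = Fract c d"
    by (auto simp: q_integral_def)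
  thus ?thesis unfolding q_integral_def
    by (intro exI[of _ "a * c"] exI[of _ "b * d"]) (simp add: *)
qed

lemma q_integral_Fract_1: "q_integral (Fract a 1)"
  unfolding q_integral_def by (intro exI[of _ a] exI[of _ 1]) simp

lemma q_integral_uminus: "q_integral x \<Longrightarrow> q_integral (- x)"
  using q_integral_mult[OF q_integral_Fract_1[of "-1"], of x] by (simp flip: minus_fract One_fract_def)

lemma q_integral_0: "q_integral 0" and q_integral_1: "q_integral 1"
  using q_integral_Fract_1[of 0] q_integral_Fract_1[of 1] by (simp_all add: Zero_fract_def One_fract_def)

lemma q_integral_power: "q_integral x \<Longrightarrow> q_integral (x ^ n)"
  by (induction n) (auto intro: q_integral_1 q_integral_mult)

lemma q_integral_sum: "(\<And>i. i \<in> S \<Longrightarrow> q_integral (f i)) \<Longrightarrow> q_integral (\<Sum>i\<in>S. f i)"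
  by (induction S rule: infinite_finite_induct) (auto intro: q_integral_0 q_integral_add)

lemma q_integral_prod: "(\<And>i. i \<in> S \<Longrightarrow> q_integral (f i)) \<Longrightarrow> q_integral (\<Prod>i\<in>S. f i)"
  by (induction S rule: infinite_finite_induct) (auto intro: q_integral_1 q_integral_mult)

lemma q_integral_Qvar: "q_integral Qvar" and q_integral_Tvar: "q_integral Tvar"
  unfolding Qvar_def Tvar_def by (rule q_integral_Fract_1)+

lemma q_integral_inverse: "q_integral (1 / (1 - Qvar ^ Suc m))"
proof -
  have "Qvar ^ k = Fract ([:0, 1:] ^ k) 1" for k
    by (induction k) (simp_all add: Qvar_def One_fract_def)
  hence "1 - Qvar ^ Suc m = Fract (1 - [:0, 1:] ^ Suc m) 1"
    by (simp add: One_fract_def del: power_Suc)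
  hence "1 / (1 - Qvar ^ Suc m) = Fract 1 (1 - [:0, 1:] ^ Suc m)"
    by (simp add: One_fract_def del: power_Suc)
  thus ?thesis unfolding q_integral_def
    by (intro exI[of _ 1] exI[of _ "1 - [:0, 1:] ^ Suc m"]) simp
qed

lemma q_integral_euler_series: "q_integral a \<Longrightarrow> q_integral (fps_nth (qt.euler_series a) m)"
proof -
  assume a: "q_integral a"
  have "- a * Qvar ^ i / (1 - Qvar ^ (i + 1)) = - a * Qvar ^ i * (1 / (1 - Qvar ^ Suc i))" for i by simp
  thus ?thesis unfolding qt.euler_series_def fps_nth_Abs_fps
    by (intro q_integral_prod)
      (simp only:, intro q_integral_mult q_integral_uminus a q_integral_power q_integral_Qvar q_integral_inverse)
qed

definition fps_q_integral :: "ratqt fps \<Rightarrow> bool" where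
  "fps_q_integral f \<longleftrightarrow> (\<forall>n. q_integral (fps_nth f n))"

lemma fps_q_integral_mult: "fps_q_integral f \<Longrightarrow> fps_q_integral g \<Longrightarrow> fps_q_integral (f * g)"
  by (auto simp: fps_q_integral_def fps_mult_nth intro!: q_integral_sum q_integral_mult)

lemma fps_q_integral_partial:
  assumes "q_integral a"
  shows "fps_q_integral (\<Prod>k<n. 1 - fps_const (a * Qvar ^ k) * fps_X)"
proof (induction n)
  case 0
  show ?case by (auto simp: fps_q_integral_def fps_one_nth intro: q_integral_1 q_integral_0)
next
  case (Suc n)
  have "fps_q_integral (1 - fps_const (a * Qvar ^ n) * fps_X)"
    unfolding fps_q_integral_def
  proof
    fix m
    have "q_integral (a * Qvar ^ n)"
      by (intro q_integral_mult assms q_integral_power q_integral_Qvar)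
    from q_integral_uminus[OF this] show "q_integral (fps_nth (1 - fps_const (a * Qvar ^ n) * fps_X) m)"
      by (cases "m = 0"; cases "m = 1") (auto simp: fps_X_def fps_one_nth intro: q_integral_1 q_integral_0)
  qed
  thus ?case using Suc by (simp add: fps_q_integral_mult)
qed

text \<open>The limit is the partial product times a dilated series. For \<open>n \<ge> M\<close>
  the latter is 1 modulo \<open>Qvar ^ M\<close>, because its coefficient at \<open>m > 0\<close>
  carries \<open>Qvar ^ (n * m)\<close>; everything else is integral.\<close>

lemma qadic_tendsto_partial:
  assumes a: "q_integral a"
  shows "qadic_tendsto (\<lambda>n. fps_nth (\<Prod>k<n. 1 - fps_const (a * Qvar ^ k) * fps_X) N)
     (fps_nth (qt.euler_series a) N)"
  unfolding qadic_tendsto_def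
proof
  fix M
  show "\<forall>\<^sub>F n in sequentially. \<exists>c b. \<not> [:0, 1:] dvd b \<and>
      fps_nth (\<Prod>k<n. 1 - fps_const (a * Qvar ^ k) * fps_X) N - fps_nth (qt.euler_series a) N
        = Qvar ^ M * Fract c b"
    using eventually_ge_at_top[of M]
  proof eventually_elim
    fix n assume n: "M \<le> n"
    define P where "P = (\<Prod>k<n. 1 - fps_const (a * Qvar ^ k) * fps_X)"
    define e where "e = fps_nth (qt.euler_series a)"
    \<comment> \<open>The remainder divided by \<open>Qvar ^ M\<close>; the exponent
      \<open>n * m - M\<close> is a true difference, as \<open>m > 0\<close> and
      \<open>M \<le> n\<close>.\<close>
    define R where "R = Abs_fps (\<lambda>m. if m = 0 then 0 else - (Qvar ^ (n * m - M) * e m))"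
    have e0: "e 0 = 1" by (simp add: e_def qt.euler_series_def)
    have "fps_dilate (Qvar ^ n) (qt.euler_series a) = 1 - fps_const (Qvar ^ M) * R"
    proof (rule fps_ext)
      fix m
      have "(Qvar ^ n) ^ m = Qvar ^ M * Qvar ^ (n * m - M)" if "m \<noteq> 0"
      proof -
        have "M \<le> n * m" using n that by (metis le_trans mult.right_neutral mult_le_mono2 One_nat_def Suc_leI neq0_conv)
        thus ?thesis by (simp flip: power_mult power_add)
      qed
      thus "fps_nth (fps_dilate (Qvar ^ n) (qt.euler_series a)) m = fps_nth (1 - fps_const (Qvar ^ M) * R) m"
        using e0 by (simp add: fps_dilate_nth R_def e_def fps_one_nth)
    qed
    hence "qt.euler_series a = P * (1 - fps_const (Qvar ^ M) * R)"
      using qt.euler_series_split[of a n] by (simp add: P_def)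
    hence "P - qt.euler_series a = fps_const (Qvar ^ M) * (P * R)" by (simp add: algebra_simps)
    hence "fps_nth P N - fps_nth (qt.euler_series a) N = Qvar ^ M * fps_nth (P * R) N"
      by (metis fps_sub_nth fps_mult_left_const_nth)
    moreover have "fps_q_integral (P * R)"
      using q_integral_euler_series[OF a] fps_q_integral_partial[OF a, of n]
      by (intro fps_q_integral_mult)
        (auto simp: P_def fps_q_integral_def R_def e_def intro!: q_integral_0 q_integral_uminus q_integral_mult q_integral_power q_integral_Qvar)
    then obtain c b where "poly b 0 \<noteq> 0" "fps_nth (P * R) N = Fract c b"
      unfolding fps_q_integral_def q_integral_def by blast
    moreover from this have "\<not> [:0, 1:] dvd b" using poly_eq_0_iff_dvd[of b 0] by simp
    ultimately show "\<exists>c b. \<not> [:0, 1:] dvd b \<and>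
      fps_nth (\<Prod>k<n. 1 - fps_const (a * Qvar ^ k) * fps_X) N - fps_nth (qt.euler_series a) N
        = Qvar ^ M * Fract c b"
      unfolding P_def by (intro exI[of _ c] exI[of _ b]) simp
  qed
qed

lemma qadic_tendsto_0: "qadic_tendsto (\<lambda>_. 0) 0"
  unfolding qadic_tendsto_def
  by (intro allI always_eventually exI[of _ 0] exI[of _ 1])
    (use poly_eq_0_iff_dvd[of "1 :: rat poly poly" 0] in \<open>simp add: Zero_fract_def[symmetric]\<close>)

text \<open>Substituting \<open>s ^ e\<close> commutes with the finite partial products and merely
  spreads out their coefficients; in between the sequences are constantly 0. Uniqueness of limits
  resolves the definite description.\<close>

lemma qpoch_inf_eq:
  assumes a: "q_integral a" and e: "e \<ge> 1"
  shows "qpoch_inf (fps_const a * fps_X ^ e) = qt.euler_series a oo fps_X ^ e"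
proof (rule fps_ext)
  fix N
  have X0: "fps_nth (fps_X ^ e :: ratqt fps) 0 = 0" using e by (simp add: fps_X_power_nth)
  have P: "(\<Prod>k<n. 1 - fps_const a * fps_X ^ e * fps_const (Qvar ^ k)) =
      (\<Prod>k<n. 1 - fps_const (a * Qvar ^ k) * fps_X) oo fps_X ^ e" for n
  proof -
    have "(1 - fps_const (a * Qvar ^ k) * fps_X) oo fps_X ^ e = 1 - fps_const a * fps_X ^ e * fps_const (Qvar ^ k)" for k
      using X0 by (simp add: fps_compose_sub_distrib fps_compose_mult_distrib fps_const_mult[symmetric] mult_ac del: fps_const_mult)
    thus ?thesis using X0 by (simp add: fps_compose_prod_distrib)
  qed
  have "qadic_tendsto (\<lambda>n. fps_nth (\<Prod>k<n. 1 - fps_const a * fps_X ^ e * fps_const (Qvar ^ k)) N)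
      (fps_nth (qt.euler_series a oo fps_X ^ e) N)"
    unfolding P fps_X_power_compose_nth[OF e]
    using qadic_tendsto_partial[OF a] qadic_tendsto_0 by simp
  thus "fps_nth (qpoch_inf (fps_const a * fps_X ^ e)) N = fps_nth (qt.euler_series a oo fps_X ^ e) N"
    unfolding qpoch_inf_def fps_nth_Abs_fps using qadic_tendsto_unique by (intro the_equality) auto
qed

lemma qpoch_inf_quotient:
  assumes e: "e \<ge> 1"
  shows "qpoch_inf (fps_const Tvar * fps_X ^ e) / qpoch_inf (fps_X ^ e) = qt.binomial_series oo fps_X ^ e"
proof -
  have X0: "fps_nth (fps_X ^ e :: ratqt fps) 0 = 0" using e by (simp add: fps_X_power_nth)
  have 1: "qpoch_inf (fps_X ^ e) = qt.euler_series 1 oo fps_X ^ e"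
    using qpoch_inf_eq[OF q_integral_1 e] by simp
  have "fps_nth (qt.euler_series 1 oo fps_X ^ e) 0 = 1"
    by (simp add: qt.euler_series_def)
  hence nz: "qt.euler_series 1 oo fps_X ^ e \<noteq> 0" by (metis fps_zero_nth zero_neq_one)
  have "qpoch_inf (fps_const Tvar * fps_X ^ e) = (qt.euler_series 1 oo fps_X ^ e) * (qt.binomial_series oo fps_X ^ e)"
    using X0 by (simp add: qpoch_inf_eq[OF q_integral_Tvar e] qt.q_binomial_theorem fps_compose_mult_distrib)
  thus ?thesis using nz by (simp add: 1)
qed

section \<open>Principal specialization\<close>

definition parts_upto :: "nat \<Rightarrow> (nat \<Rightarrow> nat) set" where
  "parts_upto n = {l. is_partition l \<and> part_size l \<le> n}"

lemma finite_parts_upto: "finite (parts_upto n)"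
  unfolding parts_upto_def by (rule finite_partitions)

lemma parts_upto_mono: "n \<le> k \<Longrightarrow> parts_upto n \<subseteq> parts_upto k"
  by (auto simp: parts_upto_def)

text \<open>Infinite sums over all partitions, in a form that needs no topology: only partitions of
  size at most \<open>n\<close> are taken to contribute to the \<open>n\<close>-th coefficient.\<close>

definition psum :: "((nat \<Rightarrow> nat) \<Rightarrow> 'a::comm_ring_1 fps) \<Rightarrow> 'a fps" where
  "psum f = Abs_fps (\<lambda>n. \<Sum>l\<in>parts_upto n. fps_nth (f l) n)"

lemma psum_nth: "fps_nth (psum f) n = (\<Sum>l\<in>parts_upto n. fps_nth (f l) n)"
  by (simp add: psum_def)

lemma psum_cong: "(\<And>l. is_partition l \<Longrightarrow> f l = g l) \<Longrightarrow> psum f = psum g"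
  by (rule fps_ext) (auto simp: psum_nth parts_upto_def intro!: sum.cong)

lemma psum_swap: "psum (\<lambda>l. psum (\<lambda>m. f l m)) = psum (\<lambda>m. psum (\<lambda>l. f l m))"
  by (rule fps_ext) (simp add: psum_nth, rule sum.swap)

text \<open>A coefficient of the product involves lower coefficients of \<open>psum f\<close>, which
  are sums over fewer partitions. By assumption \<open>f l\<close> is divisible by
  \<open>s ^ part_size l\<close>, so the missing partitions contribute 0.\<close>

lemma psum_mult:
  assumes "\<And>l n. n < part_size l \<Longrightarrow> fps_nth (f l) n = 0"
  shows "psum (\<lambda>l. c * f l) = c * psum f"
proof (rule fps_ext)
  fix n
  have "fps_nth (psum f) (n - i) = (\<Sum>l\<in>parts_upto n. fps_nth (f l) (n - i))" for i
    unfolding psum_nth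
  proof (rule sum.mono_neutral_left)
    show "parts_upto (n - i) \<subseteq> parts_upto n" by (rule parts_upto_mono) simp
    show "\<forall>l\<in>parts_upto n - parts_upto (n - i). fps_nth (f l) (n - i) = 0"
      using assms by (auto simp: parts_upto_def not_le)
  qed (rule finite_parts_upto)
  hence "fps_nth (c * psum f) n = (\<Sum>i=0..n. fps_nth c i * (\<Sum>l\<in>parts_upto n. fps_nth (f l) (n - i)))"
    by (simp add: fps_mult_nth)
  also have "\<dots> = (\<Sum>l\<in>parts_upto n. fps_nth (c * f l) n)"
    unfolding fps_mult_nth sum_distrib_left by (rule sum.swap)
  finally show "fps_nth (psum (\<lambda>l. c * f l)) n = fps_nth (c * psum f) n" by (simp add: psum_nth)
qed

lemma fps_X_power_mult_small: "n < k \<Longrightarrow> fps_nth (fps_X ^ k * f) n = (0 :: 'a::comm_ring_1)"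
  by (simp add: fps_X_power_mult_nth)

lemma psum_mult_X:
  fixes f :: "(nat \<Rightarrow> nat) \<Rightarrow> 'a::comm_ring_1 fps"
  assumes "\<And>l. is_partition l \<Longrightarrow> f l = fps_X ^ part_size l * h l"
  shows "psum (\<lambda>l. c * f l) = c * psum f"
proof -
  have "psum (\<lambda>l. c * f l) = psum (\<lambda>l. c * (fps_X ^ part_size l * h l))"
    using assms by (intro psum_cong) simp
  also have "\<dots> = c * psum (\<lambda>l. fps_X ^ part_size l * h l)"
    by (rule psum_mult) (rule fps_X_power_mult_small)
  also have "psum (\<lambda>l. fps_X ^ part_size l * h l) = psum f"
    using assms by (intro psum_cong) simp
  finally show ?thesis .
qed

lemma psum_single:
  assumes "\<And>l. is_partition l \<Longrightarrow> l \<noteq> one_row 0 \<Longrightarrow> f l = 0"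
  shows "psum f = f (one_row 0)"
proof (rule fps_ext)
  fix n
  have "one_row 0 \<in> parts_upto n" by (simp add: parts_upto_def partition_one_row)
  hence "(\<Sum>l\<in>parts_upto n. fps_nth (f l) n) = fps_nth (f (one_row 0)) n + (\<Sum>l\<in>parts_upto n - {one_row 0}. fps_nth (f l) n)"
    using finite_parts_upto by (intro sum.remove) auto
  also have "(\<Sum>l\<in>parts_upto n - {one_row 0}. fps_nth (f l) n) = 0"
    using assms by (intro sum.neutral) (auto simp: parts_upto_def)
  finally show "fps_nth (psum f) n = fps_nth (f (one_row 0)) n" by (simp add: psum_nth)
qed

text \<open>Coefficient \<open>n\<close> runs over partitions up to size \<open>n\<close> on the
  left but only up to \<open>n div j\<close> on the right; the bound on \<open>part_size l\<close>
  makes the surplus vanish.\<close>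

lemma psum_X_power:
  fixes w :: "(nat \<Rightarrow> nat) \<Rightarrow> 'a::comm_ring_1"
  assumes j: "j \<ge> 1" and w: "\<And>l. is_partition l \<Longrightarrow> w l \<noteq> 0 \<Longrightarrow> part_size l \<le> h l"
  shows "psum (\<lambda>l. fps_X ^ (j * h l) * fps_const (w l)) =
    Abs_fps (\<lambda>n. \<Sum>l\<in>parts_upto n. if h l = n then w l else 0) oo fps_X ^ j"
proof (rule fps_ext)
  fix n
  have "(\<Sum>l\<in>parts_upto n. if n = j * h l then w l else 0) =
      (if j dvd n then \<Sum>l\<in>parts_upto (n div j). if h l = n div j then w l else 0 else 0)"
  proof (cases "j dvd n")
    case True
    then obtain k where k: "n = j * k" by auto
    have "k \<le> n" using j by (simp add: k)
    have "(\<Sum>l\<in>parts_upto n. if n = j * h l then w l else 0) = (\<Sum>l\<in>parts_upto n. if h l = k then w l else 0)"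
      using j by (intro sum.cong) (auto simp: k)
    also have "\<dots> = (\<Sum>l\<in>parts_upto k. if h l = k then w l else 0)"
      using \<open>k \<le> n\<close> parts_upto_mono w finite_parts_upto
      by (intro sum.mono_neutral_right) (auto simp: parts_upto_def)
    finally show ?thesis using j by (simp add: k)
  qed (auto intro!: sum.neutral)
  moreover have "fps_nth (fps_X ^ (j * h l) * fps_const (w l)) n = (if n = j * h l then w l else 0)" for l
    by (simp add: fps_X_power_nth)
  ultimately show "fps_nth (psum (\<lambda>l. fps_X ^ (j * h l) * fps_const (w l))) n =
    fps_nth (Abs_fps (\<lambda>n. \<Sum>l\<in>parts_upto n. if h l = n then w l else 0) oo fps_X ^ j) n"
    unfolding psum_nth fps_X_power_compose_nth[OF j] by simp
qed

section \<open>Cauchy identities as identities of power series in \<open>s\<close>\<close>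

context generic_qt
begin

abbreviation "Bser e \<equiv> binomial_series oo fps_X ^ e"

lemma W_size: "is_partition l \<Longrightarrow> W l m \<noteq> 0 \<Longrightarrow> part_size m \<le> part_size l \<and> is_partition m"
  using W_nonzeroD part_size_interlaced partition_interlaced by blast

text \<open>The generating function of the skew Cauchy identity with \<open>s ^ j\<close> as its
  variable. The subtraction in the exponent is a true one whenever the weight is nonzero, since then
  \<open>l\<close> is contained in both \<open>m\<close> and \<open>v\<close>.\<close>

lemma skew_cauchy_fps:
  assumes m: "is_partition m" and v: "is_partition v" and j: "j \<ge> 1"
  shows "psum (\<lambda>l. fps_X ^ (j * part_size l) * fps_const (W l m * W l v / W l l)) =
    Bser j * psum (\<lambda>l. fps_X ^ (j * (part_size m + part_size v - part_size l)) * fps_const (W m l * W v l / W l l))"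
proof -
  define h where "h l = part_size m + part_size v - part_size l" for l
  define F1 where "F1 = Abs_fps (\<lambda>n. \<Sum>l\<in>parts_upto n. if part_size l = n then W l m * W l v / W l l else 0)"
  define F2 where "F2 = Abs_fps (\<lambda>n. \<Sum>l\<in>parts_upto n. if h l = n then W m l * W v l / W l l else 0)"
  have sz: "part_size l \<le> part_size m \<and> part_size l \<le> part_size v" if "W m l * W v l / W l l \<noteq> 0" for l
    using that W_size[OF m, of l] W_size[OF v, of l] by auto
  have F1: "fps_nth F1 n = (\<Sum>l | is_partition l \<and> part_size l = n. W l m * W l v / W l l)" for n
    unfolding F1_def fps_nth_Abs_fps
    by (rule sum.mono_neutral_cong_right) (auto simp: finite_parts_upto, auto simp: parts_upto_def)
  have F2: "fps_nth F2 n = (\<Sum>l | is_partition l \<and> part_size l + n = part_size m + part_size v. W m l * W v l / W l l)" for n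
    unfolding F2_def fps_nth_Abs_fps
  proof (rule sum.mono_neutral_cong)
    show "finite {l. is_partition l \<and> part_size l + n = part_size m + part_size v}"
      by (rule finite_subset[OF _ finite_partitions[of "part_size m + part_size v"]]) auto
    fix l
    have c: "W m l * W v l / W l l = 0 \<or> (part_size l \<le> part_size m \<and> part_size l \<le> part_size v)"
      using sz[of l] by blast
    show "W m l * W v l / W l l = 0"
      if "l \<in> {l. is_partition l \<and> part_size l + n = part_size m + part_size v} - parts_upto n"
      using c that by (elim disjE) (auto simp: parts_upto_def)
    show "(if h l = n then W m l * W v l / W l l else 0) = 0"
      if "l \<in> parts_upto n - {l. is_partition l \<and> part_size l + n = part_size m + part_size v}"
      using c that by (elim disjE) (auto simp: parts_upto_def h_def)
    show "l \<in> parts_upto n \<inter> {l. is_partition l \<and> part_size l + n = part_size m + part_size v} \<Longrightarrow>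
        (if h l = n then W m l * W v l / W l l else 0) = W m l * W v l / W l l"
      by (auto simp: h_def)
  qed (rule finite_parts_upto)
  have "F1 = binomial_series * F2"
  proof (rule fps_ext)
    fix n
    have "fps_nth F1 n = (\<Sum>k\<le>n. cauchy_coeff k * (\<Sum>l | is_partition l \<and> part_size l + n = part_size m + part_size v + k.
        W m l * W v l / W l l))"
      unfolding F1 by (rule skew_cauchy[OF m v])
    also have "\<dots> = (\<Sum>k\<le>n. cauchy_coeff k * fps_nth F2 (n - k))"
      unfolding F2 by (intro sum.cong refl arg_cong2[of _ _ _ _ "(*)"] Collect_cong) auto
    finally show "fps_nth F1 n = fps_nth (binomial_series * F2) n"
      by (simp add: fps_mult_nth binomial_series_def cauchy_coeff_eq atLeast0AtMost)
  qed
  moreover have "fps_nth (fps_X ^ j :: 'a fps) 0 = 0" using j by (simp add: fps_X_power_nth)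
  ultimately have "F1 oo fps_X ^ j = Bser j * (F2 oo fps_X ^ j)"
    by (simp add: fps_compose_mult_distrib)
  moreover have "psum (\<lambda>l. fps_X ^ (j * part_size l) * fps_const (W l m * W l v / W l l)) = F1 oo fps_X ^ j"
    unfolding F1_def by (rule psum_X_power[OF j]) simp
  moreover have "psum (\<lambda>l. fps_X ^ (j * h l) * fps_const (W m l * W v l / W l l)) = F2 oo fps_X ^ j"
    unfolding F2_def by (rule psum_X_power[OF j]) (use sz in \<open>force simp: h_def\<close>)
  ultimately show ?thesis by (simp add: h_def)
qed

text \<open>Up to normalisation, \<open>up_sum r l\<close> is the Macdonald polynomial of shape \<open>l\<close> at the \<open>r\<close>
  variables \<open>s ^ k\<close>, \<open>k < r\<close>, and the next lemma is the Cauchy identity with one further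
  variable \<open>s ^ j\<close>.\<close>

fun up_sum :: "nat \<Rightarrow> (nat \<Rightarrow> nat) \<Rightarrow> 'a fps" where
  "up_sum 0 l = (if l = one_row 0 then 1 else 0)"
| "up_sum (Suc r) l = psum (\<lambda>m. fps_X ^ part_size m * (up_sum r m * fps_const (W l m / W m m)))"

lemma principal_cauchy:
  assumes "j \<ge> 1" "is_partition v"
  shows "psum (\<lambda>l. fps_X ^ (j * part_size l) * (up_sum r l * fps_const (W l v / W l l))) =
    (\<Prod>k<r. Bser (j + k)) * fps_X ^ (j * part_size v) * up_sum r v"
  using assms
proof (induction r arbitrary: j v)
  case 0
  have "psum (\<lambda>l. fps_X ^ (j * part_size l) * (up_sum 0 l * fps_const (W l v / W l l)))
      = fps_const (W (one_row 0) v)"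
    by (subst psum_single) (auto simp: partition_one_row W_row_0)
  also have "\<dots> = fps_X ^ (j * part_size v) * up_sum 0 v"
    using interlaced_from_row_0[of v] W_0[of "one_row 0" v] by (auto simp: W_row_0 partition_one_row)
  finally show ?case by simp
next
  case (Suc r)
  note j = Suc.prems(1) and v = Suc.prems(2)
  \<comment> \<open>One power \<open>s ^ n\<close> is split off to secure the divisibility that
    moving factors out of \<open>psum\<close> requires; this is where \<open>j \<ge> 1\<close>
    enters.\<close>
  have X: "fps_X ^ (j * n) = fps_X ^ n * (fps_X ^ ((j - 1) * n) :: 'a fps)" for n
    using j by (cases j) (simp_all add: power_add)
  have "psum (\<lambda>l. fps_X ^ (j * part_size l) * (up_sum (Suc r) l * fps_const (W l v / W l l))) =
      psum (\<lambda>l. psum (\<lambda>m. fps_X ^ (j * part_size l) * fps_const (W l v / W l l) *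
        (fps_X ^ part_size m * (up_sum r m * fps_const (W l m / W m m)))))"
    by (intro psum_cong, subst psum_mult_X) (auto simp: mult_ac)
  also have "\<dots> = psum (\<lambda>m. psum (\<lambda>l. fps_X ^ part_size m * up_sum r m * fps_const (1 / W m m) *
      (fps_X ^ (j * part_size l) * fps_const (W l m * W l v / W l l))))"
  proof (subst psum_swap, intro psum_cong)
    fix m l
    have "fps_const (W l v / W l l) * fps_const (W l m / W m m) =
        fps_const (1 / W m m) * fps_const (W l m * W l v / W l l)"
      by (simp add: mult_ac)
    thus "fps_X ^ (j * part_size l) * fps_const (W l v / W l l) *
        (fps_X ^ part_size m * (up_sum r m * fps_const (W l m / W m m))) =
      fps_X ^ part_size m * up_sum r m * fps_const (1 / W m m) *
      (fps_X ^ (j * part_size l) * fps_const (W l m * W l v / W l l))"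
      by (metis (no_types, opaque_lifting) mult.assoc mult.left_commute)
  qed
  also have "\<dots> = psum (\<lambda>m. fps_X ^ part_size m * up_sum r m * fps_const (1 / W m m) *
      psum (\<lambda>l. fps_X ^ (j * part_size l) * fps_const (W l m * W l v / W l l)))"
    by (intro psum_cong psum_mult_X) (simp only: X mult.assoc)
  also have "\<dots> = psum (\<lambda>m. Bser j * (fps_X ^ part_size m * (up_sum r m * fps_const (1 / W m m) *
      psum (\<lambda>l. fps_X ^ (j * (part_size m + part_size v - part_size l)) * fps_const (W m l * W v l / W l l)))))"
    by (intro psum_cong, subst skew_cauchy_fps[OF _ v j]) (simp_all only: mult_ac)
  also have "\<dots> = Bser j * psum (\<lambda>m. fps_X ^ part_size m * (up_sum r m * fps_const (1 / W m m) *
      psum (\<lambda>l. fps_X ^ (j * (part_size m + part_size v - part_size l)) * fps_const (W m l * W v l / W l l))))"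
    by (rule psum_mult_X) simp
  \<comment> \<open>The exponent
    \<open>part_size m + j * (part_size m + part_size v - part_size l)\<close> regroups as
    \<open>Suc j * part_size m + j * (part_size v - part_size l)\<close>, so the inner sum over
    \<open>m\<close> has the original form with \<open>Suc j\<close> in place of
    \<open>j\<close>.\<close>
  also have "psum (\<lambda>m. fps_X ^ part_size m * (up_sum r m * fps_const (1 / W m m) *
      psum (\<lambda>l. fps_X ^ (j * (part_size m + part_size v - part_size l)) * fps_const (W m l * W v l / W l l))))
    = psum (\<lambda>m. psum (\<lambda>l. fps_X ^ (j * (part_size v - part_size l)) * fps_const (W v l / W l l) *
      (fps_X ^ (Suc j * part_size m) * (up_sum r m * fps_const (W m l / W m m)))))"
  proof (intro psum_cong)
    fix m assume m: "is_partition m"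
    have "fps_X ^ part_size m * (up_sum r m * fps_const (1 / W m m) *
        psum (\<lambda>l. fps_X ^ (j * (part_size m + part_size v - part_size l)) * fps_const (W m l * W v l / W l l))) =
      (fps_X ^ part_size m * (up_sum r m * fps_const (1 / W m m))) *
        psum (\<lambda>l. fps_X ^ (j * (part_size m + part_size v - part_size l)) * fps_const (W m l * W v l / W l l))"
      by (simp only: mult.assoc)
    also have "\<dots> = psum (\<lambda>l. (fps_X ^ part_size m * (up_sum r m * fps_const (1 / W m m))) *
        (fps_X ^ (j * (part_size m + part_size v - part_size l)) * fps_const (W m l * W v l / W l l)))"
    proof (rule psum_mult[symmetric])
      fix l n assume n: "n < part_size l"
      show "fps_nth (fps_X ^ (j * (part_size m + part_size v - part_size l)) * fps_const (W m l * W v l / W l l)) n = 0"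
      proof (cases "W m l * W v l / W l l = 0")
        case False
        hence "part_size l \<le> part_size m" "part_size l \<le> part_size v"
          using W_size[OF m, of l] W_size[OF v, of l] by auto
        hence "n < part_size m + part_size v - part_size l" using n by simp
        also have "\<dots> \<le> j * (part_size m + part_size v - part_size l)" using j by simp
        finally show ?thesis by (rule fps_X_power_mult_small)
      qed simp
    qed
    also have "\<dots> = psum (\<lambda>l. fps_X ^ (j * (part_size v - part_size l)) * fps_const (W v l / W l l) *
      (fps_X ^ (Suc j * part_size m) * (up_sum r m * fps_const (W m l / W m m))))"
    proof (rule psum_cong)
      fix l
      show "(fps_X ^ part_size m * (up_sum r m * fps_const (1 / W m m))) *
        (fps_X ^ (j * (part_size m + part_size v - part_size l)) * fps_const (W m l * W v l / W l l)) =
        fps_X ^ (j * (part_size v - part_size l)) * fps_const (W v l / W l l) *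
      (fps_X ^ (Suc j * part_size m) * (up_sum r m * fps_const (W m l / W m m)))"
      proof (cases "W m l * W v l = 0")
        case False
        hence "part_size l \<le> part_size v" using W_size[OF v, of l] by auto
        hence "j * (part_size m + part_size v - part_size l) = j * part_size m + j * (part_size v - part_size l)"
          by (metis Nat.add_diff_assoc distrib_left)
        hence X: "fps_X ^ (j * (part_size m + part_size v - part_size l)) =
            fps_X ^ (j * part_size m) * (fps_X ^ (j * (part_size v - part_size l)) :: 'a fps)"
          by (simp add: power_add)
        have C: "fps_const (W m l * W v l / W l l) * fps_const (1 / W m m) =
            fps_const (W v l / W l l) * fps_const (W m l / W m m)" by (simp add: mult_ac)
        have X': "fps_X ^ (Suc j * part_size m) = fps_X ^ part_size m * (fps_X ^ (j * part_size m) :: 'a fps)"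
          by (simp add: power_add)
        have "a * (b * c) * ((d * e) * f) = e * (a * d * b) * (f * c)" for a b c d e f :: "'a fps"
          by (simp only: mult_ac)
        hence "(fps_X ^ part_size m * (up_sum r m * fps_const (1 / W m m))) *
            (fps_X ^ (j * (part_size m + part_size v - part_size l)) * fps_const (W m l * W v l / W l l)) =
          fps_X ^ (j * (part_size v - part_size l)) * (fps_X ^ (Suc j * part_size m) * up_sum r m) *
            (fps_const (W m l * W v l / W l l) * fps_const (1 / W m m))"
          unfolding X X' by blast
        thus ?thesis unfolding C by (simp only: mult_ac)
      qed auto
    qed
    finally show "fps_X ^ part_size m * (up_sum r m * fps_const (1 / W m m) *
        psum (\<lambda>l. fps_X ^ (j * (part_size m + part_size v - part_size l)) * fps_const (W m l * W v l / W l l))) =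
      psum (\<lambda>l. fps_X ^ (j * (part_size v - part_size l)) * fps_const (W v l / W l l) *
      (fps_X ^ (Suc j * part_size m) * (up_sum r m * fps_const (W m l / W m m))))" .
  qed
  also have "\<dots> = psum (\<lambda>l. fps_X ^ (j * (part_size v - part_size l)) * fps_const (W v l / W l l) *
      psum (\<lambda>m. fps_X ^ (Suc j * part_size m) * (up_sum r m * fps_const (W m l / W m m))))"
    by (subst psum_swap, intro psum_cong psum_mult_X) (simp only: mult_Suc power_add mult.assoc)
  also have "\<dots> = psum (\<lambda>l. (\<Prod>k<r. Bser (Suc j + k)) * fps_X ^ (j * part_size v) *
      (fps_X ^ part_size l * (up_sum r l * fps_const (W v l / W l l))))"
  proof (rule psum_cong)
    fix l assume l: "is_partition l"
    have IH: "psum (\<lambda>m. fps_X ^ (Suc j * part_size m) * (up_sum r m * fps_const (W m l / W m m))) =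
        (\<Prod>k<r. Bser (Suc j + k)) * fps_X ^ (Suc j * part_size l) * up_sum r l"
      by (rule Suc.IH) (use l in auto)
    show "fps_X ^ (j * (part_size v - part_size l)) * fps_const (W v l / W l l) *
      psum (\<lambda>m. fps_X ^ (Suc j * part_size m) * (up_sum r m * fps_const (W m l / W m m))) =
      (\<Prod>k<r. Bser (Suc j + k)) * fps_X ^ (j * part_size v) *
      (fps_X ^ part_size l * (up_sum r l * fps_const (W v l / W l l)))"
    proof (cases "W v l = 0")
      case False
      hence "part_size l \<le> part_size v" using W_size[OF v, of l] by auto
      hence "j * (part_size v - part_size l) + Suc j * part_size l = j * part_size v + part_size l"
        by (simp add: diff_mult_distrib2)
      hence X: "fps_X ^ (j * (part_size v - part_size l)) * fps_X ^ (Suc j * part_size l) =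
          (fps_X ^ (j * part_size v) * fps_X ^ part_size l :: 'a fps)"
        by (metis power_add)
      have "a * b * (c * d * e) = c * (a * d) * (e * b)" for a b c d e :: "'a fps"
        by (simp only: mult_ac)
      from this[of "fps_X ^ (j * (part_size v - part_size l))" "fps_const (W v l / W l l)"
          "\<Prod>k<r. Bser (Suc j + k)" "fps_X ^ (Suc j * part_size l)" "up_sum r l"]
      show ?thesis unfolding IH X by (simp only: mult.assoc)
    qed simp
  qed
  also have "\<dots> = (\<Prod>k<r. Bser (Suc j + k)) * fps_X ^ (j * part_size v) * up_sum (Suc r) v"
    unfolding up_sum.simps by (rule psum_mult_X) simp
  also have "Bser j * ((\<Prod>k<r. Bser (Suc j + k)) * fps_X ^ (j * part_size v) * up_sum (Suc r) v) =
      (\<Prod>k<Suc r. Bser (j + k)) * fps_X ^ (j * part_size v) * up_sum (Suc r) v"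
    unfolding prod.lessThan_Suc_shift by (simp only: add_0_right add_Suc_right add_Suc mult.assoc)
  finally show ?case .
qed

lemma up_sum_row_0: "up_sum r (one_row 0) = 1"
proof (induction r)
  case (Suc r)
  have "up_sum (Suc r) (one_row 0) = fps_X ^ part_size (one_row 0) * (up_sum r (one_row 0) * fps_const (W (one_row 0) (one_row 0) / W (one_row 0) (one_row 0)))"
    unfolding up_sum.simps
    by (rule psum_single) (use interlaced_from_row_0 W_0 in force)
  thus ?case by (simp add: Suc W_row_0 partition_one_row)
qed simp

section \<open>Weighted chains of partitions\<close>

definition step_weight :: "nat \<Rightarrow> nat \<Rightarrow> (nat \<Rightarrow> nat) \<Rightarrow> (nat \<Rightarrow> nat) \<Rightarrow> 'a" where
  "step_weight r k l m = (if k < r then W m l else W l m) / W l l"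

text \<open>Transfer-matrix form of the sum over chains from the empty partition; the last slice is
  not yet weighted by its size.\<close>

fun path_sum :: "nat \<Rightarrow> nat \<Rightarrow> (nat \<Rightarrow> nat) \<Rightarrow> 'a fps" where
  "path_sum r 0 l = (if l = one_row 0 then 1 else 0)"
| "path_sum r (Suc k) m = psum (\<lambda>l. fps_X ^ part_size l * (path_sum r k l * fps_const (step_weight r k l m)))"

lemma path_sum_up: "k \<le> r \<Longrightarrow> path_sum r k l = up_sum k l"
  by (induction k arbitrary: l) (auto simp: step_weight_def)

text \<open>The principal Cauchy identity at \<open>Suc j\<close> absorbs one decreasing step and
  contributes the factors of one column of boxes; the weights of the slices passed so far have
  accumulated to \<open>s ^ (j * part_size v)\<close>.\<close>

lemma path_sum_down:
  "is_partition v \<Longrightarrow> path_sum r (r + j) v =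
    (\<Prod>i=1..j. \<Prod>k<r. Bser (i + k)) * fps_X ^ (j * part_size v) * up_sum r v"
proof (induction j arbitrary: v)
  case 0
  thus ?case by (simp add: path_sum_up)
next
  case (Suc j)
  have "path_sum r (r + Suc j) v =
      psum (\<lambda>l. fps_X ^ part_size l * (path_sum r (r + j) l * fps_const (W l v / W l l)))"
    by (simp add: step_weight_def)
  also have "\<dots> = psum (\<lambda>l. (\<Prod>i=1..j. \<Prod>k<r. Bser (i + k)) *
      (fps_X ^ (Suc j * part_size l) * (up_sum r l * fps_const (W l v / W l l))))"
    by (intro psum_cong) (simp only: Suc.IH mult_Suc power_add mult_ac)
  also have "\<dots> = (\<Prod>i=1..j. \<Prod>k<r. Bser (i + k)) *
      psum (\<lambda>l. fps_X ^ (Suc j * part_size l) * (up_sum r l * fps_const (W l v / W l l)))"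
    by (rule psum_mult_X) (simp only: mult_Suc power_add mult.assoc)
  also have "\<dots> = (\<Prod>i=1..Suc j. \<Prod>k<r. Bser (i + k)) * fps_X ^ (Suc j * part_size v) * up_sum r v"
    using Suc.prems by (subst principal_cauchy) (auto simp: mult_ac)
  finally show ?case .
qed

theorem path_sum_closed: "path_sum r (r + c) (one_row 0) = (\<Prod>i=1..r. \<Prod>j=1..c. Bser (i + j - 1))"
proof -
  have "path_sum r (r + c) (one_row 0) = (\<Prod>j=1..c. \<Prod>k<r. Bser (j + k))"
    by (simp add: path_sum_down partition_one_row up_sum_row_0)
  also have "\<dots> = (\<Prod>j=1..c. \<Prod>i=1..r. Bser (i + j - 1))"
    by (intro prod.cong refl prod.reindex_bij_witness[of _ "\<lambda>i. i - 1" Suc]) (auto simp: add.commute)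
  also have "\<dots> = (\<Prod>i=1..r. \<Prod>j=1..c. Bser (i + j - 1))" by (rule prod.swap)
  finally show ?thesis .
qed

text \<open>Values beyond index \<open>k\<close> are fixed, so that each chain is one function; the
  size bound \<open>n\<close> makes the set finite.\<close>

definition paths :: "nat \<Rightarrow> nat \<Rightarrow> (nat \<Rightarrow> nat) \<Rightarrow> (nat \<Rightarrow> nat \<Rightarrow> nat) set" where
  "paths n k m = {\<sigma>. \<sigma> 0 = one_row 0 \<and> \<sigma> k = m \<and> (\<forall>j. if j \<le> k then \<sigma> j \<in> parts_upto n else \<sigma> j = one_row 0)}"

definition path_weight :: "nat \<Rightarrow> nat \<Rightarrow> (nat \<Rightarrow> nat \<Rightarrow> nat) \<Rightarrow> 'a" where
  "path_weight r k \<sigma> = (\<Prod>j<k. step_weight r j (\<sigma> j) (\<sigma> (Suc j)))"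

lemma finite_paths: "finite (paths n k m)"
proof (rule finite_subset)
  show "paths n k m \<subseteq> {f. \<forall>x. (x \<in> {..k} \<longrightarrow> f x \<in> parts_upto n) \<and> (x \<notin> {..k} \<longrightarrow> f x = one_row 0)}"
    by (auto simp: paths_def split: if_splits)
qed (rule finite_set_of_finite_funs; simp add: finite_parts_upto)

text \<open>The bound \<open>n\<close> on the slices is kept apart from the coefficient index
  \<open>i\<close>, because the recursion lowers \<open>i\<close> by the size of each slice. Slices
  larger than \<open>i\<close> contribute 0.\<close>

lemma path_sum_nth:
  assumes "m \<in> parts_upto n" "i \<le> n"
  shows "fps_nth (path_sum r k m) i =
    (\<Sum>\<sigma>\<in>paths n k m. if (\<Sum>j<k. part_size (\<sigma> j)) = i then path_weight r k \<sigma> else 0)"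
  using assms
proof (induction k arbitrary: m i)
  case 0
  have r0: "one_row 0 \<in> parts_upto n" by (simp add: parts_upto_def partition_one_row)
  have "paths n 0 m = (if m = one_row 0 then {\<lambda>_. one_row 0} else {})"
  proof (cases "m = one_row 0")
    case True
    have "\<sigma> = (\<lambda>_. one_row 0)" if "\<sigma> \<in> paths n 0 m" for \<sigma>
    proof
      fix j show "\<sigma> j = one_row 0" using that by (cases "j = 0") (auto simp: paths_def split: if_splits)
    qed
    moreover have "(\<lambda>_. one_row 0) \<in> paths n 0 m" using True r0 by (simp add: paths_def)
    ultimately have "paths n 0 m = {\<lambda>_. one_row 0}" by blast
    thus ?thesis using True by simp
  qed (auto simp: paths_def)
  thus ?case by (auto simp: path_weight_def)
next
  case (Suc k)
  let ?G = "\<lambda>l \<sigma>. if (\<Sum>j<k. part_size (\<sigma> j)) + part_size l = i then path_weight r k \<sigma> * step_weight r k l m else 0"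
  have "fps_nth (path_sum r (Suc k) m) i =
      (\<Sum>l\<in>parts_upto i. fps_nth (path_sum r k l) (i - part_size l) * step_weight r k l m)"
    unfolding path_sum.simps psum_nth
    by (intro sum.cong refl) (auto simp: fps_X_power_mult_nth parts_upto_def)
  also have "\<dots> = (\<Sum>l\<in>parts_upto i. \<Sum>\<sigma>\<in>paths n k l. ?G l \<sigma>)"
  proof (rule sum.cong)
    fix l assume l: "l \<in> parts_upto i"
    hence ln: "l \<in> parts_upto n" using parts_upto_mono[OF Suc.prems(2)] by auto
    have li: "part_size l \<le> i" using l by (simp add: parts_upto_def)
    show "fps_nth (path_sum r k l) (i - part_size l) * step_weight r k l m = (\<Sum>\<sigma>\<in>paths n k l. ?G l \<sigma>)"
      using Suc.IH[OF ln, of "i - part_size l"] Suc.prems(2) li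
      by (simp add: sum_distrib_right) (auto intro!: sum.cong)
  qed simp
  also have "\<dots> = (\<Sum>l\<in>parts_upto n. \<Sum>\<sigma>\<in>paths n k l. ?G l \<sigma>)"
    by (rule sum.mono_neutral_left)
      (use finite_parts_upto parts_upto_mono[OF Suc.prems(2)] in \<open>auto intro!: sum.neutral simp: parts_upto_def split: if_splits\<close>)
  also have "\<dots> = (\<Sum>(l, \<sigma>)\<in>(SIGMA l:parts_upto n. paths n k l). ?G l \<sigma>)"
    by (rule sum.Sigma) (auto simp: finite_parts_upto finite_paths)
  also have "\<dots> = (\<Sum>\<sigma>\<in>paths n (Suc k) m. if (\<Sum>j<Suc k. part_size (\<sigma> j)) = i then path_weight r (Suc k) \<sigma> else 0)"
  proof (rule sum.reindex_bij_witness[of _ "\<lambda>\<sigma>. (\<sigma> k, \<sigma>(Suc k := one_row 0))" "\<lambda>(l, \<sigma>). \<sigma>(Suc k := m)"])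
    fix x assume x: "x \<in> (SIGMA l:parts_upto n. paths n k l)"
    obtain l \<sigma> where ls: "x = (l, \<sigma>)" "l \<in> parts_upto n" "\<sigma> \<in> paths n k l" using x by auto
    have "\<sigma> k = l" "\<sigma> (Suc k) = one_row 0" using ls(3) by (auto simp: paths_def dest: spec[of _ "Suc k"])
    thus "(\<lambda>\<sigma>. (\<sigma> k, \<sigma>(Suc k := one_row 0))) ((\<lambda>(l, \<sigma>). \<sigma>(Suc k := m)) x) = x"
      by (auto simp: ls)
    show "(\<lambda>(l, \<sigma>). \<sigma>(Suc k := m)) x \<in> paths n (Suc k) m"
      using ls Suc.prems(1) by (auto simp: paths_def le_Suc_eq)
    have w: "path_weight r (Suc k) (\<sigma>(Suc k := m)) = path_weight r k \<sigma> * step_weight r k l m"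
      using \<open>\<sigma> k = l\<close> by (simp add: path_weight_def)
    have s: "(\<Sum>j<Suc k. part_size ((\<sigma>(Suc k := m)) j)) = (\<Sum>j<k. part_size (\<sigma> j)) + part_size l"
      using \<open>\<sigma> k = l\<close> by simp
    show "(if (\<Sum>j<Suc k. part_size (((\<lambda>(l, \<sigma>). \<sigma>(Suc k := m)) x) j)) = i
         then path_weight r (Suc k) ((\<lambda>(l, \<sigma>). \<sigma>(Suc k := m)) x) else 0) = (case x of (l, \<sigma>) \<Rightarrow> ?G l \<sigma>)"
      unfolding ls prod.case w s ..
  next
    fix \<sigma> assume s: "\<sigma> \<in> paths n (Suc k) m"
    show "(\<lambda>(l, \<sigma>). \<sigma>(Suc k := m)) (\<sigma> k, \<sigma>(Suc k := one_row 0)) = \<sigma>"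
      using s by (auto simp: paths_def)
    show "(\<sigma> k, \<sigma>(Suc k := one_row 0)) \<in> (SIGMA l:parts_upto n. paths n k l)"
      using s by (auto simp: paths_def split: if_splits)
  qed
  finally show ?case .
qed

end

section \<open>Diagonal slices of plane partitions\<close>

text \<open>In this topology each coefficient has to become constant, so it suffices that every
  exponent occurs finitely often.\<close>

lemma fps_has_sum_X_powers:
  fixes c :: "'i \<Rightarrow> 'a::comm_ring_1"
  assumes fin: "\<And>n. finite {x \<in> A. w x = n}"
  shows "((\<lambda>x. fps_const (c x) * fps_X ^ w x) has_sum
    Abs_fps (\<lambda>n. \<Sum>x\<in>{x \<in> A. w x = n}. c x)) A"
  unfolding has_sum_def
proof (rule tendsto_fpsI)
  fix n
  have "fps_nth (\<Sum>x\<in>Y. fps_const (c x) * fps_X ^ w x) n = (\<Sum>x\<in>{x \<in> A. w x = n}. c x)"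
    if "finite Y" "{x \<in> A. w x = n} \<subseteq> Y" "Y \<subseteq> A" for Y
  proof -
    have "fps_nth (fps_const (c x) * fps_X ^ w x) n = (if w x = n then c x else 0)" for x
      by (simp add: fps_X_power_nth)
    hence "fps_nth (\<Sum>x\<in>Y. fps_const (c x) * fps_X ^ w x) n = (\<Sum>x\<in>Y. if w x = n then c x else 0)"
      by (simp only: fps_sum_nth)
    also have "\<dots> = (\<Sum>x\<in>{x \<in> A. w x = n}. c x)"
      using that by (intro sum.mono_neutral_cong_right) auto
    finally show ?thesis .
  qed
  thus "\<forall>\<^sub>F Y in finite_subsets_at_top A. fps_nth (\<Sum>x\<in>Y. fps_const (c x) * fps_X ^ w x) n =
      fps_nth (Abs_fps (\<lambda>n. \<Sum>x\<in>{x \<in> A. w x = n}. c x)) n"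
    unfolding eventually_finite_subsets_at_top fps_nth_Abs_fps
    by (intro exI[of _ "{x \<in> A. w x = n}"]) (use fin in auto)
qed

lemma plane_partitionD:
  assumes "\<pi> \<in> plane_partitions"
  shows "\<pi> i j > 0 \<Longrightarrow> i \<ge> 1 \<and> j \<ge> 1" "finite (pp_support \<pi>)"
    "i \<ge> 1 \<Longrightarrow> j \<ge> 1 \<Longrightarrow> \<pi> (Suc i) j \<le> \<pi> i j" "i \<ge> 1 \<Longrightarrow> j \<ge> 1 \<Longrightarrow> \<pi> i (Suc j) \<le> \<pi> i j"
  using assms unfolding plane_partitions_def pp_support_def
  by (auto, (metis Suc_leI gr0I not_less_zero)+)

lemma plane_partition_mono:
  assumes "\<pi> \<in> plane_partitions" "1 \<le> a" "a \<le> i" "1 \<le> b" "b \<le> j"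
  shows "\<pi> i j \<le> \<pi> a b"
proof -
  have "\<pi> i j \<le> \<pi> a j"
    using assms(3)
  proof (induction i rule: dec_induct)
    case (step n)
    have "\<pi> (Suc n) j \<le> \<pi> n j" using assms step by (intro plane_partitionD(3)) auto
    thus ?case using step.IH by simp
  qed simp
  also have "\<pi> a j \<le> \<pi> a b"
    using assms(5)
  proof (induction j rule: dec_induct)
    case (step n)
    have "\<pi> a (Suc n) \<le> \<pi> a n" using assms step by (intro plane_partitionD(4)) auto
    thus ?case using step.IH by simp
  qed simp
  finally show ?thesis .
qed

lemma sum_image_le_pp_weight:
  assumes "\<pi> \<in> plane_partitions" "finite B" "B \<subseteq> pp_support \<pi>"
  shows "card B \<le> pp_weight \<pi>"
proof -
  have "card B = (\<Sum>(i, j)\<in>B. 1)" by simp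
  also have "\<dots> \<le> (\<Sum>(i, j)\<in>B. \<pi> i j)"
    using assms(3) by (intro sum_mono) (auto simp: pp_support_def)
  also have "\<dots> \<le> pp_weight \<pi>"
    unfolding pp_weight_def using assms plane_partitionD(2) by (intro sum_mono2) auto
  finally show ?thesis .
qed

text \<open>A positive entry forces positive entries above it in its column and to its left in its
  row, so the weight bounds both coordinates.\<close>

lemma plane_partition_in_square:
  assumes "\<pi> \<in> plane_partitions" "pp_weight \<pi> \<le> n"
  shows "\<pi> \<in> plane_partitions_in n n" and "\<pi> i j \<le> n"
proof -
  have "i \<le> n \<and> j \<le> n" if pos: "\<pi> i j > 0" for i j
  proof
    have ij: "i \<ge> 1" "j \<ge> 1" using plane_partitionD(1)[OF assms(1) pos] by auto
    have "(\<lambda>a. (a, j)) ` {1..i} \<subseteq> pp_support \<pi>"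
      using plane_partition_mono[OF assms(1), of _ i j j] ij pos by (fastforce simp: pp_support_def)
    from sum_image_le_pp_weight[OF assms(1) _ this] show "i \<le> n"
      using assms(2) by (simp add: card_image inj_on_def)
    have "(\<lambda>a. (i, a)) ` {1..j} \<subseteq> pp_support \<pi>"
      using plane_partition_mono[OF assms(1), of i i _ j] ij pos by (fastforce simp: pp_support_def)
    from sum_image_le_pp_weight[OF assms(1) _ this] show "j \<le> n"
      using assms(2) by (simp add: card_image inj_on_def)
  qed
  thus "\<pi> \<in> plane_partitions_in n n"
    using assms(1) unfolding plane_partitions_in_def by (auto; meson not_less neq0_conv)
  show "\<pi> i j \<le> n"
  proof (cases "\<pi> i j = 0")
    case False
    hence "\<pi> i j \<le> pp_weight \<pi>"
      unfolding pp_weight_def using plane_partitionD(2)[OF assms(1)]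
      by (intro order_trans[OF _ member_le_sum[of "(i, j)" _ "\<lambda>(i, j). \<pi> i j"]]) (auto simp: pp_support_def)
    thus ?thesis using assms(2) by simp
  qed simp
qed

lemma finite_plane_partitions: "finite {\<pi> \<in> plane_partitions. pp_weight \<pi> = n}"
proof (rule finite_subset)
  let ?B = "{f :: nat \<Rightarrow> nat. \<forall>x. (x \<in> {..n} \<longrightarrow> f x \<in> {..n}) \<and> (x \<notin> {..n} \<longrightarrow> f x = 0)}"
  let ?C = "{f :: nat \<Rightarrow> nat \<Rightarrow> nat. \<forall>x. (x \<in> {..n} \<longrightarrow> f x \<in> ?B) \<and> (x \<notin> {..n} \<longrightarrow> f x = (\<lambda>_. 0))}"
  show "finite ?C" by (intro finite_set_of_finite_funs) simp_all
  show "{\<pi> \<in> plane_partitions. pp_weight \<pi> = n} \<subseteq> ?C"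
  proof
    fix \<pi> assume "\<pi> \<in> {\<pi> \<in> plane_partitions. pp_weight \<pi> = n}"
    hence \<pi>: "\<pi> \<in> plane_partitions" "pp_weight \<pi> \<le> n" by auto
    have "\<pi> i j \<le> n" for i j by (rule plane_partition_in_square(2)[OF \<pi>])
    moreover have "\<pi> i j = 0" if "i > n \<or> j > n" for i j
      using plane_partition_in_square(1)[OF \<pi>] that by (auto simp: plane_partitions_in_def)
    ultimately show "\<pi> \<in> ?C" by auto
  qed
qed

text \<open>The diagonal slices of an array with \<open>r\<close> rows are numbered from the bottom left, so that
  slice \<open>r\<close> is the main diagonal and slice \<open>k\<close> starts at the box \<open>(1 + (r - k), 1 + (k - r))\<close>,
  with truncated subtraction.\<close>

definition slice :: "nat \<Rightarrow> (nat \<Rightarrow> nat \<Rightarrow> nat) \<Rightarrow> nat \<Rightarrow> nat \<Rightarrow> nat" where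
  "slice r \<pi> k i = \<pi> (i + 1 + (r - k)) (i + 1 + (k - r))"

definition unslice :: "nat \<Rightarrow> nat \<Rightarrow> (nat \<Rightarrow> nat \<Rightarrow> nat) \<Rightarrow> nat \<Rightarrow> nat \<Rightarrow> nat" where
  "unslice r c \<sigma> i j = (if 1 \<le> i \<and> i \<le> r \<and> 1 \<le> j \<and> j \<le> c then \<sigma> (r + j - i) (min i j - 1) else 0)"

definition slice_paths :: "nat \<Rightarrow> nat \<Rightarrow> (nat \<Rightarrow> nat \<Rightarrow> nat) set" where
  "slice_paths r c = {\<sigma>. (\<forall>k. is_partition (\<sigma> k)) \<and> \<sigma> 0 = one_row 0 \<and> (\<forall>k\<ge>r + c. \<sigma> k = one_row 0) \<and>
     (\<forall>k<r. interlaced (\<sigma> (Suc k)) (\<sigma> k)) \<and> (\<forall>k. r \<le> k \<and> k < r + c \<longrightarrow> interlaced (\<sigma> k) (\<sigma> (Suc k)))}"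

lemma one_row_0_apply [simp]: "one_row 0 i = 0"
  by (simp add: one_row_def)

lemma slice_in:
  assumes "\<pi> \<in> plane_partitions_in r c"
  shows "slice r \<pi> \<in> slice_paths r c"
proof -
  have out: "\<pi> i j = 0" if "i > r \<or> j > c" for i j
    using assms that by (auto simp: plane_partitions_in_def)
  have pp: "\<pi> \<in> plane_partitions" using assms by (simp add: plane_partitions_in_def)
  note mono = plane_partition_mono[OF pp]
  have "zero_from r (slice r \<pi> k)" for k
    by (auto simp: zero_from_def slice_def intro!: out)
  moreover have "decseq (slice r \<pi> k)" for k
    by (rule decseq_SucI) (auto simp: slice_def intro!: mono)
  ultimately have "is_partition (slice r \<pi> k)" for k by (auto simp: is_partition_def)
  moreover have "slice r \<pi> 0 = one_row 0"
    by (rule ext) (auto simp: slice_def intro!: out)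
  moreover have "slice r \<pi> k = one_row 0" if "k \<ge> r + c" for k
    by (rule ext) (use that in \<open>auto simp: slice_def intro!: out\<close>)
  moreover have "interlaced (slice r \<pi> (Suc k)) (slice r \<pi> k)" if "k < r" for k
    using that by (auto simp: interlaced_def slice_def intro!: mono)
  moreover have "interlaced (slice r \<pi> k) (slice r \<pi> (Suc k))" if "r \<le> k" for k
    using that by (auto simp: interlaced_def slice_def intro!: mono)
  ultimately show ?thesis by (simp add: slice_paths_def)
qed

lemma unslice_slice:
  assumes "\<pi> \<in> plane_partitions_in r c"
  shows "unslice r c (slice r \<pi>) = \<pi>"
proof (intro ext)
  fix i j
  show "unslice r c (slice r \<pi>) i j = \<pi> i j"
  proof (cases "1 \<le> i \<and> i \<le> r \<and> 1 \<le> j \<and> j \<le> c")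
    case True
    have "min i j - 1 + 1 + (r - (r + j - i)) = i" "min i j - 1 + 1 + (r + j - i - r) = j"
      using True by (auto simp: min_def)
    moreover have "unslice r c (slice r \<pi>) i j = slice r \<pi> (r + j - i) (min i j - 1)"
      using True by (simp add: unslice_def)
    ultimately show ?thesis by (simp only: slice_def)
  next
    case False
    have "\<pi> i j = 0"
    proof (rule ccontr)
      assume nz: "\<pi> i j \<noteq> 0"
      hence "1 \<le> i" "1 \<le> j" using assms plane_partitionD(1)[of \<pi> i j] by (auto simp: plane_partitions_in_def)
      moreover have "i \<le> r" "j \<le> c" using assms nz by (auto simp: plane_partitions_in_def not_less[symmetric])
      ultimately show False using False by simp
    qed
    thus ?thesis using False by (simp only: unslice_def if_False)
  qed
qed

text \<open>Interlacing lets the number of parts grow by at most one per step, which gives a bound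
  counted from either end. The other two bounds come from containment in the main diagonal slice.
  Together they say that no slice leaves the \<open>r\<close> by \<open>c\<close> rectangle.\<close>

lemma slice_paths_zero:
  assumes "\<sigma> \<in> slice_paths r c"
  shows "k \<le> r \<Longrightarrow> zero_from k (\<sigma> k)" "j \<le> c \<Longrightarrow> zero_from (c - j) (\<sigma> (r + j))"
    "k \<le> r \<Longrightarrow> zero_from c (\<sigma> k)" "j \<le> c \<Longrightarrow> zero_from r (\<sigma> (r + j))"
proof -
  have up: "interlaced (\<sigma> (Suc k)) (\<sigma> k)" if "k < r" for k
    using assms that by (simp add: slice_paths_def)
  have down: "interlaced (\<sigma> (r + j)) (\<sigma> (r + Suc j))" if "j < c" for j
    using assms that by (simp add: slice_paths_def)
  have ends: "\<sigma> 0 = one_row 0" "\<sigma> (r + c) = one_row 0" using assms by (simp_all add: slice_paths_def)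
  show 1: "zero_from k (\<sigma> k)" if "k \<le> r" for k
    using that
  proof (induction k)
    case (Suc k)
    hence z: "zero_from k (\<sigma> k)" by simp
    have il: "interlaced (\<sigma> (Suc k)) (\<sigma> k)" using Suc.prems by (intro up) simp
    show ?case
      unfolding zero_from_def
    proof (intro allI impI)
      fix i assume "Suc k \<le> i"
      then obtain i' where "i = Suc i'" "k \<le> i'" by (cases i) auto
      thus "\<sigma> (Suc k) i = 0" using il z by (auto simp: interlaced_def zero_from_def dest!: spec[of _ i'])
    qed
  qed (simp add: ends zero_from_def)
  show 2: "zero_from (c - j) (\<sigma> (r + j))" if "j \<le> c" for j
    using that
  proof (induction j rule: inc_induct)
    case (step j)
    have il: "interlaced (\<sigma> (r + j)) (\<sigma> (r + Suc j))" using step by (intro down)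
    show ?case
      unfolding zero_from_def
    proof (intro allI impI)
      fix i assume "c - j \<le> i"
      then obtain i' where "i = Suc i'" "c - Suc j \<le> i'" using step by (cases i) auto
      thus "\<sigma> (r + j) i = 0" using il step.IH by (auto simp: interlaced_def zero_from_def dest!: spec[of _ i'])
    qed
  qed (simp add: ends zero_from_def)
  show "zero_from c (\<sigma> k)" if "k \<le> r"
    using that
  proof (induction k rule: inc_induct)
    case base
    show ?case using 2[of 0] by simp
  next
    case (step k)
    show ?case by (rule zero_from_interlaced[OF up step.IH]) (use step in simp)
  qed
  show "zero_from r (\<sigma> (r + j))" if "j \<le> c"
    using that
  proof (induction j)
    case 0
    show ?case using 1[of r] by simp
  next
    case (Suc j)
    show ?case by (rule zero_from_interlaced[OF down]) (use Suc in auto)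
  qed
qed

lemma slice_unslice:
  assumes "\<sigma> \<in> slice_paths r c"
  shows "slice r (unslice r c \<sigma>) = \<sigma>"
proof (intro ext)
  fix k i
  define a where "a = i + 1 + (r - k)"
  define b where "b = i + 1 + (k - r)"
  have s: "slice r (unslice r c \<sigma>) k i = unslice r c \<sigma> a b" by (simp only: slice_def a_def b_def)
  show "slice r (unslice r c \<sigma>) k i = \<sigma> k i"
  proof (cases "a \<le> r \<and> b \<le> c")
    case True
    have "r + b - a = k" "min a b - 1 = i" using True by (auto simp: a_def b_def)
    moreover have "1 \<le> a" "1 \<le> b" by (auto simp: a_def b_def)
    ultimately show ?thesis using True by (simp add: s unslice_def)
  next
    case False
    have "\<sigma> k i = 0"
    proof (cases "k \<le> r")
      case True
      hence "k \<le> i \<or> c \<le> i" using False by (auto simp: a_def b_def)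
      thus ?thesis using slice_paths_zero(1,3)[OF assms True] by (auto simp: zero_from_def)
    next
      case k: False
      show ?thesis
      proof (cases "k \<le> r + c")
        case True
        then obtain j where j: "k = r + j" "j \<le> c" using k by (metis add_le_cancel_left le_Suc_ex nat_le_linear)
        have "r \<le> i \<or> c - j \<le> i" using False k j by (auto simp: a_def b_def)
        thus ?thesis using slice_paths_zero(2,4)[OF assms j(2)] j(1) by (auto simp: zero_from_def)
      next
        case False
        hence "\<sigma> k = one_row 0" using assms by (simp add: slice_paths_def)
        thus ?thesis by simp
      qed
    qed
    thus ?thesis using False by (auto simp: s unslice_def)
  qed
qed

lemma unslice_in:
  assumes "\<sigma> \<in> slice_paths r c"
  shows "unslice r c \<sigma> \<in> plane_partitions_in r c"
proof -
  let ?p = "unslice r c \<sigma>"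
  have up: "\<sigma> k i \<le> \<sigma> (Suc k) i" "\<sigma> (Suc k) (Suc i) \<le> \<sigma> k i" if "k < r" for k i
    using assms that by (auto simp: slice_paths_def interlaced_def)
  have down: "\<sigma> (Suc k) i \<le> \<sigma> k i" "\<sigma> k (Suc i) \<le> \<sigma> (Suc k) i" if "r \<le> k" "k < r + c" for k i
    using assms that by (auto simp: slice_paths_def interlaced_def)
  have 1: "?p (Suc i) j \<le> ?p i j" if ij: "i \<ge> 1" "j \<ge> 1" for i j
  proof (cases "Suc i \<le> r \<and> j \<le> c")
    case True
    define k where "k = r + j - Suc i"
    have k: "r + j - i = Suc k" using True unfolding k_def by arith
    show ?thesis
    proof (cases "k < r")
      case kr: True
      hence "min (Suc i) j - 1 = min i j - 1" using True by (auto simp: k_def)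
      thus ?thesis using True ij up(1)[OF kr] by (simp add: unslice_def k_def[symmetric] k)
    next
      case False
      hence "min (Suc i) j - 1 = i" "min i j - 1 = i - 1" "k < r + c"
        using True ij by (auto simp: k_def)
      thus ?thesis using True ij down(2)[of k "i - 1"] False by (simp add: unslice_def k_def[symmetric] k)
    qed
  qed (auto simp: unslice_def)
  have 2: "?p i (Suc j) \<le> ?p i j" if ij: "i \<ge> 1" "j \<ge> 1" for i j
  proof (cases "i \<le> r \<and> Suc j \<le> c")
    case True
    define k where "k = r + j - i"
    have k: "Suc (r + j) - i = Suc k" using True unfolding k_def by arith
    show ?thesis
    proof (cases "k < r")
      case kr: True
      hence "min i (Suc j) - 1 = j" "min i j - 1 = j - 1" using True ij by (auto simp: k_def)
      thus ?thesis using True ij up(2)[OF kr, of "j - 1"] by (simp add: unslice_def k_def[symmetric] k)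
    next
      case False
      hence "min i (Suc j) - 1 = min i j - 1" "k < r + c" using True ij by (auto simp: k_def)
      thus ?thesis using True ij down(1)[of k] False by (simp add: unslice_def k_def[symmetric] k)
    qed
  qed (auto simp: unslice_def)
  have "finite {(i, j). ?p i j > 0}"
    by (rule finite_subset[of _ "{..r} \<times> {..c}"]) (auto simp: unslice_def split: if_splits)
  moreover have "?p i j = 0" if "i = 0 \<or> j = 0 \<or> i > r \<or> j > c" for i j
    using that by (auto simp: unslice_def)
  ultimately show ?thesis
    using 1 2 by (auto simp: plane_partitions_in_def plane_partitions_def)
qed

lemma slice_box_inj: "inj (\<lambda>(k, p). (p + 1 + (r - k), p + 1 + (k - r)) :: nat \<times> nat)"
  by (auto simp: inj_on_def)

lemma pp_support_slices:
  assumes "\<pi> \<in> plane_partitions_in r c"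
  shows "pp_support \<pi> \<subseteq> (\<lambda>(k, p). (p + 1 + (r - k), p + 1 + (k - r))) ` ({1..<r + c} \<times> {..<r + c})"
proof
  fix x assume x: "x \<in> pp_support \<pi>"
  obtain i j where ij: "x = (i, j)" by (cases x)
  have "\<pi> i j > 0" using x ij by (simp add: pp_support_def)
  hence b: "1 \<le> i" "1 \<le> j" "i \<le> r" "j \<le> c"
    using assms plane_partitionD(1)[of \<pi> i j] by (auto simp: plane_partitions_in_def not_less[symmetric])
  have "min i j - 1 + 1 + (r - (r + j - i)) = i" "min i j - 1 + 1 + (r + j - i - r) = j"
    using b by (auto simp: min_def)
  hence "x = (\<lambda>(k, p). (p + 1 + (r - k), p + 1 + (k - r))) (r + j - i, min i j - 1)" by (simp only: ij prod.case)
  moreover have "(r + j - i, min i j - 1) \<in> {1..<r + c} \<times> {..<r + c}" using b by auto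
  ultimately show "x \<in> (\<lambda>(k, p). (p + 1 + (r - k), p + 1 + (k - r))) ` ({1..<r + c} \<times> {..<r + c})"
    by blast
qed

lemma pp_weight_slices:
  assumes \<pi>: "\<pi> \<in> plane_partitions_in r c"
  shows "pp_weight \<pi> = (\<Sum>k<r + c. part_size (slice r \<pi> k))"
proof -
  let ?\<beta> = "\<lambda>(k, p). (p + 1 + (r - k), p + 1 + (k - r)) :: nat \<times> nat"
  have z: "zero_from (r + c) (slice r \<pi> k)" for k
    using \<pi> by (auto simp: zero_from_def slice_def plane_partitions_in_def)
  have "pp_weight \<pi> = (\<Sum>(i, j)\<in>?\<beta> ` ({1..<r + c} \<times> {..<r + c}). \<pi> i j)"
    unfolding pp_weight_def using pp_support_slices[OF \<pi>]
    by (intro sum.mono_neutral_left) (auto simp: pp_support_def)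
  also have "\<dots> = (\<Sum>(k, p)\<in>{1..<r + c} \<times> {..<r + c}. slice r \<pi> k p)"
    by (subst sum.reindex[OF inj_on_subset[OF slice_box_inj subset_UNIV]])
      (auto intro!: sum.cong simp: slice_def)
  also have "\<dots> = (\<Sum>k\<in>{1..<r + c}. part_size (slice r \<pi> k))"
    by (simp add: sum.cartesian_product[symmetric] part_size_eq[OF z])
  also have "\<dots> = (\<Sum>k<r + c. part_size (slice r \<pi> k))"
    using slice_in[OF \<pi>] partition_one_row(2)[of 0]
    by (intro sum.mono_neutral_left) (auto simp: slice_paths_def not_le less_Suc_eq_0_disj)
  finally show ?thesis .
qed

section \<open>The weight of a plane partition in terms of its slices\<close>

context generic_qt
begin

text \<open>The partitions below and to the right of the box are read along slices
  \<open>k - 1\<close> and \<open>k + 1\<close>. Whether they start at position \<open>p\<close> or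
  \<open>p + 1\<close> depends on the side of the main diagonal, so \<open>wl\<close> and
  \<open>wr\<close> change roles there. Dividing all four factors by
  \<open>g (\<sigma> k p) m\<close> leaves the quotient unchanged.\<close>

lemma F_box_slices:
  assumes \<pi>: "\<pi> \<in> plane_partitions_in r c" and k: "1 \<le> k"
  defines "\<sigma> \<equiv> slice r \<pi>"
  shows "F_box q t \<pi> (p + 1 + (r - k)) (p + 1 + (k - r)) = (\<Prod>m<r + c.
    (if k \<le> r then wl (\<sigma> k) (\<sigma> (k - 1)) p m else wr (\<sigma> (k - 1)) (\<sigma> k) p m) *
    (if k < r then wr (\<sigma> (Suc k)) (\<sigma> k) p m else wl (\<sigma> k) (\<sigma> (Suc k)) p m) /
    (wl (\<sigma> k) (\<sigma> k) p m * wr (\<sigma> k) (\<sigma> k) p m))"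
proof -
  define i where "i = p + 1 + (r - k)"
  define j where "j = p + 1 + (k - r)"
  have lam: "diag_part \<pi> i j (m + 1) = \<sigma> k (p + m)" for m
    unfolding diag_part_def \<sigma>_def slice_def i_def j_def
    by (rule arg_cong2[of _ _ _ _ \<pi>]) auto
  have lam1: "diag_part \<pi> i j 1 = \<sigma> k p" using lam[of 0] by simp
  have lam2: "diag_part \<pi> i j (m + 2) = \<sigma> k (p + m + 1)" for m using lam[of "m + 1"] by simp
  have mu: "diag_part \<pi> (i + 1) j (m + 1) = (if k \<le> r then \<sigma> (k - 1) (p + m) else \<sigma> (k - 1) (p + m + 1))" for m
  proof (cases "k \<le> r")
    case True
    hence "i + 1 + (m + 1) - 1 = p + m + 1 + (r - (k - 1))" "j + (m + 1) - 1 = p + m + 1 + (k - 1 - r)"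
      using k by (auto simp: i_def j_def)
    thus ?thesis using True by (simp only: diag_part_def \<sigma>_def slice_def if_True)
  next
    case False
    hence "i + 1 + (m + 1) - 1 = p + m + 1 + 1 + (r - (k - 1))" "j + (m + 1) - 1 = p + m + 1 + 1 + (k - 1 - r)"
      using k by (auto simp: i_def j_def)
    thus ?thesis using False by (simp only: diag_part_def \<sigma>_def slice_def if_False)
  qed
  have nu: "diag_part \<pi> i (j + 1) (m + 1) = (if k < r then \<sigma> (Suc k) (p + m + 1) else \<sigma> (Suc k) (p + m))" for m
  proof (cases "k < r")
    case True
    hence "i + (m + 1) - 1 = p + m + 1 + 1 + (r - Suc k)" "j + 1 + (m + 1) - 1 = p + m + 1 + 1 + (Suc k - r)"
      using k by (auto simp: i_def j_def)
    thus ?thesis using True by (simp only: diag_part_def \<sigma>_def slice_def if_True)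
  next
    case False
    hence "i + (m + 1) - 1 = p + m + 1 + (r - Suc k)" "j + 1 + (m + 1) - 1 = p + m + 1 + (Suc k - r)"
      using k by (auto simp: i_def j_def)
    thus ?thesis using False by (simp only: diag_part_def \<sigma>_def slice_def if_False)
  qed
  define h where "h m = (g (diag_part \<pi> i j 1 - diag_part \<pi> (i + 1) j (m + 1)) m *
      g (diag_part \<pi> i j 1 - diag_part \<pi> i (j + 1) (m + 1)) m) /
     (g (diag_part \<pi> i j 1 - diag_part \<pi> i j (m + 1)) m * g (diag_part \<pi> i j 1 - diag_part \<pi> i j (m + 2)) m)" for m
  have h: "h m = (if k \<le> r then wl (\<sigma> k) (\<sigma> (k - 1)) p m else wr (\<sigma> (k - 1)) (\<sigma> k) p m) *
    (if k < r then wr (\<sigma> (Suc k)) (\<sigma> k) p m else wl (\<sigma> k) (\<sigma> (Suc k)) p m) /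
    (wl (\<sigma> k) (\<sigma> k) p m * wr (\<sigma> k) (\<sigma> k) p m)" for m
  proof -
    have frac: "a * b / (c * d) = (a / e) * (b / e) / ((c / e) * (d / e))" if "e \<noteq> 0" for a b c d e :: 'a
      using that by simp
    show ?thesis
      unfolding h_def lam lam1 lam2 mu nu wl_def wr_def
      by (rule trans[OF frac[OF g_nz[of "\<sigma> k p" m]]]) (cases "k \<le> r"; cases "k < r"; simp only: if_True if_False)
  qed
  have z: "\<sigma> k' i' = 0" if "r + c \<le> i'" for k' i'
    using \<pi> that by (auto simp: \<sigma>_def slice_def plane_partitions_in_def)
  have "h m = 1" if "r + c \<le> m" for m
    unfolding h_def lam lam1 lam2 mu nu using that g_nz by (auto simp: z)
  hence "{m. h m \<noteq> 1} \<subseteq> {..<r + c}" by (auto simp: not_le[symmetric])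
  hence "Prod_any h = (\<Prod>m<r + c. h m)" by (intro Prod_any.expand_superset) auto
  moreover have "F_box q t \<pi> i j = Prod_any h" unfolding F_box_def Let_def h_def ..
  ultimately show ?thesis unfolding h i_def j_def by simp
qed

lemma F_box_outside: "\<pi> i j = 0 \<Longrightarrow> F_box q t \<pi> i j = 1"
  by (simp add: F_box_def diag_part_def g_0)

text \<open>The factors are regrouped from slices to steps: those of slice \<open>k\<close> towards
  \<open>k - 1\<close> and those of slice \<open>k - 1\<close> towards \<open>k\<close> together
  form the weight of the pair, and the denominators of slice \<open>k\<close> form
  \<open>W (\<sigma> k) (\<sigma> k)\<close>.\<close>

lemma F_pp_path_weight:
  assumes \<pi>: "\<pi> \<in> plane_partitions_in r c" and r: "r \<ge> 1" and c: "c \<ge> 1"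
  shows "F_pp q t \<pi> = path_weight r (r + c) (slice r \<pi>)"
proof -
  let ?\<beta> = "\<lambda>(k, p). (p + 1 + (r - k), p + 1 + (k - r)) :: nat \<times> nat"
  define \<sigma> where "\<sigma> = slice r \<pi>"
  have \<sigma>: "\<sigma> \<in> slice_paths r c" unfolding \<sigma>_def by (rule slice_in[OF \<pi>])
  have z: "zero_from (r + c) (\<sigma> k)" for k
    using \<pi> by (auto simp: \<sigma>_def zero_from_def slice_def plane_partitions_in_def)
  define lw where "lw k p m = (if k \<le> r then wl (\<sigma> k) (\<sigma> (k - 1)) p m else wr (\<sigma> (k - 1)) (\<sigma> k) p m)" for k p m
  define rw where "rw k p m = (if k < r then wr (\<sigma> (Suc k)) (\<sigma> k) p m else wl (\<sigma> k) (\<sigma> (Suc k)) p m)" for k p m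
  define L where "L k = (\<Prod>p<r + c. \<Prod>m<r + c. lw k p m)" for k
  define R where "R k = (\<Prod>p<r + c. \<Prod>m<r + c. rw k p m)" for k
  have il: "interlaced (\<sigma> k) (\<sigma> k)" for k
    using \<sigma> by (intro interlaced_refl) (simp add: slice_paths_def is_partition_def)
  obtain M where M: "r + c = Suc M" using r by (cases "r + c") auto
  have "F_pp q t \<pi> = (\<Prod>(i, j)\<in>?\<beta> ` ({1..<r + c} \<times> {..<r + c}). F_box q t \<pi> i j)"
    unfolding F_pp_def using pp_support_slices[OF \<pi>]
    by (intro prod.mono_neutral_left) (auto simp: pp_support_def intro!: F_box_outside)
  also have "\<dots> = (\<Prod>(k, p)\<in>{1..<r + c} \<times> {..<r + c}. F_box q t \<pi> (p + 1 + (r - k)) (p + 1 + (k - r)))"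
    by (subst prod.reindex[OF inj_on_subset[OF slice_box_inj subset_UNIV]]) (auto intro!: prod.cong)
  also have "\<dots> = (\<Prod>k\<in>{1..<r + c}. \<Prod>p<r + c. F_box q t \<pi> (p + 1 + (r - k)) (p + 1 + (k - r)))"
    by (simp add: prod.cartesian_product[symmetric])
  also have "\<dots> = (\<Prod>k\<in>{1..<r + c}. L k * R k / W (\<sigma> k) (\<sigma> k))"
  proof (rule prod.cong)
    fix k assume "k \<in> {1..<r + c}"
    hence k: "1 \<le> k" by simp
    show "(\<Prod>p<r + c. F_box q t \<pi> (p + 1 + (r - k)) (p + 1 + (k - r))) = L k * R k / W (\<sigma> k) (\<sigma> k)"
      unfolding F_box_slices[OF \<pi> k] \<sigma>_def[symmetric] L_def R_def lw_def[symmetric] rw_def[symmetric]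
        W_eq[OF il z] by (simp add: prod_dividef prod.distrib)
  qed simp
  also have "\<dots> = (\<Prod>j<M. L (Suc j) * R (Suc j) / W (\<sigma> (Suc j)) (\<sigma> (Suc j)))"
    unfolding M by (rule prod.reindex_bij_witness[of _ Suc "\<lambda>k. k - 1"]) auto
  also have "\<dots> = (\<Prod>j<M. L (Suc j)) * (\<Prod>j<M. R (Suc j)) / (\<Prod>j<M. W (\<sigma> (Suc j)) (\<sigma> (Suc j)))"
    by (simp add: prod_dividef prod.distrib)
  finally have F: "F_pp q t \<pi> = \<dots>" .
  have step: "step_weight r j (\<sigma> j) (\<sigma> (Suc j)) = L (Suc j) * R j / W (\<sigma> j) (\<sigma> j)" if j: "j < r + c" for j
  proof (cases "j < r")
    case True
    have "interlaced (\<sigma> (Suc j)) (\<sigma> j)" using \<sigma> True by (simp add: slice_paths_def)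
    thus ?thesis using True by (simp add: step_weight_def W_eq[OF _ z, of "Suc j"] L_def R_def lw_def rw_def)
  next
    case False
    have "interlaced (\<sigma> j) (\<sigma> (Suc j))" using \<sigma> False j by (simp add: slice_paths_def)
    from W_eq[OF this z] show ?thesis using False
      by (simp add: step_weight_def L_def R_def lw_def rw_def mult.commute)
  qed
  have ends: "\<sigma> 0 = one_row 0" "\<sigma> (Suc M) = one_row 0"
    using \<sigma> M by (auto simp: slice_paths_def)
  \<comment> \<open>The end slices are empty, so the regrouping leaves no boundary terms;
    \<open>r \<ge> 1\<close> and \<open>c \<ge> 1\<close> decide which case of \<open>rw\<close> and
    \<open>lw\<close> applies.\<close>
  have R0: "R 0 = 1" using r g_nz by (simp add: R_def rw_def wr_def ends g_0)
  have LM: "L (Suc M) = 1" using c M g_nz by (simp add: L_def lw_def wr_def ends g_0)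
  have "path_weight r (r + c) \<sigma> = (\<Prod>j<Suc M. L (Suc j) * R j / W (\<sigma> j) (\<sigma> j))"
    unfolding path_weight_def M[symmetric] by (intro prod.cong) (auto simp: step)
  also have "\<dots> = (\<Prod>j<Suc M. L (Suc j)) * (\<Prod>j<Suc M. R j) / (\<Prod>j<Suc M. W (\<sigma> j) (\<sigma> j))"
    by (simp only: prod_dividef prod.distrib)
  also have "(\<Prod>j<Suc M. L (Suc j)) = (\<Prod>j<M. L (Suc j))" by (simp add: LM)
  also have "(\<Prod>j<Suc M. R j) = (\<Prod>j<M. R (Suc j))" by (simp add: prod.lessThan_Suc_shift R0 del: prod.lessThan_Suc)
  also have "(\<Prod>j<Suc M. W (\<sigma> j) (\<sigma> j)) = (\<Prod>j<M. W (\<sigma> (Suc j)) (\<sigma> (Suc j)))"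
    by (simp add: prod.lessThan_Suc_shift ends W_row_0 del: prod.lessThan_Suc)
  finally show ?thesis unfolding F \<sigma>_def ..
qed

theorem plane_partitions_coeff:
  assumes r: "r \<ge> 1" and c: "c \<ge> 1"
  shows "(\<Sum>\<pi>\<in>{\<pi> \<in> plane_partitions_in r c. pp_weight \<pi> = n}. F_pp q t \<pi>) =
    fps_nth (\<Prod>i=1..r. \<Prod>j=1..c. Bser (i + j - 1)) n"
proof -
  let ?total = "\<lambda>\<sigma>. \<Sum>j<r + c. part_size (\<sigma> j)"
  let ?G = "{\<sigma> \<in> slice_paths r c. ?total \<sigma> = n}"
  have "fps_nth (\<Prod>i=1..r. \<Prod>j=1..c. Bser (i + j - 1)) n = fps_nth (path_sum r (r + c) (one_row 0)) n"
    by (simp only: path_sum_closed)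
  also have "\<dots> = (\<Sum>\<sigma>\<in>paths n (r + c) (one_row 0). if ?total \<sigma> = n then path_weight r (r + c) \<sigma> else 0)"
    by (rule path_sum_nth) (simp_all add: parts_upto_def partition_one_row)
  also have "\<dots> = (\<Sum>\<sigma>\<in>?G. path_weight r (r + c) \<sigma>)"
  proof (rule sum.mono_neutral_cong_right)
    show "?G \<subseteq> paths n (r + c) (one_row 0)"
    proof
      fix \<sigma> assume \<sigma>: "\<sigma> \<in> ?G"
      have "part_size (\<sigma> j) \<le> n" for j
      proof (cases "j < r + c")
        case True
        hence "part_size (\<sigma> j) \<le> ?total \<sigma>" by (intro member_le_sum) auto
        thus ?thesis using \<sigma> by simp
      next
        case False
        thus ?thesis using \<sigma> partition_one_row(2)[of 0] by (simp add: slice_paths_def)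
      qed
      thus "\<sigma> \<in> paths n (r + c) (one_row 0)"
        using \<sigma> by (auto simp: paths_def slice_paths_def parts_upto_def)
    qed
    \<comment> \<open>A path of total size \<open>n\<close> that is not a slice path violates
      interlacing somewhere, and that step has weight 0.\<close>
    show "\<forall>\<sigma>\<in>paths n (r + c) (one_row 0) - ?G. (if ?total \<sigma> = n then path_weight r (r + c) \<sigma> else 0) = 0"
    proof (rule ballI, rule ccontr)
      fix \<sigma> assume \<sigma>: "\<sigma> \<in> paths n (r + c) (one_row 0) - ?G"
        and "(if ?total \<sigma> = n then path_weight r (r + c) \<sigma> else 0) \<noteq> 0"
      hence t: "?total \<sigma> = n" and "path_weight r (r + c) \<sigma> \<noteq> 0" by (auto split: if_splits)
      hence nz: "step_weight r j (\<sigma> j) (\<sigma> (Suc j)) \<noteq> 0" if "j < r + c" for j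
        using that by (auto simp: path_weight_def)
      have "interlaced (\<sigma> (Suc k)) (\<sigma> k)" if "k < r" for k
        using nz[of k] that W_nonzeroD by (auto simp: step_weight_def)
      moreover have "interlaced (\<sigma> k) (\<sigma> (Suc k))" if "r \<le> k" "k < r + c" for k
        using nz[of k] that W_nonzeroD by (auto simp: step_weight_def)
      moreover have "is_partition (\<sigma> k)" for k
        using \<sigma> partition_one_row(1)[of 0] by (cases "k \<le> r + c") (auto simp: paths_def parts_upto_def split: if_splits)
      moreover have "\<sigma> 0 = one_row 0" using \<sigma> by (simp add: paths_def)
      moreover have "\<sigma> k = one_row 0" if "k \<ge> r + c" for k
        using \<sigma> that by (cases "k = r + c") (auto simp: paths_def split: if_splits)
      ultimately have "\<sigma> \<in> ?G" using t by (simp add: slice_paths_def)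
      thus False using \<sigma> by simp
    qed
  qed (auto simp: finite_paths)
  also have "\<dots> = (\<Sum>\<pi>\<in>{\<pi> \<in> plane_partitions_in r c. pp_weight \<pi> = n}. F_pp q t \<pi>)"
  proof (rule sum.reindex_bij_witness[of _ "slice r" "unslice r c"])
    fix \<sigma> assume \<sigma>: "\<sigma> \<in> ?G"
    hence p: "unslice r c \<sigma> \<in> plane_partitions_in r c" and s: "slice r (unslice r c \<sigma>) = \<sigma>"
      by (auto intro: unslice_in slice_unslice)
    show "slice r (unslice r c \<sigma>) = \<sigma>" by (rule s)
    show "unslice r c \<sigma> \<in> {\<pi> \<in> plane_partitions_in r c. pp_weight \<pi> = n}"
      using p \<sigma> by (simp add: pp_weight_slices s)
    show "F_pp q t (unslice r c \<sigma>) = path_weight r (r + c) \<sigma>"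
      by (simp add: F_pp_path_weight[OF p r c] s)
  next
    fix \<pi> assume \<pi>: "\<pi> \<in> {\<pi> \<in> plane_partitions_in r c. pp_weight \<pi> = n}"
    thus "unslice r c (slice r \<pi>) = \<pi>" by (simp add: unslice_slice)
    show "slice r \<pi> \<in> ?G" using \<pi> pp_weight_slices[of \<pi> r c] by (simp add: slice_in)
  qed
  finally show ?thesis ..
qed

end

text \<open>Coefficients up to \<open>n\<close> only see the factors with exponent at most \<open>n\<close>, and the exponent
  \<open>e = i + j - 1\<close> occurs \<open>e\<close> times.\<close>

lemma square_prod_nth:
  fixes B :: "nat \<Rightarrow> 'a::comm_ring_1 fps"
  assumes B: "\<And>e i. i < e \<Longrightarrow> fps_nth (B e) i = (if i = 0 then 1 else 0)" and n: "n \<le> m"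
  shows "fps_nth (\<Prod>i=1..m. \<Prod>j=1..m. B (i + j - 1)) n = fps_nth (\<Prod>e=1..m. B e ^ e) n"
proof -
  let ?T = "{(i, j) \<in> {1..m} \<times> {1..m}. i + j - 1 \<le> m}"
  let ?U = "{(i, j) \<in> {1..m} \<times> {1..m}. i + j - 1 > m}"
  have low: "fps_nth (f * h) n = fps_nth f n" if "\<And>i. i \<le> n \<Longrightarrow> fps_nth h i = (if i = 0 then 1 else 0)"
    for f h :: "'a fps" and n
  proof -
    have "fps_nth (f * h) n = (\<Sum>i=0..n. if i = n then fps_nth f i else 0)"
      unfolding fps_mult_nth using that by (intro sum.cong) auto
    thus ?thesis by simp
  qed
  \<comment> \<open>Factors whose exponent exceeds \<open>m \<ge> n\<close> agree with 1 up to
    coefficient \<open>n\<close>.\<close>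
  have U: "fps_nth (\<Prod>(i, j)\<in>V. B (i + j - 1)) k = (if k = 0 then 1 else 0)"
    if "finite V" "V \<subseteq> ?U" "k \<le> n" for V k
    using that
  proof (induction V arbitrary: k rule: finite_induct)
    case (insert x V)
    obtain i j where x: "x = (i, j)" by (cases x)
    have "k < i + j - 1" using insert.prems n by (auto simp: x)
    have "fps_nth (\<Prod>(i, j)\<in>insert x V. B (i + j - 1)) k = fps_nth (B (i + j - 1) * (\<Prod>(i, j)\<in>V. B (i + j - 1))) k"
      using insert.hyps by (simp add: x)
    also have "\<dots> = fps_nth (B (i + j - 1)) k"
      using insert.prems by (intro low insert.IH) auto
    finally show ?case using B[OF \<open>k < i + j - 1\<close>] by simp
  qed simp
  have fin: "finite ?T" "finite ?U" by (auto intro: finite_subset[of _ "{1..m} \<times> {1..m}"])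
  have "(\<Prod>i=1..m. \<Prod>j=1..m. B (i + j - 1)) = (\<Prod>(i, j)\<in>?T \<union> ?U. B (i + j - 1))"
    unfolding prod.cartesian_product by (intro prod.cong) auto
  also have "\<dots> = (\<Prod>(i, j)\<in>?T. B (i + j - 1)) * (\<Prod>(i, j)\<in>?U. B (i + j - 1))"
    using fin by (intro prod.union_disjoint) auto
  finally have "fps_nth (\<Prod>i=1..m. \<Prod>j=1..m. B (i + j - 1)) n = fps_nth (\<Prod>(i, j)\<in>?T. B (i + j - 1)) n"
    using low[of n "\<Prod>(i, j)\<in>?U. B (i + j - 1)"] U[OF fin(2) subset_refl] by simp
  also have "(\<Prod>(i, j)\<in>?T. B (i + j - 1)) = (\<Prod>(e, i)\<in>(SIGMA e:{1..m}. {1..e}). B e)"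
    by (rule prod.reindex_bij_witness[of _ "\<lambda>(e, i). (i, e + 1 - i)" "\<lambda>(i, j). (i + j - 1, i)"]) auto
  also have "\<dots> = (\<Prod>e=1..m. B e ^ e)"
    by (subst prod.Sigma[symmetric]) auto
  finally show ?thesis .
qed

theorem theoremA:
  shows "(\<forall>r c. r \<ge> 1 \<longrightarrow> c \<ge> 1 \<longrightarrow>
            ((\<lambda>\<pi>. fps_const (F_pp Qvar Tvar \<pi>) * fps_X ^ pp_weight \<pi>) has_sum
              (\<Prod>i=1..r. \<Prod>j=1..c.
                 qpoch_inf (fps_const Tvar * fps_X ^ (i + j - 1)) /
                 qpoch_inf (fps_X ^ (i + j - 1))))
            (plane_partitions_in r c))
       \<and> (\<exists>R. (\<lambda>n. (qpoch_inf (fps_const Tvar * fps_X ^ (n + 1)) /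
                     qpoch_inf (fps_X ^ (n + 1))) ^ (n + 1)) has_prod R \<and>
            ((\<lambda>\<pi>. fps_const (F_pp Qvar Tvar \<pi>) * fps_X ^ pp_weight \<pi>) has_sum R)
              plane_partitions)"
proof (intro conjI allI impI)
  fix r c :: nat assume rc: "r \<ge> 1" "c \<ge> 1"
  have fin: "finite {\<pi> \<in> plane_partitions_in r c. pp_weight \<pi> = n}" for n
    by (rule finite_subset[OF _ finite_plane_partitions[of n]]) (auto simp: plane_partitions_in_def)
  have "(\<Prod>i=1..r. \<Prod>j=1..c. qpoch_inf (fps_const Tvar * fps_X ^ (i + j - 1)) / qpoch_inf (fps_X ^ (i + j - 1)))
      = (\<Prod>i=1..r. \<Prod>j=1..c. qt.Bser (i + j - 1))"
    by (intro prod.cong refl qpoch_inf_quotient) auto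
  also have "\<dots> = Abs_fps (\<lambda>n. \<Sum>\<pi>\<in>{\<pi> \<in> plane_partitions_in r c. pp_weight \<pi> = n}. F_pp Qvar Tvar \<pi>)"
    by (rule fps_ext) (simp only: fps_nth_Abs_fps qt.plane_partitions_coeff[OF rc])
  finally show "((\<lambda>\<pi>. fps_const (F_pp Qvar Tvar \<pi>) * fps_X ^ pp_weight \<pi>) has_sum
      (\<Prod>i=1..r. \<Prod>j=1..c. qpoch_inf (fps_const Tvar * fps_X ^ (i + j - 1)) / qpoch_inf (fps_X ^ (i + j - 1))))
      (plane_partitions_in r c)"
    using fps_has_sum_X_powers[OF fin] by simp
next
  define R where "R = Abs_fps (\<lambda>n. \<Sum>\<pi>\<in>{\<pi> \<in> plane_partitions. pp_weight \<pi> = n}. F_pp Qvar Tvar \<pi>)"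
  have B: "fps_nth (qt.Bser e) i = (if i = 0 then 1 else 0)" if "i < e" for e i
    using that by (auto simp: fps_X_power_compose_nth qt.binomial_series_def qt.g_0 dest: dvd_imp_le)
  have R: "fps_nth R n = fps_nth (\<Prod>e=1..m. qt.Bser e ^ e) n" if "n < m" for n m
  proof -
    \<comment> \<open>A plane partition of weight \<open>n < m\<close> fits into the
      \<open>m\<close> by \<open>m\<close> square, so the unrestricted coefficient is supplied by
      the rectangular case.\<close>
    have "{\<pi> \<in> plane_partitions. pp_weight \<pi> = n} = {\<pi> \<in> plane_partitions_in m m. pp_weight \<pi> = n}"
      using plane_partition_in_square(1)[of _ m] that by (auto simp: plane_partitions_in_def)
    hence "fps_nth R n = fps_nth (\<Prod>i=1..m. \<Prod>j=1..m. qt.Bser (i + j - 1)) n"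
      using qt.plane_partitions_coeff[of m m n] that by (simp add: R_def)
    also have "\<dots> = fps_nth (\<Prod>e=1..m. qt.Bser e ^ e) n"
      using B that by (intro square_prod_nth) auto
    finally show ?thesis .
  qed
  have partial: "(\<Prod>k\<le>K. (qpoch_inf (fps_const Tvar * fps_X ^ (k + 1)) / qpoch_inf (fps_X ^ (k + 1))) ^ (k + 1)) =
      (\<Prod>e=1..Suc K. qt.Bser e ^ e)" for K
    unfolding qpoch_inf_quotient[of "_ + 1", OF le_add2]
    by (rule prod.reindex_bij_witness[of _ "\<lambda>e. e - 1" Suc]) auto
  have "(\<lambda>K. \<Prod>k\<le>K. (qpoch_inf (fps_const Tvar * fps_X ^ (k + 1)) / qpoch_inf (fps_X ^ (k + 1))) ^ (k + 1)) \<longlonglongrightarrow> R"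
    unfolding partial
  proof (rule tendsto_fpsI)
    fix n
    show "\<forall>\<^sub>F K in sequentially. fps_nth (\<Prod>e=1..Suc K. qt.Bser e ^ e) n = fps_nth R n"
      using eventually_ge_at_top[of n] by eventually_elim (rule R[symmetric], simp)
  qed
  \<comment> \<open>\<open>has_prod\<close> asks for a nonzero limit, and the constant term provides
    it.\<close>
  moreover have "fps_nth R 0 = 1"
    using R[of 0 1] B[of 0 1] by simp
  hence "R \<noteq> 0" by auto
  ultimately have "(\<lambda>n. (qpoch_inf (fps_const Tvar * fps_X ^ (n + 1)) / qpoch_inf (fps_X ^ (n + 1))) ^ (n + 1)) has_prod R"
    unfolding has_prod_def raw_has_prod_def by simp
  moreover have "((\<lambda>\<pi>. fps_const (F_pp Qvar Tvar \<pi>) * fps_X ^ pp_weight \<pi>) has_sum R) plane_partitions"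
    unfolding R_def by (rule fps_has_sum_X_powers[OF finite_plane_partitions])
  ultimately show "\<exists>R. (\<lambda>n. (qpoch_inf (fps_const Tvar * fps_X ^ (n + 1)) /
                     qpoch_inf (fps_X ^ (n + 1))) ^ (n + 1)) has_prod R \<and>
            ((\<lambda>\<pi>. fps_const (F_pp Qvar Tvar \<pi>) * fps_X ^ pp_weight \<pi>) has_sum R)
              plane_partitions"
    by blast
qed

end
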